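(* Let $0<s<1$, $m>0$, $L=(-\Delta)^s$, let $f\in L^1(\mathbb{R}^N)$ with $f\ge0$, and let $u$ be the unique solution of $Lu^m+u=f$ in $\mathbb{R}^N$. Let $H$ be a hyperplane dividing $\mathbb{R}^N$ into two half-spaces $\Omega_1,\Omega_2$, and let $\Pi$ be the reflection with respect to $H$ (mapping $\Omega_1$ onto $\Omega_2$). If $f(x)\ge f(\Pi(x))$ for $x\in\Omega_1$, then $u(x)\ge u(\Pi(x))$ for $x\in\Omega_1$.
   Context: $(-\Delta)^s$ is the fractional Laplacian with Fourier symbol $|\xi|^{2s}$. For $f\in L^1(\mathbb{R}^N)$ the problem $(-\Delta)^s(u^m)+u=f$ has a unique (weak) solution $u\in L^1(\mathbb{R}^N)$, the resolvent of the $m$-accretive operator $u\mapsto(-\Delta)^s(u^m)$ in $L^1(\mathbb{R}^N)$, and the map $f\mapsto u$ is an ordered $L^1$-contraction. *)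

theory Defs
  imports "HOL-Analysis.Analysis"
begin

fun Ck_fun :: "nat \<Rightarrow> ('a::euclidean_space \<Rightarrow> real) \<Rightarrow> bool" where
  "Ck_fun 0 f = continuous_on UNIV f"
| "Ck_fun (Suc k) f =
     (\<exists>f'. (\<forall>x. (f has_derivative f' x) (at x)) \<and> (\<forall>v. Ck_fun k (\<lambda>x. f' x v)))"

definition smooth_fun :: "('a::euclidean_space \<Rightarrow> real) \<Rightarrow> bool" where
  "smooth_fun f \<longleftrightarrow> (\<forall>k. Ck_fun k f)"

definition test_fun :: "('a::euclidean_space \<Rightarrow> real) \<Rightarrow> bool" where
  "test_fun \<phi> \<longleftrightarrow> smooth_fun \<phi> \<and> compact (closure {x. \<phi> x \<noteq> 0})"

text \<open>Normalising constant C(N,s) = s 4^s Gamma(N/2+s) / (pi^(N/2) Gamma(1-s)),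
  which makes the operator below have Fourier symbol |xi|^(2s).\<close>
definition frac_const :: "nat \<Rightarrow> real \<Rightarrow> real" where
  "frac_const N s = s * 4 powr s * Gamma (real N / 2 + s) / (pi powr (real N / 2) * Gamma (1 - s))"

definition frac_lap :: "real \<Rightarrow> ('a::euclidean_space \<Rightarrow> real) \<Rightarrow> 'a \<Rightarrow> real" where
  "frac_lap s \<phi> x = frac_const DIM('a) s / 2 *
     (\<integral>z. (2 * \<phi> x - \<phi> (x + z) - \<phi> (x - z)) / norm z powr (real DIM('a) + 2 * s) \<partial>lborel)"

definition spow :: "real \<Rightarrow> real \<Rightarrow> real" where
  "spow m t = sgn t * \<bar>t\<bar> powr m"

definition frac_weak_sol :: "real \<Rightarrow> real \<Rightarrow> ('a::euclidean_space \<Rightarrow> real) \<Rightarrow> ('a \<Rightarrow> real) \<Rightarrow> bool" where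
  "frac_weak_sol s m f u \<longleftrightarrow>
     integrable lborel u \<and>
     integrable lborel (\<lambda>x. \<bar>u x\<bar> powr m / (1 + norm x) powr (real DIM('a) + 2 * s)) \<and>
     (\<forall>\<phi>. test_fun \<phi> \<longrightarrow>
        (\<integral>x. spow m (u x) * frac_lap s \<phi> x \<partial>lborel) + (\<integral>x. u x * \<phi> x \<partial>lborel)
          = (\<integral>x. f x * \<phi> x \<partial>lborel))"

definition hyp_refl :: "'a::euclidean_space \<Rightarrow> real \<Rightarrow> 'a \<Rightarrow> 'a" where
  "hyp_refl a b x = x - (2 * (a \<bullet> x - b) / (a \<bullet> a)) *\<^sub>R a"

end

theory Submission
  imports Defs
begin

text \<open>Put \<open>U = u\<^sup>m\<close>, write \<open>\<Pi>\<close> for the reflection and let \<open>Z = U \<circ> \<Pi> - U\<close>, which is odd under \<open>\<Pi>\<close> and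
  satisfies \<open>L Z = k \<circ> \<Pi> - k\<close> with \<open>k = f - u\<close>. On the half-space this right-hand side is nonpositive
  wherever \<open>Z > 0\<close>. Fix a level \<open>\<theta> > 0\<close> and let \<open>Y\<close> be the part of \<open>Z - \<theta>\<close> above \<open>0\<close> in the half-space,
  extended by zero; it lives on a set \<open>E\<close> of finite measure because \<open>u\<close> is integrable. Since the kernel
  \<open>|z|\<^bsup>-p\<^esup>\<close>, \<open>p = N + 2s\<close>, is radially decreasing, oddness of \<open>Z\<close> gives the Kato inequality
  \<open>L Y \<le> 1\<^bsub>E\<^esub> L Z\<close> on the whole space. Integrate it against the weight \<open>w(x) = (1 + |x/T|\<^sup>2)\<^bsup>-p/2\<^esup>\<close>,
  treating jumps shorter and longer than \<open>r\<close> separately: the long ones contribute at least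
  \<open>c r\<^bsup>-2s\<^esup> (1 - C |E| r\<^bsup>-N\<^esup>) \<integral> w Y\<close>, the short ones at least \<open>- C(r) T\<^bsup>-2\<^esup> \<integral> w Y\<close>. Taking \<open>r\<close> large and then \<open>T\<close>
  large forces \<open>Y = 0\<close>, and \<open>\<theta> \<rightarrow> 0\<close> gives \<open>Z \<le> 0\<close>. To make this rigorous for weak solutions the equation is
  mollified and the kernel is truncated near the origin.\<close>

section \<open>Reflections and Lebesgue measure\<close>

text \<open>The solution concept controls \<open>U\<close> only in L1 with weight (1 + |x|)^(-p), so
  nothing can be integrated against 1. A weight decaying like the kernel works because it is stable:
  convolved with itself, or with any kernel of the same decay, it stays below a multiple of itself.
  The two error terms arise as follows. A long jump from E back into E costs at most C r^(-p) |E|,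
  while the total mass of long jumps is of order r^(-2s) = r^(N-p); hence the gain r^(-N). Short
  jumps see only the second difference of w, at most C |z|^2 T^(-2) w; being relative to w, it
  closes on the integral of w Y. That cost does not depend on the truncation, and r and T depend
  only on the limiting level set, so both stay fixed while first the truncation and then the
  mollification is removed. The sign of the right-hand side comes from k o Pi - k = (f o Pi - f) -
  (u o Pi - u), where Z > 0 means u o Pi > u. The positive level gives finite measure by Chebyshev.
  The superlevel sets of the mollified functions need not converge on {Z = level}, so the limit is
  taken with the non-strict level set, where the sign is still available.\<close>

lemma le_abs_trans: "(a::real) \<le> b \<Longrightarrow> a \<le> \<bar>b\<bar>"
  by linarith

lemmas L1_dominated = Bochner_Integration.integrable_bound
  and L1_add = Bochner_Integration.integrable_add
  and L1_diff = Bochner_Integration.integrable_diff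
  and L1_integral_add = Bochner_Integration.integral_add
  and L1_integral_diff = Bochner_Integration.integral_diff
  and L1_integral_cong = Bochner_Integration.integral_cong

lemma lborel_distr_neg: "distr lborel borel uminus = (lborel :: 'a::euclidean_space measure)"
  using lborel_affine[of "-1" "0::'a"] by (simp add: density_1)

lemma nn_integral_lborel_add:
  fixes f :: "'a::euclidean_space \<Rightarrow> ennreal"
  assumes [measurable]: "f \<in> borel_measurable borel"
  shows "(\<integral>\<^sup>+x. f (c + x) \<partial>lborel) = (\<integral>\<^sup>+x. f x \<partial>lborel)"
  by (subst (2) lborel_distr_plus[symmetric, of c]) (simp add: nn_integral_distr)

lemma nn_integral_lborel_diff:
  fixes f :: "'a::euclidean_space \<Rightarrow> ennreal"
  assumes [measurable]: "f \<in> borel_measurable borel"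
  shows "(\<integral>\<^sup>+x. f (c - x) \<partial>lborel) = (\<integral>\<^sup>+x. f x \<partial>lborel)"
proof -
  have "(\<integral>\<^sup>+x. f (c - x) \<partial>lborel) = (\<integral>\<^sup>+x. f (c + x) \<partial>distr lborel borel uminus)"
    by (simp add: nn_integral_distr)
  then show ?thesis by (simp add: lborel_distr_neg nn_integral_lborel_add)
qed

lemma distr_lborel_diff: "distr lborel borel ((-) c) = (lborel :: 'a::euclidean_space measure)"
proof -
  have "distr lborel borel ((-) c) = distr (distr lborel borel uminus) borel ((+) c :: 'a \<Rightarrow> 'a)"
    by (subst distr_distr) (auto simp: o_def)
  then show ?thesis by (simp add: lborel_distr_neg lborel_distr_plus)
qed

lemma integral_lborel_add:
  fixes f :: "'a::euclidean_space \<Rightarrow> real"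
  assumes "f \<in> borel_measurable borel"
  shows "(LBINT x. f (c + x)) = (LBINT x. f x)"
  using integral_distr[of "(+) c" lborel borel f] assms by (simp add: lborel_distr_plus)

lemma integral_lborel_diff:
  fixes f :: "'a::euclidean_space \<Rightarrow> real"
  assumes "f \<in> borel_measurable borel"
  shows "(LBINT x. f (c - x)) = (LBINT x. f x)"
  using integral_distr[of "(-) c" lborel borel f] assms by (simp add: distr_lborel_diff)

lemma integrable_lborel_add:
  fixes f :: "'a::euclidean_space \<Rightarrow> real"
  assumes "integrable lborel f"
  shows "integrable lborel (\<lambda>x. f (c + x))"
  using integrable_distr_eq[of "(+) c" lborel borel f] assms by (simp add: lborel_distr_plus)

lemma integrable_lborel_diff:
  fixes f :: "'a::euclidean_space \<Rightarrow> real"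
  assumes "integrable lborel f"
  shows "integrable lborel (\<lambda>x. f (c - x))"
  using integrable_distr_eq[of "(-) c" lborel borel f] assms by (simp add: distr_lborel_diff)

text \<open>Double counting with the unit ball \<open>B\<close>, which \<open>R\<close> preserves.
  Integrating 1_A(R x) 1_B(R x + y) in y first gives the pushforward measure of \<open>A\<close>
  times |B|; translating x so that y moves into the other factor gives |A| |B|. The finite positive
  number |B| cancels.\<close>

lemma distr_isometry_lborel:
  fixes R :: "'a::euclidean_space \<Rightarrow> 'a"
  assumes R: "orthogonal_transformation R"
  shows "distr lborel borel R = lborel"
proof (rule measure_eqI)
  have lin: "linear R" using R by (rule orthogonal_transformation_linear)
  have [measurable]: "R \<in> borel_measurable borel"
    using lin by (intro borel_measurable_continuous_onI linear_continuous_on) (simp add: linear_conv_bounded_linear)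
  obtain S where S: "\<And>y. R (S y) = y"
    using orthogonal_transformation_surj[OF R] by (metis surjD)
  fix A assume "A \<in> sets (distr lborel borel R)"
  then have [measurable]: "A \<in> sets borel" by simp
  define B where "B = ball (0::'a) 1"
  have [measurable]: "B \<in> sets borel" by (simp add: B_def)
  have IA: "(\<integral>\<^sup>+x. indicator A (R x) \<partial>lborel) = emeasure (distr lborel borel R) A"
    using nn_integral_distr[of R lborel borel "indicator A"] by (simp add: nn_integral_indicator)
  have IB: "(\<integral>\<^sup>+x. indicator B (R x) \<partial>lborel) = emeasure lborel B"
    using R by (auto simp flip: nn_integral_indicator intro!: nn_integral_cong
        simp: orthogonal_transformation_norm B_def split: split_indicator)
  have addB: "(\<integral>\<^sup>+y. indicator B (c + y) \<partial>lborel) = emeasure lborel B" for c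
    using nn_integral_lborel_add[of "indicator B :: 'a \<Rightarrow> ennreal" c] by simp
  have diffA: "(\<integral>\<^sup>+y. indicator A (c - y) \<partial>lborel) = emeasure lborel A" for c
    using nn_integral_lborel_diff[of "indicator A :: 'a \<Rightarrow> ennreal" c] by simp
  have "emeasure (distr lborel borel R) A * emeasure lborel B
      = (\<integral>\<^sup>+x. \<integral>\<^sup>+y. indicator A (R x) * indicator B (R x + y) \<partial>lborel \<partial>lborel)"
    by (simp add: nn_integral_cmult nn_integral_multc IA addB)
  also have "\<dots> = (\<integral>\<^sup>+y. \<integral>\<^sup>+x. indicator A (R x) * indicator B (R x + y) \<partial>lborel \<partial>lborel)"
    by (rule lborel_pair.Fubini'[symmetric]) simp
  also have "\<dots> = (\<integral>\<^sup>+y. \<integral>\<^sup>+x. indicator A (R x - y) * indicator B (R x) \<partial>lborel \<partial>lborel)"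
  proof (rule nn_integral_cong)
    fix y
    have "R (S (-y) + x) = R x - y" for x
      using S[of "-y"] by (simp add: linear_add[OF lin])
    then show "(\<integral>\<^sup>+x. indicator A (R x) * indicator B (R x + y) \<partial>lborel)
        = (\<integral>\<^sup>+x. indicator A (R x - y) * indicator B (R x) \<partial>lborel)"
      using nn_integral_lborel_add[of "\<lambda>x. indicator A (R x) * indicator B (R x + y)" "S (-y)"]
      by simp
  qed
  also have "\<dots> = (\<integral>\<^sup>+x. \<integral>\<^sup>+y. indicator A (R x - y) * indicator B (R x) \<partial>lborel \<partial>lborel)"
    by (rule lborel_pair.Fubini') simp
  also have "\<dots> = emeasure lborel A * emeasure lborel B"
    by (simp add: nn_integral_cmult nn_integral_multc IB diffA)
  finally have "emeasure lborel B * emeasure (distr lborel borel R) A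
      = emeasure lborel B * emeasure lborel A"
    by (simp add: mult.commute)
  moreover have "emeasure lborel B \<noteq> 0" "emeasure lborel B \<noteq> \<infinity>"
    using content_ball_pos[of 1 "0::'a"] by (auto simp: B_def measure_def emeasure_lborel_ball_finite less_top[symmetric])
  ultimately show "emeasure (distr lborel borel R) A = emeasure lborel A"
    by (subst (asm) ennreal_mult_cancel_left) auto
qed simp

section \<open>Reflection in a hyperplane\<close>

lemma hyp_refl_decomp: "hyp_refl a b x = hyp_refl a b 0 + hyp_refl a 0 x"
  by (simp add: hyp_refl_def algebra_simps diff_divide_distrib)

lemma hyp_refl_add: "hyp_refl a b (x + z) = hyp_refl a b x + hyp_refl a 0 z"
  by (simp add: hyp_refl_def algebra_simps diff_divide_distrib add_divide_distrib inner_add_right)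

lemma hyp_refl_diff: "hyp_refl a b (x - z) = hyp_refl a b x - hyp_refl a 0 z"
  by (simp add: hyp_refl_def algebra_simps diff_divide_distrib add_divide_distrib inner_diff_right)

lemma inner_hyp_refl: "a \<noteq> 0 \<Longrightarrow> a \<bullet> hyp_refl a b x = 2 * b - a \<bullet> x"
  by (simp add: hyp_refl_def inner_diff_right)

lemma hyp_refl_involution [simp]: "a \<noteq> 0 \<Longrightarrow> hyp_refl a b (hyp_refl a b x) = x"
  by (subst hyp_refl_def, subst inner_hyp_refl)
     (auto simp: hyp_refl_def algebra_simps simp flip: scaleR_add_left add_divide_distrib)

lemma orthogonal_hyp_refl:
  assumes "a \<noteq> 0"
  shows "orthogonal_transformation (hyp_refl a 0)"
  unfolding orthogonal_transformation_def
proof (intro conjI allI linearI)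
  fix v w
  show "hyp_refl a 0 v \<bullet> hyp_refl a 0 w = v \<bullet> w"
    using assms by (simp add: hyp_refl_def inner_diff_left inner_diff_right inner_commute)
qed (simp_all add: hyp_refl_def algebra_simps inner_add_right add_divide_distrib)

lemma norm_hyp_refl: "a \<noteq> 0 \<Longrightarrow> norm (hyp_refl a 0 z) = norm z"
  using orthogonal_hyp_refl by (rule orthogonal_transformation_norm)


lemma borel_measurable_hyp_refl [measurable]: "hyp_refl a b \<in> borel_measurable borel"
  unfolding hyp_refl_def divide_inverse by measurable

lemma distr_hyp_refl:
  assumes "a \<noteq> 0"
  shows "distr lborel borel (hyp_refl a b) = lborel"
proof -
  have "distr lborel borel (hyp_refl a b) = distr (distr lborel borel (hyp_refl a 0)) borel ((+) (hyp_refl a b 0))"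
    by (subst distr_distr) (auto simp: o_def hyp_refl_decomp[of a b, symmetric])
  then show ?thesis
    by (simp add: distr_isometry_lborel orthogonal_hyp_refl assms lborel_distr_plus)
qed


lemma integral_hyp_refl:
  fixes f :: "'a::euclidean_space \<Rightarrow> real"
  assumes "a \<noteq> 0" and [measurable]: "f \<in> borel_measurable borel"
  shows "(LBINT x. f (hyp_refl a b x)) = (LBINT x. f x)"
  by (subst (2) distr_hyp_refl[OF assms(1), of b, symmetric]) (simp add: integral_distr)

lemma integrable_hyp_refl:
  fixes f :: "'a::euclidean_space \<Rightarrow> real"
  assumes "a \<noteq> 0" and "integrable lborel f"
  shows "integrable lborel (\<lambda>x. f (hyp_refl a b x))"
  using assms integrable_distr_eq[of "hyp_refl a b" lborel borel f]
  by (simp add: distr_hyp_refl)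


section \<open>Power weights\<close>

lemma dim_less_nonneg: "real DIM('a::euclidean_space) < p \<Longrightarrow> 0 \<le> p"
  using DIM_positive[where 'a='a] by linarith

lemma dyadic_bracket:
  fixes x :: real
  assumes "1 \<le> x"
  obtains j :: nat where "2 ^ j \<le> x" "x \<le> 2 ^ Suc j"
proof -
  define j where "j = nat \<lfloor>log 2 x\<rfloor>"
  have l: "0 \<le> log 2 x" using assms by simp
  have "real j \<le> log 2 x" "log 2 x \<le> real (Suc j)"
    unfolding j_def using l by linarith+
  then have "2 powr real j \<le> x" "x \<le> 2 powr real (Suc j)"
    using assms by (auto simp: le_log_iff log_le_iff)
  then show ?thesis
    using that[of j] by (auto simp: powr_realpow simp del: of_nat_Suc)
qed

text \<open>\<open>f\<close> is dominated by a series of multiples of ball indicators; the volume of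
  a ball of radius \<open>\<rho> j\<close> cancels the denominator, so the terms integrate to a
  geometric series. The radii may grow or shrink, hence one criterion covers tails as well as
  singularities at the origin.\<close>

lemma integrable_dyadic:
  fixes f :: "'a::euclidean_space \<Rightarrow> real"
  assumes [measurable]: "f \<in> borel_measurable borel" and nn: "\<And>x. 0 \<le> f x"
    and q: "0 \<le> q" "q < 1" and c: "0 \<le> c" and \<rho>: "\<And>j::nat. 0 < \<rho> j"
    and b: "\<And>x. f x \<noteq> 0 \<Longrightarrow> \<exists>j. norm x < \<rho> j \<and> f x \<le> c * q ^ j / \<rho> j ^ DIM('a)"
  shows "integrable lborel f"
proof (rule integrableI_nonneg)
  let ?g = "\<lambda>j x. ennreal (c * q ^ j / \<rho> j ^ DIM('a)) * indicator (ball (0::'a) (\<rho> j)) x"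
  have "(\<integral>\<^sup>+x. ennreal (f x) \<partial>lborel) \<le> (\<integral>\<^sup>+x. (\<Sum>j. ?g j x) \<partial>lborel)"
  proof (rule nn_integral_mono)
    fix x :: 'a
    show "ennreal (f x) \<le> (\<Sum>j. ?g j x)"
    proof (cases "f x = 0")
      case False
      then obtain j where j: "norm x < \<rho> j" "f x \<le> c * q ^ j / \<rho> j ^ DIM('a)" using b by blast
      then have "ennreal (f x) \<le> ?g j x" by (auto intro!: ennreal_leI)
      also have "?g j x = sum (\<lambda>i. ?g i x) {j}" by (subst sum.insert) auto
      also have "\<dots> \<le> (\<Sum>j. ?g j x)" by (rule sum_le_suminf) auto
      finally show ?thesis .
    qed simp
  qed
  also have "\<dots> = (\<Sum>j. \<integral>\<^sup>+x. ?g j x \<partial>lborel)" 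
    by (rule nn_integral_suminf) (intro borel_measurable_times_ennreal borel_measurable_const borel_measurable_indicator; simp)
  also have "\<dots> = (\<Sum>j. ennreal (c * unit_ball_vol (real DIM('a)) * q ^ j))"
  proof (rule suminf_cong)
    fix j
    have "(\<integral>\<^sup>+x. ?g j x \<partial>lborel) = ennreal (c * q ^ j / \<rho> j ^ DIM('a)) * emeasure lborel (ball (0::'a) (\<rho> j))"
      by (rule nn_integral_cmult_indicator) simp
    also have "\<dots> = ennreal (c * q ^ j / \<rho> j ^ DIM('a)) * ennreal (unit_ball_vol (real DIM('a)) * \<rho> j ^ DIM('a))"
      using \<rho>[of j] by (subst emeasure_ball) auto
    also have "\<dots> = ennreal (c * q ^ j / \<rho> j ^ DIM('a) * (unit_ball_vol (real DIM('a)) * \<rho> j ^ DIM('a)))"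
      using q c \<rho>[of j] by (intro ennreal_mult[symmetric]) (auto simp: unit_ball_vol_nonneg less_imp_le)
    also have "c * q ^ j / \<rho> j ^ DIM('a) * (unit_ball_vol (real DIM('a)) * \<rho> j ^ DIM('a))
        = c * unit_ball_vol (real DIM('a)) * q ^ j"
      using \<rho>[of j] by (simp add: field_simps)
    finally show "(\<integral>\<^sup>+x. ?g j x \<partial>lborel) = ennreal (c * unit_ball_vol (real DIM('a)) * q ^ j)" .
  qed
  also have "\<dots> = ennreal (\<Sum>j. c * unit_ball_vol (real DIM('a)) * q ^ j)"
    using q c by (intro suminf_ennreal2) (auto intro!: summable_mult summable_geometric simp: unit_ball_vol_nonneg)
  also have "\<dots> < \<infinity>" by simp
  finally show "(\<integral>\<^sup>+x. ennreal (f x) \<partial>lborel) < \<infinity>" .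
qed (use nn in auto)

lemma integrable_norm_powr_tail:
  assumes "real DIM('a) < p" "0 < r"
  shows "integrable lborel (\<lambda>z::'a::euclidean_space. indicator {z. r < norm z} z * norm z powr - p)"
\<comment> \<open>On the shell r 2^j <= |z| <= 2 r 2^j the function is at most (r 2^j)^(-p). The
  radius 4 r 2^j leaves a spare factor 2 because strict inclusion is required, and (4 r)^N in
  \<open>c\<close> undoes the volume normalisation.\<close>
proof (rule integrable_dyadic[where c = "r powr - p * (4 * r) ^ DIM('a)" and q = "2 powr (real DIM('a) - p)"
      and \<rho> = "\<lambda>j. 4 * r * 2 ^ j"])
  fix z :: 'a
  assume "indicator {z. r < norm z} z * norm z powr - p \<noteq> 0"
  then have z: "r < norm z" by (auto split: split_indicator_asm)
  then obtain j :: nat where j: "2 ^ j \<le> norm z / r" "norm z / r \<le> 2 ^ Suc j"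
    using dyadic_bracket[of "norm z / r"] assms by auto
  have "norm z powr - p \<le> (r * 2 ^ j) powr - p"
    using j assms by (intro powr_mono2') (auto simp: field_simps)
  also have "\<dots> = r powr - p * (2 powr real j) powr - p"
    using assms by (simp add: powr_mult powr_realpow)
  also have "(2 powr real j) powr - p = (2 powr (real DIM('a) - p)) powr real j / (2 powr real j) powr real DIM('a)"
    by (simp add: powr_powr powr_diff[symmetric] algebra_simps)
  also have "\<dots> = (2 powr (real DIM('a) - p)) ^ j / (2 ^ j) ^ DIM('a)"
    by (simp add: powr_realpow)
  finally have "norm z powr - p \<le> r powr - p * (4 * r) ^ DIM('a) * (2 powr (real DIM('a) - p)) ^ j / (4 * r * 2 ^ j) ^ DIM('a)"
    using assms by (simp add: field_simps power_mult_distrib)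
  moreover have "norm z < 4 * r * 2 ^ j"
  proof -
    have "norm z \<le> r * (2 * 2 ^ j)" using j(2) assms by (simp add: pos_divide_le_eq mult_ac)
    moreover have "0 < r * 2 ^ j" using assms by simp
    ultimately show ?thesis by (simp add: mult_ac)
  qed
  ultimately show "\<exists>j. norm z < 4 * r * 2 ^ j \<and> indicator {z. r < norm z} z * norm z powr - p
      \<le> r powr - p * (4 * r) ^ DIM('a) * (2 powr (real DIM('a) - p)) ^ j / (4 * r * 2 ^ j) ^ DIM('a)"
    using z by (intro exI[of _ j]) auto
next
  show "2 powr (real DIM('a) - p) < 1" using assms by (simp add: powr_less_one)
qed (use assms in \<open>auto split: split_indicator\<close>)

lemma integrable_norm_powr_near:
  assumes "p < real DIM('a) + 2" "0 \<le> p" "0 < r"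
  shows "integrable lborel (\<lambda>z::'a::euclidean_space. indicator {z. norm z \<le> r} z * ((norm z)\<^sup>2 * norm z powr - p))"
\<comment> \<open>The shells now shrink: r / 2^(j+1) <= |z| <= r / 2^j. The factor |z|^2 improves
  the ratio to 2^(p - N - 2), which is below 1 because p < N + 2.\<close>
proof (rule integrable_dyadic[where c = "r\<^sup>2 * (r / 2) powr - p * (2 * r) ^ DIM('a)" and q = "2 powr (p - real DIM('a) - 2)"
      and \<rho> = "\<lambda>j. 2 * r / 2 ^ j"])
  show "(\<lambda>z::'a. indicator {z. norm z \<le> r} z * ((norm z)\<^sup>2 * norm z powr - p)) \<in> borel_measurable borel"
    by measurable
  fix z :: 'a
  assume "indicator {z. norm z \<le> r} z * ((norm z)\<^sup>2 * norm z powr - p) \<noteq> 0"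
  then have z: "norm z \<le> r" "z \<noteq> 0" by (auto split: split_indicator_asm)
  then obtain j :: nat where j: "2 ^ j \<le> r / norm z" "r / norm z \<le> 2 ^ Suc j"
    using dyadic_bracket[of "r / norm z"] assms by (auto simp: field_simps)
  have zj: "norm z \<le> r / 2 ^ j" "r / 2 / 2 ^ j \<le> norm z"
    using j z by (auto simp: field_simps)
  have "(norm z)\<^sup>2 * norm z powr - p \<le> (r / 2 ^ j)\<^sup>2 * (r / 2 / 2 ^ j) powr - p"
    using zj assms by (intro mult_mono power_mono powr_mono2') auto
  also have "(r / 2 / 2 ^ j) powr - p = (r / 2) powr - p * (2 powr real j) powr p"
    using powr_divide[of "r / 2" "2 ^ j" "- p"] assms by (simp add: powr_realpow powr_minus_divide del: divide_divide_eq_left)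
  also have "(2 powr real j) powr p
      = (2 powr (p - real DIM('a) - 2)) powr real j * ((2 powr real j) powr real DIM('a) * (2 powr real j) powr 2)"
    unfolding powr_powr powr_add[symmetric] by (simp add: algebra_simps)
  also have "\<dots> = (2 powr (p - real DIM('a) - 2)) ^ j * ((2 ^ j) ^ DIM('a) * (2 ^ j)\<^sup>2)"
    by (simp add: powr_realpow)
  finally have "(norm z)\<^sup>2 * norm z powr - p
      \<le> r\<^sup>2 * (r / 2) powr - p * (2 * r) ^ DIM('a) * (2 powr (p - real DIM('a) - 2)) ^ j / (2 * r / 2 ^ j) ^ DIM('a)"
    using assms by (simp add: power_divide)
  moreover have "norm z < 2 * r / 2 ^ j"
    using zj(1) assms divide_strict_right_mono[of r "2 * r" "2 ^ j"] by simp
  ultimately show "\<exists>j. norm z < 2 * r / 2 ^ j \<and> indicator {z. norm z \<le> r} z * ((norm z)\<^sup>2 * norm z powr - p)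
      \<le> r\<^sup>2 * (r / 2) powr - p * (2 * r) ^ DIM('a) * (2 powr (p - real DIM('a) - 2)) ^ j / (2 * r / 2 ^ j) ^ DIM('a)"
    using z by (intro exI[of _ j]) auto
next
  show "2 powr (p - real DIM('a) - 2) < 1" using assms by (simp add: powr_less_one)
qed (use assms in auto)

text \<open>Only the shell between the radii r and 3 r is kept: there the kernel is at least (3
  r)^(-p), and the shell has at least the volume of a ball of radius r. For p = N + 2 s this is the
  order r^(-2s) of the long jumps.\<close>

lemma integral_norm_powr_tail_ge:
  assumes "real DIM('a) < p"
  obtains \<kappa> where "0 < \<kappa>"
    "\<And>r. 0 < r \<Longrightarrow> \<kappa> * r powr (real DIM('a) - p)
      \<le> (LBINT z. indicator {z. r < norm z} z * norm (z::'a::euclidean_space) powr - p)"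
proof -
  let ?N = "DIM('a)" and ?v = "unit_ball_vol (real DIM('a))"
  have v: "0 < ?v" by (simp add: unit_ball_vol_pos)
  have N2: "(2::real) \<le> 2 ^ ?N"
    using power_increasing[of 1 ?N "2::real"] DIM_positive[where 'a='a] by simp
  show ?thesis
  proof (rule that[of "3 powr - p * ?v"])
    show "0 < 3 powr - p * ?v" using v by simp
    fix r :: real
    assume r: "0 < r"
    let ?S = "ball 0 (3 * r) - cball 0 r :: 'a set"
    have *: "emeasure lborel ?S = ennreal (?v * (3 * r) ^ ?N - ?v * r ^ ?N)"
      using r v by (subst emeasure_Diff) (auto simp: emeasure_ball emeasure_cball ennreal_minus)
    have m: "measure lborel ?S = ?v * (3 * r) ^ ?N - ?v * r ^ ?N"
      unfolding measure_def * using r v by (intro enn2real_ennreal) (simp add: power_mono)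
    have "2 * r ^ ?N \<le> (3 * r) ^ ?N"
    proof -
      have "2 * r ^ ?N \<le> 2 ^ ?N * r ^ ?N" using N2 r by (intro mult_right_mono) auto
      also have "\<dots> \<le> (3 * r) ^ ?N" using r by (simp add: power_mult_distrib power_mono)
      finally show ?thesis .
    qed
    then have m2: "?v * r ^ ?N \<le> measure lborel ?S"
      unfolding m using mult_left_mono[of "2 * r ^ ?N" "(3 * r) ^ ?N" ?v] v by simp
    have "3 powr - p * ?v * r powr (real ?N - p) = (3 * r) powr - p * (?v * r ^ ?N)"
      using r by (simp add: powr_mult powr_diff powr_minus_divide powr_realpow field_simps)
    also have "\<dots> \<le> (3 * r) powr - p * measure lborel ?S"
      using m2 by (intro mult_left_mono) auto
    also have "\<dots> = (LBINT z. (3 * r) powr - p * indicator ?S z)" by simp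
    also have "\<dots> \<le> (LBINT z. indicator {z. r < norm z} z * norm (z::'a) powr - p)"
    proof (rule integral_mono)
      show "integrable lborel (\<lambda>z. (3 * r) powr - p * indicator ?S z)"
        by (intro integrable_mult_right integrable_real_indicator) (auto simp: *)
      show "integrable lborel (\<lambda>z::'a. indicator {z. r < norm z} z * norm z powr - p)"
        using assms r by (rule integrable_norm_powr_tail)
      fix z :: 'a
      show "(3 * r) powr - p * indicator ?S z \<le> indicator {z. r < norm z} z * norm z powr - p"
        using r assms by (auto split: split_indicator intro!: powr_mono2')
    qed
    finally show "3 powr - p * ?v * r powr (real ?N - p)
        \<le> (LBINT z. indicator {z. r < norm z} z * norm (z::'a) powr - p)" .
  qed
qed

text \<open>The square under the power makes the weight smooth at the origin, which the second
  difference estimate needs, while the decay remains that of (1 + |x|)^(-p), the weight in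
  \<open>frac_weak_sol\<close>. A large scale \<open>T\<close> makes it nearly constant at short
  range.\<close>

definition wt :: "real \<Rightarrow> real \<Rightarrow> 'a::real_normed_vector \<Rightarrow> real" where
  "wt p T x = (1 + (norm x / T)\<^sup>2) powr (- (p / 2))"

lemma wt_base_pos: "0 < 1 + (norm x / T)\<^sup>2"
  by (simp add: add_pos_nonneg)

lemma wt_pos [simp]: "0 < wt p T x"
  using wt_base_pos[of x T] unfolding wt_def powr_gt_zero by linarith

lemma wt_nonneg [simp]: "0 \<le> wt p T x"
  by (simp add: less_imp_le)

lemma wt_le_1: "0 \<le> p \<Longrightarrow> wt p T x \<le> 1"
  using powr_mono2'[of "- (p / 2)" 1 "1 + (norm x / T)\<^sup>2"] by (simp add: wt_def)

lemma borel_measurable_wt [measurable]: "wt p T \<in> borel_measurable borel"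
  unfolding wt_def by measurable

lemma wt_diff_commute: "wt p T (x - y) = wt p T (y - x)"
  by (simp add: wt_def norm_minus_commute)

lemma wt_le_norm_powr:
  assumes "0 \<le> p" "0 < T" "x \<noteq> 0"
  shows "wt p T x \<le> T powr p * norm x powr - p"
proof -
  have "wt p T x \<le> ((norm x / T)\<^sup>2) powr (- (p / 2))"
    unfolding wt_def using assms by (intro powr_mono2') auto
  also have "\<dots> = (norm x / T) powr - p"
    using assms by (simp add: powr_powr flip: powr_numeral)
  also have "\<dots> = T powr p * norm x powr - p"
    using assms by (simp add: powr_divide powr_minus_divide)
  finally show ?thesis .
qed

lemma norm_powr_le_wt:
  assumes "0 \<le> p" "0 < T" "0 < r" "r \<le> norm x"
  shows "norm x powr - p \<le> (1 / r\<^sup>2 + 1 / T\<^sup>2) powr (p / 2) * wt p T x"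
proof -
  have "1 \<le> (norm x)\<^sup>2 / r\<^sup>2" using assms by (simp add: power_mono)
  then have "1 + (norm x / T)\<^sup>2 \<le> (1 / r\<^sup>2 + 1 / T\<^sup>2) * (norm x)\<^sup>2"
    by (simp add: power_divide distrib_right)
  then have "((1 / r\<^sup>2 + 1 / T\<^sup>2) * (norm x)\<^sup>2) powr (- (p / 2)) \<le> wt p T x"
    unfolding wt_def using assms wt_base_pos[of x T] by (intro powr_mono2') auto
  also have "((1 / r\<^sup>2 + 1 / T\<^sup>2) * (norm x)\<^sup>2) powr (- (p / 2))
      = norm x powr - p / (1 / r\<^sup>2 + 1 / T\<^sup>2) powr (p / 2)"
    using assms by (simp add: powr_mult powr_minus_divide powr_powr flip: powr_numeral)
  finally show ?thesis
    using pos_divide_le_eq[of "(1 / r\<^sup>2 + 1 / T\<^sup>2) powr (p / 2)" "norm x powr - p" "wt p T x"] assms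
      add_pos_pos[of "1 / r\<^sup>2" "1 / T\<^sup>2"]
    by (simp add: mult.commute)
qed

lemma norm_sq_triangle: "(norm (x + z))\<^sup>2 \<le> 2 * (norm x)\<^sup>2 + 2 * (norm z)\<^sup>2"
proof -
  have "(norm (x + z))\<^sup>2 \<le> (norm x + norm z)\<^sup>2"
    by (intro power_mono norm_triangle_ineq) auto
  moreover have "0 \<le> (norm x - norm z)\<^sup>2" by simp
  ultimately show ?thesis unfolding power2_sum power2_diff by linarith
qed

text \<open>Peetre's inequality: A <= 2 B + 2 C implies 1 + A <= 2 (1 + C) (1 + B), applied to
  squared norms over T^2 and raised to the power -p/2.\<close>

lemma wt_shift:
  assumes "0 \<le> p"
  shows "wt p T y \<le> 2 powr (p / 2) * (1 + (norm (x - y) / T)\<^sup>2) powr (p / 2) * wt p T x"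
proof -
  let ?a = "1 + (norm x / T)\<^sup>2" and ?b = "1 + (norm y / T)\<^sup>2" and ?c = "1 + (norm (x - y) / T)\<^sup>2"
  have "(norm x)\<^sup>2 \<le> 2 * (norm y)\<^sup>2 + 2 * (norm (x - y))\<^sup>2"
    using norm_sq_triangle[of y "x - y"] by simp
  then have "(norm x)\<^sup>2 / T\<^sup>2 \<le> (2 * (norm y)\<^sup>2 + 2 * (norm (x - y))\<^sup>2) / T\<^sup>2"
    by (rule divide_right_mono) simp
  then have "(norm x / T)\<^sup>2 \<le> 2 * (norm y / T)\<^sup>2 + 2 * (norm (x - y) / T)\<^sup>2"
    by (simp add: power_divide add_divide_distrib)
  moreover have "1 + A \<le> 2 * (1 + C) * (1 + B)" if "A \<le> 2 * B + 2 * C" "0 \<le> B" "0 \<le> C" for A B C :: real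
    using that mult_nonneg_nonneg[of B C] by (simp add: distrib_left distrib_right mult_ac del: mult_nonneg_nonneg)
  ultimately have "?a \<le> 2 * ?c * ?b" by simp
  then have "?a / (2 * ?c) \<le> ?b"
    using wt_base_pos[of "x - y" T] by (subst pos_divide_le_eq) (auto simp: mult.commute)
  then have "wt p T y \<le> (?a / (2 * ?c)) powr (- (p / 2))"
    unfolding wt_def using assms wt_base_pos[of "x - y" T] wt_base_pos[of x T] by (intro powr_mono2') auto
  also have "\<dots> = 2 powr (p / 2) * ?c powr (p / 2) * wt p T x"
    unfolding wt_def using wt_base_pos[of "x - y" T] wt_base_pos[of x T]
    using powr_mult[of 2 ?c "p / 2"] by (simp add: powr_divide powr_minus_divide)
  finally show ?thesis .
qed

text \<open>Peetre's inequality multiplied by \<open>wt p T (x - y)\<close>, which cancels its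
  displacement factor.\<close>

lemma wt_mult_le: "0 \<le> p \<Longrightarrow> wt p T y * wt p T (x - y) \<le> 2 powr (p / 2) * wt p T x"
proof -
  assume p: "0 \<le> p"
  have "(1 + (norm (x - y) / T)\<^sup>2) powr (p / 2) * wt p T (x - y) = 1"
    unfolding wt_def using wt_base_pos[of "x - y" T] by (simp add: powr_minus_divide)
  moreover have "wt p T y * wt p T (x - y)
      \<le> (2 powr (p / 2) * (1 + (norm (x - y) / T)\<^sup>2) powr (p / 2) * wt p T x) * wt p T (x - y)"
    by (intro mult_right_mono wt_shift p) simp
  ultimately show ?thesis by (simp add: mult.assoc mult.left_commute)
qed

text \<open>Since y = x - (x - y), the points x and x - y cannot both be much shorter than y, and at
  the longer one the weight is at most 2^p \<open>wt p T y\<close>. The other factor of the product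
  is kept. The resulting right-hand side is integrable in x, unlike a constant.\<close>

lemma wt_mult_le_sum:
  assumes p: "0 \<le> p"
  shows "wt p T x * wt p T (x - y) \<le> 2 powr p * wt p T y * (wt p T x + wt p T (x - y))"
proof -
  let ?a = "1 + (norm x / T)\<^sup>2" and ?b = "1 + (norm y / T)\<^sup>2" and ?c = "1 + (norm (x - y) / T)\<^sup>2"
  have "(norm y)\<^sup>2 \<le> 2 * (norm x)\<^sup>2 + 2 * (norm (x - y))\<^sup>2"
    using norm_sq_triangle[of x "y - x"] by (simp add: norm_minus_commute)
  then have "(norm y)\<^sup>2 / T\<^sup>2 \<le> (2 * (norm x)\<^sup>2 + 2 * (norm (x - y))\<^sup>2) / T\<^sup>2"
    by (rule divide_right_mono) simp
  then have "(norm y / T)\<^sup>2 \<le> 2 * (norm x / T)\<^sup>2 + 2 * (norm (x - y) / T)\<^sup>2"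
    by (simp add: power_divide add_divide_distrib)
  then have "?b \<le> 2 * (?a + ?c)" by simp
  moreover have "b / 4 \<le> max a c" if "b \<le> 2 * (a + c)" for a b c :: real
    using that by (auto simp: max_def)
  ultimately have "?b / 4 \<le> max ?a ?c" by blast
  then have "(max ?a ?c) powr (- (p / 2)) \<le> (?b / 4) powr (- (p / 2))"
    using p wt_base_pos[of y T] by (intro powr_mono2') auto
  also have "\<dots> = 4 powr (p / 2) * wt p T y"
    unfolding wt_def using wt_base_pos[of y T] by (simp add: powr_divide powr_minus_divide)
  also have "4 powr (p / 2) = (2 powr 2) powr (p / 2)" by simp
  also have "\<dots> = 2 powr p" by (subst powr_powr) simp
  finally have *: "(max ?a ?c) powr (- (p / 2)) \<le> 2 powr p * wt p T y" .
  then consider "wt p T x \<le> 2 powr p * wt p T y" | "wt p T (x - y) \<le> 2 powr p * wt p T y"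
    unfolding wt_def max_def by (auto split: if_splits)
  then show ?thesis
  proof cases
    case 1
    then have "wt p T x * wt p T (x - y) \<le> (2 powr p * wt p T y) * wt p T (x - y)"
      by (rule mult_right_mono) simp
    also have "\<dots> \<le> 2 powr p * wt p T y * (wt p T x + wt p T (x - y))"
      by (intro mult_left_mono) auto
    finally show ?thesis .
  next
    case 2
    then have "wt p T x * wt p T (x - y) \<le> wt p T x * (2 powr p * wt p T y)"
      by (rule mult_left_mono) simp
    also have "\<dots> \<le> 2 powr p * wt p T y * (wt p T x + wt p T (x - y))"
      by (subst mult.commute, intro mult_left_mono) auto
    finally show ?thesis .
  qed
qed

lemma integrable_wt:
  assumes "real DIM('a) < p" "0 < T"
  shows "integrable lborel (wt p T :: 'a::euclidean_space \<Rightarrow> real)"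
proof (rule L1_dominated)
  let ?g = "\<lambda>z::'a. indicator (cball 0 1) z + T powr p * (indicator {z. 1 < norm z} z * norm z powr - p)"
  show "integrable lborel ?g"
    using assms by (intro L1_add integrable_mult_right integrable_norm_powr_tail
        integrable_real_indicator) (auto simp: emeasure_lborel_cball_finite[unfolded infinity_ennreal_def])
  show "AE x in lborel. norm (wt p T x :: real) \<le> norm (?g x)"
  proof (rule AE_I2)
    fix x :: 'a
    show "norm (wt p T x :: real) \<le> norm (?g x)"
    proof (cases "norm x \<le> 1")
      case True
      then show ?thesis using assms wt_le_1[of p T x] by (auto split: split_indicator)
    next
      case False
      then have "x \<noteq> 0" by auto
      then show ?thesis using False assms wt_le_norm_powr[of p T x] by (auto split: split_indicator)
    qed
  qed
qed simp

text \<open>Transfers the integrability condition in \<open>frac_weak_sol\<close> to the smooth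
  weight.\<close>

lemma wt_le_norm_weight:
  assumes "0 \<le> p" "0 < T"
  obtains C where "0 \<le> C" "\<And>x::'a::real_normed_vector. wt p T x \<le> C / (1 + norm x) powr p"
proof
  let ?C = "(2 * max 1 (T\<^sup>2)) powr (p / 2)"
  show "0 \<le> ?C" by simp
  fix x :: 'a
  have m: "0 < 2 * max 1 (T\<^sup>2)" by simp
  have "(1 + norm x)\<^sup>2 \<le> 2 * (1 + (norm x)\<^sup>2)"
    using zero_le_power2[of "1 - norm x"] by (simp add: power2_eq_square algebra_simps)
  moreover have "1 + (norm x)\<^sup>2 \<le> max 1 (T\<^sup>2) * (1 + (norm x / T)\<^sup>2)"
  proof -
    have "(norm x)\<^sup>2 = T\<^sup>2 * (norm x / T)\<^sup>2" using assms by (simp add: power_divide)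
    also have "\<dots> \<le> max 1 (T\<^sup>2) * (norm x / T)\<^sup>2" by (intro mult_right_mono) auto
    finally show ?thesis by (simp add: distrib_left)
  qed
  then have "2 * (1 + (norm x)\<^sup>2) \<le> (1 + (norm x / T)\<^sup>2) * (2 * max 1 (T\<^sup>2))"
    using mult_left_mono[of "1 + (norm x)\<^sup>2" _ 2] by (simp add: mult_ac)
  ultimately have "(1 + norm x)\<^sup>2 \<le> (1 + (norm x / T)\<^sup>2) * (2 * max 1 (T\<^sup>2))"
    by (rule order_trans)
  with m have "(1 + norm x)\<^sup>2 / (2 * max 1 (T\<^sup>2)) \<le> 1 + (norm x / T)\<^sup>2"
    by (subst pos_divide_le_eq) auto
  moreover have np: "0 < 1 + norm x" by (simp add: add_pos_nonneg)
  ultimately have "wt p T x \<le> ((1 + norm x)\<^sup>2 / (2 * max 1 (T\<^sup>2))) powr (- (p / 2))"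
    unfolding wt_def using assms m by (intro powr_mono2' divide_pos_pos zero_less_power) auto
  also have "\<dots> = ?C * ((1 + norm x) powr 2) powr (- (p / 2))"
    using m np by (simp add: powr_divide powr_minus_divide del: max_less_iff_conj)
  also have "((1 + norm x) powr 2) powr (- (p / 2)) = (1 + norm x) powr - p" by (subst powr_powr) simp
  finally show "wt p T x \<le> ?C / (1 + norm x) powr p" by (simp add: powr_minus_divide)
qed

text \<open>The linear part of the reflection preserves norms, so the weight only sees the fixed
  translation \<open>hyp_refl a b 0\<close>, which Peetre's inequality absorbs.\<close>

lemma wt_hyp_refl_le:
  fixes a :: "'a::euclidean_space"
  assumes "0 \<le> p" "a \<noteq> 0"
  obtains C where "0 \<le> C" "\<And>x. wt p T (hyp_refl a b x) \<le> C * wt p T x"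
proof
  let ?C = "2 powr (p / 2) * (1 + (norm (hyp_refl a b 0) / T)\<^sup>2) powr (p / 2)"
  show "0 \<le> ?C" by simp
  fix x
  have "wt p T (hyp_refl a 0 x) = wt p T x" using assms by (simp add: wt_def norm_hyp_refl)
  moreover have "hyp_refl a 0 x - hyp_refl a b x = - hyp_refl a b 0"
    by (subst hyp_refl_decomp[of a b x]) simp
  ultimately show "wt p T (hyp_refl a b x) \<le> ?C * wt p T x"
    using wt_shift[OF assms(1), of T "hyp_refl a b x" "hyp_refl a 0 x"] by simp
qed

text \<open>Write (1 + t)^(-c) as exp l with l = -c ln (1 + t) and expand to second order: it is at
  most 1 - c t + O(t^2), and the linear terms of t and -t cancel in the sum. The restriction |t| <=
  1/2 gives |l| <= c, so the exponential remainder is uniform.\<close>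

lemma powr_second_difference:
  fixes c :: real
  assumes "0 \<le> c"
  obtains C where "0 \<le> C" "\<And>t. \<bar>t\<bar> \<le> 1 / 2 \<Longrightarrow> (1 + t) powr - c + (1 - t) powr - c - 2 \<le> C * t\<^sup>2"
proof
  let ?C = "4 * c + 4 * c\<^sup>2 * exp c"
  show "0 \<le> ?C" using assms by simp
  fix t :: real
  assume t: "\<bar>t\<bar> \<le> 1 / 2"
  have *: "(1 + t) powr - c \<le> 1 - c * t + (2 * c + 2 * c\<^sup>2 * exp c) * t\<^sup>2" if t: "\<bar>t\<bar> \<le> 1 / 2" for t
  proof -
    define l where "l = - c * ln (1 + t)"
    have l1: "\<bar>ln (1 + t) - t\<bar> \<le> 2 * t\<^sup>2" using t by (rule abs_ln_one_plus_x_minus_x_bound)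
    have "2 * t\<^sup>2 \<le> \<bar>t\<bar>"
    proof -
      have "\<bar>t\<bar> * \<bar>t\<bar> \<le> 1 / 2 * \<bar>t\<bar>" using t by (intro mult_right_mono) auto
      then show ?thesis by (simp add: power2_eq_square)
    qed
    then have "\<bar>ln (1 + t)\<bar> \<le> 2 * \<bar>t\<bar>" using l1 by linarith
    then have l2: "\<bar>l\<bar> \<le> c * (2 * \<bar>t\<bar>)"
      unfolding l_def abs_mult abs_minus_cancel using assms by (intro mult_mono) auto
    have "c * (2 * \<bar>t\<bar>) \<le> c * 1" using t assms by (intro mult_left_mono) auto
    then have l3: "\<bar>l\<bar> \<le> c" using l2 by simp
    obtain \<xi> where \<xi>: "\<bar>\<xi>\<bar> \<le> \<bar>l\<bar>" "exp l = (\<Sum>m<2. l ^ m / fact m) + exp \<xi> / fact 2 * l ^ 2"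
      using Maclaurin_exp_le[of l 2] by blast
    have "exp \<xi> * l\<^sup>2 \<le> exp c * (c * (2 * \<bar>t\<bar>))\<^sup>2"
    proof (rule mult_mono)
      show "l\<^sup>2 \<le> (c * (2 * \<bar>t\<bar>))\<^sup>2" using l2 by (metis abs_ge_zero power2_abs power_mono)
    qed (use \<xi> l3 in auto)
    then have "exp l \<le> 1 + l + 2 * c\<^sup>2 * exp c * t\<^sup>2"
      using \<xi>(2) by (simp add: numeral_2_eq_2 power_mult_distrib field_simps)
    moreover have "c * (t - 2 * t\<^sup>2) \<le> c * ln (1 + t)" using l1 assms by (intro mult_left_mono) auto
    then have "l \<le> - c * t + 2 * c * t\<^sup>2" unfolding l_def by (simp add: algebra_simps)
    moreover have "(1 + t) powr - c = exp l" using t unfolding powr_def l_def by auto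
    ultimately show ?thesis by (simp add: algebra_simps)
  qed
  show "(1 + t) powr - c + (1 - t) powr - c - 2 \<le> ?C * t\<^sup>2"
    using *[of t] *[of "- t"] t by (simp add: algebra_simps)
qed

text \<open>With q = 1 + |x/T|^2, both 1 + |(x + z)/T|^2 >= q (1 + t) and 1 + |(x - z)/T|^2 >= q (1
  - t); dropping |z/T|^2 is harmless, as the exponent is negative and only an upper bound is wanted.
  From 2 |x|/T <= q follows |t| <= |z|/T. The error is relative to \<open>wt p T x\<close>, so it
  can be absorbed in the same weighted integral.\<close>

lemma wt_second_difference:
  assumes p: "0 \<le> p"
  obtains C where "0 \<le> C"
    "\<And>T x z :: 'a :: real_inner. \<lbrakk>0 < T; norm z \<le> T / 2\<rbrakk> \<Longrightarrow>
      wt p T (x + z) + wt p T (x - z) - 2 * wt p T x \<le> C * (norm z / T)\<^sup>2 * wt p T x"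
proof -
  obtain C where C: "0 \<le> C"
    "\<And>t. \<bar>t\<bar> \<le> 1 / 2 \<Longrightarrow> (1 + t) powr - (p / 2) + (1 - t) powr - (p / 2) - 2 \<le> C * t\<^sup>2"
    using powr_second_difference[of "p / 2"] p by auto
  show ?thesis
  proof (rule that[OF C(1)])
    fix T and x z :: 'a
    assume T: "0 < T" and z: "norm z \<le> T / 2"
    define q where "q = 1 + (norm x / T)\<^sup>2"
    define t where "t = 2 * (x \<bullet> z) / (T\<^sup>2 * q)"
    have q: "0 < q" unfolding q_def by (rule wt_base_pos)
    have "2 * (norm x / T) \<le> q"
      unfolding q_def using zero_le_power2[of "1 - norm x / T"] unfolding power2_diff by simp
    then have "2 * norm x / (T * q) \<le> 1" using T q by (simp add: field_simps)
    then have "(norm z / T) * (2 * norm x / (T * q)) \<le> (norm z / T) * 1"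
      using T by (intro mult_left_mono) auto
    moreover have "\<bar>t\<bar> \<le> 2 * (norm x * norm z) / (T\<^sup>2 * q)"
      unfolding t_def using T q Cauchy_Schwarz_ineq2[of x z]
      by (simp add: abs_mult divide_right_mono)
    ultimately have t: "\<bar>t\<bar> \<le> norm z / T" by (simp add: power2_eq_square mult_ac)
    also have "\<dots> \<le> 1 / 2" using z T by (simp add: field_simps)
    finally have t2: "\<bar>t\<bar> \<le> 1 / 2" .
    have *: "wt p T (x + w) \<le> wt p T x * (1 + \<sigma> * t) powr - (p / 2)"
      if "w = \<sigma> *\<^sub>R z" "\<sigma> = 1 \<or> \<sigma> = -1" for w \<sigma>
    proof -
      have "(norm (x + w))\<^sup>2 = (norm x)\<^sup>2 + (norm z)\<^sup>2 + \<sigma> * (2 * (x \<bullet> z))"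
        using that by (auto simp: power2_norm_eq_inner inner_add_left inner_add_right inner_diff_left inner_diff_right inner_commute)
      then have "(norm x)\<^sup>2 + \<sigma> * (2 * (x \<bullet> z)) \<le> (norm (x + w))\<^sup>2" by simp
      then have "((norm x)\<^sup>2 + \<sigma> * (2 * (x \<bullet> z))) / T\<^sup>2 \<le> (norm (x + w))\<^sup>2 / T\<^sup>2"
        by (rule divide_right_mono) simp
      then have "q * (1 + \<sigma> * t) \<le> 1 + (norm (x + w) / T)\<^sup>2"
      proof -
        have "q * (\<sigma> * t) = \<sigma> * (2 * (x \<bullet> z)) / T\<^sup>2" using q T by (simp add: t_def)
        then show ?thesis
          using \<open>_ / T\<^sup>2 \<le> _\<close> by (simp add: distrib_left add_divide_distrib) (simp add: q_def power_divide)
      qed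
      moreover have "0 < 1 + \<sigma> * t" using t2 that by auto
      ultimately have "wt p T (x + w) \<le> (q * (1 + \<sigma> * t)) powr - (p / 2)"
        unfolding wt_def using q p by (intro powr_mono2') auto
      then show ?thesis
        using q \<open>0 < 1 + \<sigma> * t\<close> by (simp add: powr_mult wt_def q_def)
    qed
    have "wt p T (x + z) + wt p T (x - z) - 2 * wt p T x
        \<le> wt p T x * ((1 + t) powr - (p / 2) + (1 - t) powr - (p / 2) - 2)"
      using *[of z 1] *[of "- z" "-1"] by (simp add: algebra_simps)
    also have "\<dots> \<le> wt p T x * (C * t\<^sup>2)"
      using C(2)[OF t2] by (intro mult_left_mono) auto
    also have "\<dots> \<le> wt p T x * (C * (norm z / T)\<^sup>2)"
        using t C(1) T by (intro mult_left_mono) (auto simp: abs_le_square_iff[symmetric])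
    finally show "wt p T (x + z) + wt p T (x - z) - 2 * wt p T x \<le> C * (norm z / T)\<^sup>2 * wt p T x"
      by (simp add: mult_ac)
  qed
qed

section \<open>Convolution in weighted spaces\<close>

abbreviation wL1 :: "real \<Rightarrow> real \<Rightarrow> ('a::euclidean_space \<Rightarrow> real) \<Rightarrow> bool" where
  "wL1 p T g \<equiv> integrable lborel (\<lambda>x. wt p T x * g x)"

text \<open>Decay like the weight itself is what makes convolution with the kernel bounded on the
  weighted L1 space. The truncated kernels, the mollifiers and the majorants of their fractional
  Laplacians all have it.\<close>

definition tame :: "real \<Rightarrow> real \<Rightarrow> ('a::euclidean_space \<Rightarrow> real) \<Rightarrow> bool" where
  "tame p T h \<longleftrightarrow> h \<in> borel_measurable borel \<and> (\<exists>C. \<forall>x. \<bar>h x\<bar> \<le> C * wt p T x)"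

definition conv :: "('a::euclidean_space \<Rightarrow> real) \<Rightarrow> ('a \<Rightarrow> real) \<Rightarrow> 'a \<Rightarrow> real" where
  "conv g h x = (LBINT y. g y * h (x - y))"

lemma tame_measurable: "tame p T h \<Longrightarrow> h \<in> borel_measurable borel"
  by (simp add: tame_def)

lemma tame_bound:
  fixes h :: "'a::euclidean_space \<Rightarrow> real"
  assumes "tame p T h"
  obtains C where "0 \<le> C" "\<And>x. \<bar>h x\<bar> \<le> C * wt p T x"
proof -
  obtain C where C: "\<And>x. \<bar>h x\<bar> \<le> C * wt p T x" using assms by (auto simp: tame_def)
  show thesis
  proof
    fix x :: 'a
    have "C * wt p T x \<le> max 0 C * wt p T x" by (intro mult_right_mono) auto
    then show "\<bar>h x\<bar> \<le> max 0 C * wt p T x" using C[of x] by linarith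
  qed simp
qed

lemma tameI:
  fixes h :: "'a::euclidean_space \<Rightarrow> real"
  assumes p: "0 \<le> p" and T: "0 < T" and [measurable]: "h \<in> borel_measurable borel"
    and r: "0 < r" and B: "\<And>x. norm x \<le> r \<Longrightarrow> \<bar>h x\<bar> \<le> B"
    and C: "\<And>x. r \<le> norm x \<Longrightarrow> \<bar>h x\<bar> \<le> C * norm x powr - p" and C0: "0 \<le> C"
  shows "tame p T h"
proof -
  let ?m = "(1 + (r / T)\<^sup>2) powr (p / 2)" and ?n = "(1 / r\<^sup>2 + 1 / T\<^sup>2) powr (p / 2)"
  have B0: "0 \<le> B" using B[of 0] r by auto
  have "\<bar>h x\<bar> \<le> (B * ?m + C * ?n) * wt p T x" for x
  proof (cases "norm x \<le> r")
    case True
    have "1 + (norm x / T)\<^sup>2 \<le> 1 + (r / T)\<^sup>2"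
      using True T by (intro add_left_mono power_mono divide_right_mono) auto
    then have "(1 + (r / T)\<^sup>2) powr (- (p / 2)) \<le> wt p T x"
      unfolding wt_def using p wt_base_pos[of x T] by (intro powr_mono2') auto
    then have "?m * (1 + (r / T)\<^sup>2) powr (- (p / 2)) \<le> ?m * wt p T x"
      by (intro mult_left_mono) auto
    moreover have "?m * (1 + (r / T)\<^sup>2) powr (- (p / 2)) = 1"
      using add_pos_nonneg[of 1 "(r / T)\<^sup>2"] unfolding powr_add[symmetric] by simp
    ultimately have "B * 1 \<le> B * (?m * wt p T x)" using B0 by (intro mult_left_mono) auto
    moreover have "0 \<le> C * ?n * wt p T x" using C0 by simp
    ultimately show ?thesis using B[OF True] by (simp add: algebra_simps)
  next
    case False
    then have "\<bar>h x\<bar> \<le> C * (?n * wt p T x)"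
      using C[of x] norm_powr_le_wt[OF p T r, of x] C0
      by (meson less_eq_real_def linorder_not_le mult_left_mono order_trans)
    moreover have "0 \<le> B * ?m * wt p T x" using B0 by simp
    ultimately show ?thesis by (simp add: algebra_simps)
  qed
  then show ?thesis unfolding tame_def by (intro conjI exI allI) auto
qed

context
  fixes p T :: real
  assumes T: "0 < T"
begin

text \<open>Integrating \<open>wt_mult_le_sum\<close> in x leaves two copies of the total mass of
  the weight, finite because p exceeds the dimension.\<close>

lemma wt_conv_le:
  assumes p: "real DIM('a::euclidean_space) < p"
  obtains C where "0 \<le> C" "\<And>y::'a. integrable lborel (\<lambda>x. wt p T x * wt p T (x - y))"
    "\<And>y::'a. (LBINT x. wt p T x * wt p T (x - y)) \<le> C * wt p T y"
proof -
  define I where "I = (LBINT x. wt p T (x::'a))"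
  have p0: "0 \<le> p" by (rule dim_less_nonneg[OF p(1)])
  have int: "integrable lborel (wt p T :: 'a \<Rightarrow> real)" using p T by (rule integrable_wt)
  have "distr lborel borel ((+) (- y)) = (lborel :: 'a measure)" for y by (rule lborel_distr_plus)
  then have int_shift: "integrable lborel (\<lambda>x. wt p T (x - y))" for y :: 'a
    using integrable_distr_eq[of "(+) (- y)" lborel borel "wt p T"] int by simp
  have I_shift: "(LBINT x. wt p T (x - y)) = I" for y :: 'a
    using integral_distr[of "(+) (- y)" lborel borel "wt p T"] by (simp add: I_def lborel_distr_plus)
  have int_sum: "integrable lborel (\<lambda>x. 2 powr p * wt p T y * (wt p T x + wt p T (x - y)))" for y :: 'a
    by (intro integrable_mult_right L1_add int int_shift)
  show thesis
  proof (rule that[of "2 powr p * (2 * I)"])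
    show "0 \<le> 2 powr p * (2 * I)" by (simp add: I_def)
    fix y :: 'a
    show prod: "integrable lborel (\<lambda>x. wt p T x * wt p T (x - y))"
      by (rule L1_dominated[OF int_sum[of y]])
         (auto intro!: AE_I2 wt_mult_le_sum p0 le_abs_trans)
    have "(LBINT x. wt p T x * wt p T (x - y))
        \<le> (LBINT x. 2 powr p * wt p T y * (wt p T x + wt p T (x - y)))"
      by (intro integral_mono prod int_sum wt_mult_le_sum p0)
    also have "\<dots> = 2 powr p * (2 * I) * wt p T y"
      using int int_shift[of y] by (simp add: I_shift) (simp add: I_def)
    finally show "(LBINT x. wt p T x * wt p T (x - y)) \<le> 2 powr p * (2 * I) * wt p T y" .
  qed
qed

context
  fixes h :: "'a::euclidean_space \<Rightarrow> real"
  assumes p: "real DIM('a) < p" and h: "tame p T h"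
begin

private lemma hm [measurable]: "h \<in> borel_measurable borel"
  using h by (rule tame_measurable)

lemma tame_wt_integral:
  obtains C where "0 \<le> C" "\<And>y. integrable lborel (\<lambda>x. wt p T x * \<bar>h (x - y)\<bar>)"
    "\<And>y. (LBINT x. wt p T x * \<bar>h (x - y)\<bar>) \<le> C * wt p T y"
proof -
  obtain C where C: "0 \<le> C" "\<And>x. \<bar>h x\<bar> \<le> C * wt p T x" using tame_bound[OF h] by blast
  obtain D where D: "0 \<le> D" "\<And>y::'a. integrable lborel (\<lambda>x. wt p T x * wt p T (x - y))"
    "\<And>y::'a. (LBINT x. wt p T x * wt p T (x - y)) \<le> D * wt p T y"
    using wt_conv_le[OF p] by blast
  have b: "wt p T x * \<bar>h (x - y)\<bar> \<le> C * (wt p T x * wt p T (x - y))" for x y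
    using mult_left_mono[OF C(2)[of "x - y"], of "wt p T x"] by (simp add: mult_ac)
  have i2: "integrable lborel (\<lambda>x. C * (wt p T x * wt p T (x - y)))" for y :: 'a
    by (intro integrable_mult_right D)
  show thesis
  proof (rule that[of "C * D"])
    show "0 \<le> C * D" using C D by simp
    fix y
    show i1: "integrable lborel (\<lambda>x. wt p T x * \<bar>h (x - y)\<bar>)"
      by (rule L1_dominated[OF i2[of y]])
         (use b in \<open>auto intro!: AE_I2 le_abs_trans\<close>)
    have "(LBINT x. wt p T x * \<bar>h (x - y)\<bar>) \<le> (LBINT x. C * (wt p T x * wt p T (x - y)))"
      by (intro integral_mono i1 i2 b)
    also have "\<dots> \<le> C * (D * wt p T y)" using C D(3)[of y] by (simp add: mult_left_mono)
    finally show "(LBINT x. wt p T x * \<bar>h (x - y)\<bar>) \<le> C * D * wt p T y" by simp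
  qed
qed

context
  fixes g :: "'a \<Rightarrow> real"
  assumes g [measurable]: "g \<in> borel_measurable borel" and wg: "wL1 p T g"
begin

lemma integrable_conv_integrand: "integrable lborel (\<lambda>y. g y * h (x - y))"
proof -
  obtain C where C: "0 \<le> C" "\<And>x. \<bar>h x\<bar> \<le> C * wt p T x" using tame_bound[OF h] by blast
  define D where "D = 2 powr (p / 2) * (1 + (norm x / T)\<^sup>2) powr (p / 2)"
  have *: "\<bar>h (x - y)\<bar> \<le> C * D * wt p T y" for y
  proof -
    have "wt p T (x - y) \<le> D * wt p T y"
      using wt_shift[OF dim_less_nonneg[OF p], of T "y - x" y] by (simp add: D_def wt_diff_commute)
    then have "C * wt p T (x - y) \<le> C * (D * wt p T y)" using C(1) by (rule mult_left_mono)
    then show ?thesis using C(2)[of "x - y"] by (simp add: mult_ac)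
  qed
  show ?thesis
  proof (rule L1_dominated)
    show "integrable lborel (\<lambda>y. C * D * (wt p T y * g y))" by (intro integrable_mult_right wg)
    show "AE y in lborel. norm (g y * h (x - y)) \<le> norm (C * D * (wt p T y * g y))"
    proof (rule AE_I2)
      fix y
      have "\<bar>g y\<bar> * \<bar>h (x - y)\<bar> \<le> \<bar>g y\<bar> * (C * D * wt p T y)" by (intro mult_left_mono *) simp
      also have "\<dots> = \<bar>C * D * (wt p T y * g y)\<bar>"
        using C(1) by (simp add: abs_mult D_def)
      finally show "norm (g y * h (x - y)) \<le> norm (C * D * (wt p T y * g y))"
        by (simp add: abs_mult)
    qed
  qed simp
qed

lemma integrable_conv_pair:
  assumes [measurable]: "\<phi> \<in> borel_measurable borel" and \<phi>: "\<And>x. \<bar>\<phi> x\<bar> \<le> C * wt p T x"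
  shows "integrable (lborel \<Otimes>\<^sub>M lborel) (\<lambda>(y, x). \<phi> x * (g y * h (x - y)))"
proof -
  obtain D where D: "0 \<le> D" "\<And>y. integrable lborel (\<lambda>x. wt p T x * \<bar>h (x - y)\<bar>)"
    "\<And>y. (LBINT x. wt p T x * \<bar>h (x - y)\<bar>) \<le> D * wt p T y"
    using tame_wt_integral by blast
  have *: "integrable (lborel \<Otimes>\<^sub>M lborel) (\<lambda>(y, x). wt p T x * (g y * h (x - y)))"
  proof (rule lborel_pair.Fubini_integrable)
    have eq: "(LBINT x. norm (case (y, x) of (y, x) \<Rightarrow> wt p T x * (g y * h (x - y))))
        = \<bar>g y\<bar> * (LBINT x. wt p T x * \<bar>h (x - y)\<bar>)" for y
      by (subst integral_mult_right_zero[symmetric]) (simp add: abs_mult mult_ac)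
    show "integrable lborel (\<lambda>y. LBINT x. norm (case (y, x) of (y, x) \<Rightarrow> wt p T x * (g y * h (x - y))))"
      unfolding eq
    proof (rule L1_dominated)
      show "integrable lborel (\<lambda>y. D * (wt p T y * g y))" by (intro integrable_mult_right wg)
      show "AE y in lborel. norm (\<bar>g y\<bar> * (LBINT x. wt p T x * \<bar>h (x - y)\<bar>)) \<le> norm (D * (wt p T y * g y))"
      proof (rule AE_I2)
        fix y
        have "\<bar>g y\<bar> * (LBINT x. wt p T x * \<bar>h (x - y)\<bar>) \<le> \<bar>g y\<bar> * (D * wt p T y)"
          by (intro mult_left_mono D) simp
        then show "norm (\<bar>g y\<bar> * (LBINT x. wt p T x * \<bar>h (x - y)\<bar>)) \<le> norm (D * (wt p T y * g y))"
          using D(1) by (simp add: abs_mult mult_ac)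
      qed
    qed measurable
    show "AE y in lborel. integrable lborel (\<lambda>x. case (y, x) of (y, x) \<Rightarrow> wt p T x * (g y * h (x - y)))"
    proof (rule AE_I2)
      fix y
      have "integrable lborel (\<lambda>x. g y * (wt p T x * \<bar>h (x - y)\<bar>))" by (intro integrable_mult_right D)
      then have "integrable lborel (\<lambda>x. wt p T x * (g y * h (x - y)))"
        by (rule L1_dominated) (auto simp: abs_mult)
      then show "integrable lborel (\<lambda>x. case (y, x) of (y, x) \<Rightarrow> wt p T x * (g y * h (x - y)))" by simp
    qed
  qed measurable
  show ?thesis
  proof (rule L1_dominated)
    show "integrable (lborel \<Otimes>\<^sub>M lborel) (\<lambda>z. C * (case z of (y, x) \<Rightarrow> wt p T x * (g y * h (x - y))))"
      by (intro integrable_mult_right *)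
    show "AE z in lborel \<Otimes>\<^sub>M lborel. norm (case z of (y, x) \<Rightarrow> \<phi> x * (g y * h (x - y)))
        \<le> norm (C * (case z of (y, x) \<Rightarrow> wt p T x * (g y * h (x - y))))"
    proof (rule AE_I2, clarify)
      fix y x
      have "\<bar>\<phi> x\<bar> \<le> \<bar>C * wt p T x\<bar>" using \<phi>[of x] by linarith
      then have "\<bar>\<phi> x\<bar> * \<bar>g y * h (x - y)\<bar> \<le> \<bar>C * wt p T x\<bar> * \<bar>g y * h (x - y)\<bar>"
        by (rule mult_right_mono) simp
      then show "norm (\<phi> x * (g y * h (x - y))) \<le> norm (C * (wt p T x * (g y * h (x - y))))"
        by (simp add: abs_mult mult_ac)
    qed
  qed measurable
qed

lemma measurable_conv [measurable]: "conv g h \<in> borel_measurable borel"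
  unfolding conv_def by measurable

text \<open>Fubini puts the convolution onto the factor \<open>\<phi>\<close>. Later
  \<open>\<phi>\<close> is the weight, the weight times a sign, or the weight restricted to a set,
  so each estimate reduces to bounding the integral of \<open>\<phi> x * h (x - y)\<close> in
  x.\<close>

lemma conv_integrals:
  assumes [measurable]: "\<phi> \<in> borel_measurable borel" and \<phi>: "\<And>x. \<bar>\<phi> x\<bar> \<le> C * wt p T x"
  shows "integrable lborel (\<lambda>x. \<phi> x * conv g h x)"
    "integrable lborel (\<lambda>y. g y * (LBINT x. \<phi> x * h (x - y)))"
    "(LBINT x. \<phi> x * conv g h x) = (LBINT y. g y * (LBINT x. \<phi> x * h (x - y)))"
proof -
  note pair = integrable_conv_pair[OF assms]
  have eq1: "(LBINT y. \<phi> x * (g y * h (x - y))) = \<phi> x * conv g h x" for x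
    by (simp add: conv_def)
  have "(LBINT x. \<phi> x * (g y * h (x - y))) = (LBINT x. g y * (\<phi> x * h (x - y)))" for y
    by (simp add: mult_ac)
  then have eq2: "(LBINT x. \<phi> x * (g y * h (x - y))) = g y * (LBINT x. \<phi> x * h (x - y))" for y
    by simp
  show "integrable lborel (\<lambda>x. \<phi> x * conv g h x)"
    using lborel_pair.integrable_snd[OF pair] unfolding eq1 .
  show "integrable lborel (\<lambda>y. g y * (LBINT x. \<phi> x * h (x - y)))"
    using lborel_pair.integrable_fst[OF pair] unfolding eq2 by simp
  show "(LBINT x. \<phi> x * conv g h x) = (LBINT y. g y * (LBINT x. \<phi> x * h (x - y)))"
    using lborel_pair.Fubini_integral[OF pair] unfolding eq1 eq2 .
qed

lemma integrable_wt_conv: "integrable lborel (\<lambda>x. wt p T x * conv g h x)"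
  using conv_integrals(1)[of "wt p T" 1] by simp

end

lemma wt_conv_norm_le:
  assumes [measurable]: "g \<in> borel_measurable borel" and wg: "wL1 p T g"
    and D: "\<And>y. (LBINT x. wt p T x * \<bar>h (x - y)\<bar>) \<le> D * wt p T y"
  shows "(LBINT x. wt p T x * \<bar>conv g h x\<bar>) \<le> D * (LBINT x. wt p T x * \<bar>g x\<bar>)"
proof -
  note [measurable] = measurable_conv[OF assms(1,2)]
  have D0: "0 \<le> D"
  proof -
    have "0 \<le> (LBINT x. wt p T x * \<bar>h (x - 0)\<bar>)" by simp
    then have "0 \<le> D * wt p T (0::'a)" using D[of 0] by linarith
    then show ?thesis by (simp add: wt_def zero_le_mult_iff)
  qed
  have abs_wg: "integrable lborel (\<lambda>x. wt p T x * \<bar>g x\<bar>)"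
    using integrable_abs[OF wg] by (simp add: abs_mult)
  \<comment> \<open>The sign of the convolution linearises its absolute value, so that the Fubini
    identity applies.\<close>
  define \<phi> where "\<phi> x = wt p T x * sgn (conv g h x)" for x
  have [measurable]: "\<phi> \<in> borel_measurable borel" unfolding \<phi>_def by measurable
  have \<phi>1: "\<bar>\<phi> x\<bar> \<le> wt p T x" for x by (auto simp: \<phi>_def abs_mult abs_sgn_eq)
  then have \<phi>: "\<bar>\<phi> x\<bar> \<le> 1 * wt p T x" for x by simp
  obtain D' where D': "\<And>y. integrable lborel (\<lambda>x. wt p T x * \<bar>h (x - y)\<bar>)"
    using tame_wt_integral by blast
  have "(LBINT x. wt p T x * \<bar>conv g h x\<bar>) = (LBINT x. \<phi> x * conv g h x)"
    unfolding \<phi>_def by (intro L1_integral_cong) (auto simp: abs_sgn mult_ac)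
  also have "\<dots> = (LBINT y. g y * (LBINT x. \<phi> x * h (x - y)))"
    by (rule conv_integrals(3)[OF assms(1,2) _ \<phi>]) measurable
  also have "\<dots> \<le> (LBINT y. D * (wt p T y * \<bar>g y\<bar>))"
  proof (rule integral_mono)
    show "integrable lborel (\<lambda>y. g y * (LBINT x. \<phi> x * h (x - y)))"
      by (rule conv_integrals(2)[OF assms(1,2) _ \<phi>]) measurable
    show "integrable lborel (\<lambda>y. D * (wt p T y * \<bar>g y\<bar>))" by (intro integrable_mult_right abs_wg)
    fix y
    have "\<bar>LBINT x. \<phi> x * h (x - y)\<bar> \<le> (LBINT x. \<bar>\<phi> x * h (x - y)\<bar>)"
      by (rule integral_abs_bound)
    also have "\<dots> \<le> (LBINT x. wt p T x * \<bar>h (x - y)\<bar>)"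
    proof (rule integral_mono)
      have b: "\<bar>\<phi> x * h (x - y)\<bar> \<le> wt p T x * \<bar>h (x - y)\<bar>" for x
        unfolding abs_mult by (intro mult_right_mono \<phi>1) simp
      then show "integrable lborel (\<lambda>x. \<bar>\<phi> x * h (x - y)\<bar>)"
        by (intro L1_dominated[OF D'[of y]]) auto
      show "\<bar>\<phi> x * h (x - y)\<bar> \<le> wt p T x * \<bar>h (x - y)\<bar>" for x by (rule b)
    qed (rule D')
    also have "\<dots> \<le> D * wt p T y" by (rule D)
    finally have "\<bar>g y\<bar> * \<bar>LBINT x. \<phi> x * h (x - y)\<bar> \<le> \<bar>g y\<bar> * (D * wt p T y)"
      by (rule mult_left_mono) simp
    then show "g y * (LBINT x. \<phi> x * h (x - y)) \<le> D * (wt p T y * \<bar>g y\<bar>)"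
      by (simp add: mult_ac flip: abs_mult)
  qed
  also have "\<dots> = D * (LBINT x. wt p T x * \<bar>g x\<bar>)" by simp
  finally show ?thesis .
qed

end
end

lemma conv_diff:
  assumes "integrable lborel (\<lambda>y. g y * h (x - y))" "integrable lborel (\<lambda>y. g' y * h (x - y))"
  shows "conv (\<lambda>y. g y - g' y) h x = conv g h x - conv g' h x"
  using assms by (simp add: conv_def left_diff_distrib)

section \<open>The Kato inequality on a half-space\<close>

definition far :: "real \<Rightarrow> real \<Rightarrow> 'a::real_normed_vector \<Rightarrow> real" where
  "far p r z = indicator {z. r < norm z} z * norm z powr - p"

definition near :: "real \<Rightarrow> real \<Rightarrow> real \<Rightarrow> 'a::real_normed_vector \<Rightarrow> real" where
  "near p \<delta> r z = indicator {z. norm z \<le> r} z * max (norm z) \<delta> powr - p"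

text \<open>Capping the kernel, rather than cutting it off, keeps it radially nonincreasing.\<close>

definition trunc :: "real \<Rightarrow> real \<Rightarrow> 'a::real_normed_vector \<Rightarrow> real" where
  "trunc p \<delta> z = max (norm z) \<delta> powr - p"

lemma trunc_split: "\<delta> \<le> r \<Longrightarrow> trunc p \<delta> z = near p \<delta> r z + far p r z"
  by (auto simp: trunc_def near_def far_def max_def split: split_indicator)

lemma kernel_nonneg [simp]: "0 \<le> far p r z" "0 \<le> near p \<delta> r z" "0 \<le> trunc p \<delta> z"
  by (simp_all add: far_def near_def trunc_def)

lemma kernel_minus [simp]: "far p r (- z) = far p r z" "near p \<delta> r (- z) = near p \<delta> r z"
  "trunc p \<delta> (- z) = trunc p \<delta> z"
  by (simp_all add: far_def near_def trunc_def indicator_def)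

lemma kernel_measurable [measurable]: "far p r \<in> borel_measurable borel"
  "near p \<delta> r \<in> borel_measurable borel" "trunc p \<delta> \<in> borel_measurable borel"
  unfolding far_def near_def trunc_def by measurable

lemma trunc_antimono: "0 \<le> p \<Longrightarrow> 0 < \<delta> \<Longrightarrow> norm z \<le> norm w \<Longrightarrow> trunc p \<delta> w \<le> trunc p \<delta> z"
  unfolding trunc_def by (intro powr_mono2') auto

lemma tame_far:
  assumes "0 \<le> p" "0 < T" "0 < r"
  shows "tame p T (far p r :: 'a::euclidean_space \<Rightarrow> real)"
  by (rule tameI[where r = r and B = 0 and C = 1]) (use assms in \<open>auto simp: far_def split: split_indicator\<close>)

lemma tame_trunc:
  assumes "0 \<le> p" "0 < T" "0 < \<delta>"
  shows "tame p T (trunc p \<delta> :: 'a::euclidean_space \<Rightarrow> real)"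
  by (rule tameI[where r = \<delta> and B = "\<delta> powr - p" and C = 1])
     (use assms in \<open>auto simp: trunc_def max_def\<close>)

lemma tame_near:
  assumes "0 \<le> p" "0 < T" "0 < \<delta>" "\<delta> \<le> r"
  shows "tame p T (near p \<delta> r :: 'a::euclidean_space \<Rightarrow> real)"
  by (rule tameI[where r = r and B = "\<delta> powr - p" and C = 1])
     (use assms in \<open>auto simp: near_def split: split_indicator intro!: powr_mono2'\<close>)

lemma tame_integrable:
  fixes h :: "'a::euclidean_space \<Rightarrow> real"
  assumes "real DIM('a) < p" "0 < T" "tame p T h"
  shows "integrable lborel h"
proof -
  obtain C where C: "0 \<le> C" "\<And>x. \<bar>h x\<bar> \<le> C * wt p T x" using tame_bound[OF assms(3)] by blast
  show ?thesis
  proof (rule L1_dominated)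
    show "integrable lborel (\<lambda>x::'a. C * wt p T x)" by (intro integrable_mult_right integrable_wt assms)
  qed (use C assms(3) in \<open>auto simp: tame_def\<close>)
qed

text \<open>Averaging the substitutions x = y + z and x = y - z exposes the second difference of the
  weight. Its product with the kernel is at most a multiple of T^(-2) |z|^2 |z|^(-p)
  \<open>wt p T y\<close> on |z| <= r, a bound free of \<open>\<delta>\<close>; this uniformity lets
  \<open>\<delta>\<close> tend to 0 later.\<close>

lemma near_wt_le:
  assumes p: "real DIM('a::euclidean_space) < p" "p < real DIM('a) + 2"
  obtains C where "0 \<le> C"
    "\<And>T \<delta> r y::'a. \<lbrakk>0 < \<delta>; \<delta> \<le> r; 2 * r \<le> T\<rbrakk> \<Longrightarrow>
      (LBINT x. wt p T x * near p \<delta> r (x - y)) \<le>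
      ((LBINT z. near p \<delta> r (z::'a))
        + C / T\<^sup>2 * (LBINT z. indicator {z. norm z \<le> r} z * ((norm z)\<^sup>2 * norm (z::'a) powr - p))) * wt p T y"
proof -
  have p0: "0 \<le> p" by (rule dim_less_nonneg[OF p(1)])
  obtain C where C: "0 \<le> C"
    "\<And>T x z :: 'a. \<lbrakk>0 < T; norm z \<le> T / 2\<rbrakk> \<Longrightarrow>
      wt p T (x + z) + wt p T (x - z) - 2 * wt p T x \<le> C * (norm z / T)\<^sup>2 * wt p T x"
    using wt_second_difference[OF p0] by blast
  show thesis
  proof (rule that[of "C / 2"])
    show "0 \<le> C / 2" using C by simp
    fix T \<delta> r :: real and y :: 'a
    assume \<delta>: "0 < \<delta>" "\<delta> \<le> r" and r: "2 * r \<le> T"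
    then have T: "0 < T" by linarith
    let ?n = "near p \<delta> r :: 'a \<Rightarrow> real"
    let ?q = "\<lambda>z::'a. indicator {z. norm z \<le> r} z * ((norm z)\<^sup>2 * norm z powr - p)"
    have nt: "tame p T ?n" using p0 T \<delta> by (intro tame_near)
    have n: "integrable lborel ?n" using p(1) T nt by (rule tame_integrable)
    have i1: "integrable lborel (\<lambda>z. wt p T (y + z) * ?n z)" 
      by (rule L1_dominated[OF n])
         (auto intro!: AE_I2 mult_left_le_one_le wt_le_1 p0 simp: abs_mult)
    have i2: "integrable lborel (\<lambda>z. wt p T (y - z) * ?n z)"
      by (rule L1_dominated[OF n])
         (auto intro!: AE_I2 mult_left_le_one_le wt_le_1 p0 simp: abs_mult)
    have qi: "integrable lborel ?q" using p p0 \<delta> by (intro integrable_norm_powr_near) auto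
    have e1: "(LBINT x. wt p T x * ?n (x - y)) = (LBINT z. wt p T (y + z) * ?n z)"
      using integral_lborel_add[of "\<lambda>x. wt p T x * ?n (x - y)" y] by simp
    have e2: "(LBINT x. wt p T x * ?n (x - y)) = (LBINT z. wt p T (y - z) * ?n z)"
      using integral_lborel_diff[of "\<lambda>x. wt p T x * ?n (x - y)" y] by simp
    have "2 * (LBINT x. wt p T x * ?n (x - y))
        = (LBINT z. wt p T (y + z) * ?n z + wt p T (y - z) * ?n z)"
      using i1 i2 e1 e2 by simp
    also have "\<dots> \<le> (LBINT z. 2 * wt p T y * ?n z + C / T\<^sup>2 * wt p T y * ?q z)"
    proof (rule integral_mono)
      show "integrable lborel (\<lambda>z. wt p T (y + z) * ?n z + wt p T (y - z) * ?n z)"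
        by (intro L1_add i1 i2)
      show "integrable lborel (\<lambda>z. 2 * wt p T y * ?n z + C / T\<^sup>2 * wt p T y * ?q z)"
        by (intro L1_add integrable_mult_right n qi)
      fix z
      show "wt p T (y + z) * ?n z + wt p T (y - z) * ?n z \<le> 2 * wt p T y * ?n z + C / T\<^sup>2 * wt p T y * ?q z"
      \<comment> \<open>The origin is set apart because \<open>0 powr - p\<close> is 0, so the
        capped kernel is not below \<open>norm z powr - p\<close> there; at z = 0 the two sides
        simply agree.\<close>
      proof (cases "norm z \<le> r \<and> z \<noteq> 0")
        case True
        have "(wt p T (y + z) + wt p T (y - z) - 2 * wt p T y) * ?n z
            \<le> (C * (norm z / T)\<^sup>2 * wt p T y) * norm z powr - p"
        proof (rule order_trans[OF mult_right_mono[OF C(2)] mult_left_mono])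
          show "?n z \<le> norm z powr - p"
            using True \<delta> p0 by (auto simp: near_def intro!: powr_mono2')
        qed (use True r T C(1) in auto)
        also have "\<dots> = C / T\<^sup>2 * wt p T y * ?q z" using True by (simp add: power_divide)
        finally show ?thesis by (simp add: algebra_simps)
      qed (auto simp: near_def)
    qed
    also have "\<dots> = 2 * (((LBINT z. ?n z) + C / 2 / T\<^sup>2 * (LBINT z. ?q z)) * wt p T y)"
      using n qi by (simp add: field_simps)
    finally show "(LBINT x. wt p T x * ?n (x - y))
        \<le> ((LBINT z. ?n z) + C / 2 / T\<^sup>2 * (LBINT z. ?q z)) * wt p T y" by simp
  qed
qed

text \<open>The squared distances differ by 2 c (a \<bullet> x - b) with c = 2 (a \<bullet> y - b) /
  (a \<bullet> a), a product of nonnegative numbers.\<close>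

lemma norm_diff_hyp_refl_ge:
  assumes "a \<noteq> 0" "b \<le> a \<bullet> x" "b \<le> a \<bullet> y"
  shows "norm (x - y) \<le> norm (x - hyp_refl a b y)"
proof -
  define c where "c = 2 * (a \<bullet> y - b) / (a \<bullet> a)"
  have aa: "0 < a \<bullet> a" using assms by simp
  have c: "0 \<le> c" using assms by (simp add: c_def)
  have caa: "c * (a \<bullet> a) = 2 * (a \<bullet> y - b)" using aa by (simp add: c_def)
  have "(norm (w + c *\<^sub>R a))\<^sup>2 = (norm w)\<^sup>2 + c * (2 * (a \<bullet> w) + c * (a \<bullet> a))" for w
    by (simp add: power2_norm_eq_inner inner_add_left inner_add_right inner_commute algebra_simps)
  from this[of "x - y"] have "(norm (x - hyp_refl a b y))\<^sup>2
      = (norm (x - y))\<^sup>2 + c * (2 * (a \<bullet> x - a \<bullet> y) + c * (a \<bullet> a))"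
    by (simp add: hyp_refl_def c_def inner_diff_right diff_diff_eq2 add_diff_eq algebra_simps)
  also have "2 * (a \<bullet> x - a \<bullet> y) + c * (a \<bullet> a) = 2 * (a \<bullet> x - b)" by (simp add: caa)
  finally have "(norm (x - y))\<^sup>2 \<le> (norm (x - hyp_refl a b y))\<^sup>2" using c assms by simp
  then show ?thesis by (rule power2_le_imp_le) simp
qed

definition superlevel :: "'a::euclidean_space \<Rightarrow> real \<Rightarrow> real \<Rightarrow> ('a \<Rightarrow> real) \<Rightarrow> 'a set" where
  "superlevel a b \<theta> Z = {x. b < a \<bullet> x \<and> \<theta> < Z x}"

definition excess :: "'a::euclidean_space \<Rightarrow> real \<Rightarrow> real \<Rightarrow> ('a \<Rightarrow> real) \<Rightarrow> 'a \<Rightarrow> real" where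
  "excess a b \<theta> Z x = indicator (superlevel a b \<theta> Z) x * (Z x - \<theta>)"

context
  fixes p T \<theta> b :: real and a :: "'a::euclidean_space" and Z :: "'a \<Rightarrow> real" and E Y
  assumes p: "real DIM('a) < p" and T: "0 < T" and a: "a \<noteq> 0" and \<theta>: "0 \<le> \<theta>"
    and Z [measurable]: "Z \<in> borel_measurable borel" and wZ: "wL1 p T Z"
    and anti: "\<And>x. Z (hyp_refl a b x) = - Z x"
  defines E_superlevel: "E \<equiv> superlevel a b \<theta> Z" and Y_excess: "Y \<equiv> excess a b \<theta> Z"
begin

private lemma E_def: "E = {x. b < a \<bullet> x \<and> \<theta> < Z x}"
  by (simp add: E_superlevel superlevel_def)

private lemma Y_def: "Y = (\<lambda>x. indicator E x * (Z x - \<theta>))"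
  by (auto simp: Y_excess E_superlevel excess_def)

private lemma E_measurable [measurable]: "E \<in> sets borel"
  unfolding E_def by measurable

private lemma Y_measurable [measurable]: "Y \<in> borel_measurable borel"
  unfolding Y_def by measurable

private lemma Y_nonneg: "0 \<le> Y x"
  by (auto simp: Y_def E_def split: split_indicator)

private lemma wY: "wL1 p T Y"
proof (rule L1_dominated[OF wZ])
  have "\<bar>Y x\<bar> \<le> \<bar>Z x\<bar>" for x using \<theta> by (auto simp: Y_def E_def split: split_indicator)
  then show "AE x in lborel. norm (wt p T x * Y x) \<le> norm (wt p T x * Z x)"
    by (auto simp: abs_mult intro!: mult_left_mono)
qed measurable

text \<open>Reflecting the integration variable pairs each point with its mirror image; radial monotonicity
  of the kernel then gives the sign.\<close>
lemma kato_trunc: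
  assumes \<delta>: "0 < \<delta>" and x: "x \<in> E"
  shows "(LBINT z. trunc p \<delta> (z::'a)) * Y x - conv Y (trunc p \<delta>) x
    \<le> (LBINT z. trunc p \<delta> (z::'a)) * Z x - conv Z (trunc p \<delta>) x"
proof -
  let ?K = "trunc p \<delta> :: 'a \<Rightarrow> real"
  have K: "tame p T ?K" using dim_less_nonneg[OF p] T \<delta> by (rule tame_trunc)
  have iK: "integrable lborel (\<lambda>y. ?K (x - y))"
    using integrable_lborel_diff tame_integrable[OF p T K] by blast
  have IK: "(LBINT y. ?K (x - y)) = (LBINT z. ?K z)"
    by (rule integral_lborel_diff) measurable
  have iZ: "integrable lborel (\<lambda>y. Z y * ?K (x - y))" by (rule integrable_conv_integrand[OF T p K Z wZ])
  have iY: "integrable lborel (\<lambda>y. Y y * ?K (x - y))"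
    by (rule integrable_conv_integrand[OF T p K Y_measurable wY])
  \<comment> \<open>At a point of \<open>E\<close> one has \<open>Z x = Y x + \<theta>\<close>, so
    the claim amounts to a nonnegative integral of this function. On the open half-space
    \<open>Z - Y\<close> is the minimum of \<open>Z\<close> and \<open>\<theta>\<close>; elsewhere
    it is \<open>Z\<close>.\<close>
  let ?F = "\<lambda>y. (\<theta> - (Z y - Y y)) * ?K (x - y)"
  have F_eq: "?F = (\<lambda>y. \<theta> * ?K (x - y) - Z y * ?K (x - y) + Y y * ?K (x - y))"
    by (auto simp: algebra_simps)
  have iF: "integrable lborel ?F" unfolding F_eq
    by (intro L1_add L1_diff integrable_mult_right iK iZ iY)
  have iF': "integrable lborel (\<lambda>y. ?F (hyp_refl a b y))" by (rule integrable_hyp_refl[OF a iF])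
  have half: "0 \<le> ?F y + ?F (hyp_refl a b y)" if y: "b \<le> a \<bullet> y" for y
  proof -
    have "?K (x - hyp_refl a b y) \<le> ?K (x - y)"
      using x y by (intro trunc_antimono norm_diff_hyp_refl_ge dim_less_nonneg[OF p] \<delta> a) (auto simp: E_def)
    then have k: "0 \<le> ?K (x - hyp_refl a b y)" "0 \<le> ?K (x - y) - ?K (x - hyp_refl a b y)" by auto
    have Y': "Y (hyp_refl a b y) = 0" using y by (simp add: Y_def E_def inner_hyp_refl[OF a])
    \<comment> \<open>The strict inequality in \<open>E\<close> leaves out the hyperplane, whose
      points are fixed by the reflection; oddness makes \<open>Z\<close> vanish there.\<close>
    have "a \<bullet> hyp_refl a b y = a \<bullet> y \<Longrightarrow> hyp_refl a b y = y"
      using a by (simp add: inner_hyp_refl) (simp add: hyp_refl_def)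
    then have Z0: "Z y = 0" if "a \<bullet> y = b" using anti[of y] that a by (auto simp: inner_hyp_refl)
    \<comment> \<open>For y in \<open>E\<close> the value at y is 0 and the mirror value is
      (\<theta> + Z y) times the kernel. Otherwise the pair sums to (\<theta> - Z y) times a
      nonnegative difference of kernels, plus a nonnegative multiple of \<theta>.\<close>
    show ?thesis
    proof (cases "y \<in> E")
      case True
      then show ?thesis using k \<theta> Y' anti[of y] by (auto simp: Y_def E_def)
    next
      case False
      then have Yy: "Y y = 0" by (simp add: Y_def)
      have Zy: "Z y \<le> \<theta>" using False y Z0 \<theta> by (cases "a \<bullet> y = b") (auto simp: E_def)
      have "?F y + ?F (hyp_refl a b y)
          = (\<theta> - Z y) * (?K (x - y) - ?K (x - hyp_refl a b y)) + 2 * \<theta> * ?K (x - hyp_refl a b y)"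
        by (simp add: Yy Y' anti algebra_simps)
      then show ?thesis using k Zy \<theta> by simp
    qed
  qed
  have "0 \<le> ?F y + ?F (hyp_refl a b y)" for y
  proof (cases "b \<le> a \<bullet> y")
    case False
    then have "b \<le> a \<bullet> hyp_refl a b y" by (simp add: inner_hyp_refl[OF a])
    from half[OF this] show ?thesis using a by simp
  qed (rule half)
  then have "0 \<le> (LBINT y. ?F y + ?F (hyp_refl a b y))" by (intro integral_nonneg_AE) auto
  also have "\<dots> = (LBINT y. ?F y) + (LBINT y. ?F (hyp_refl a b y))"
    by (rule L1_integral_add[OF iF iF'])
  also have "(LBINT y. ?F (hyp_refl a b y)) = (LBINT y. ?F y)"
    by (rule integral_hyp_refl[OF a]) measurable
  finally have "0 \<le> (LBINT y. ?F y)" by simp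
  also have "\<dots> = \<theta> * (LBINT z. ?K z) - conv Z ?K x + conv Y ?K x"
    unfolding F_eq conv_def using iK iZ iY by (simp add: IK)
  finally have "conv Z ?K x - conv Y ?K x \<le> \<theta> * (LBINT z. ?K z)" by simp
  moreover have "Z x = Y x + \<theta>" using x by (simp add: Y_def)
  ultimately show ?thesis by (simp add: algebra_simps)
qed

text \<open>The Kato inequality on \<open>E\<close> is integrated against the weight. The
  short-range convolution may be extended to the whole space, because off \<open>E\<close> the
  function \<open>Y\<close> is 0 and this convolution is nonnegative; Fubini then moves it onto the
  weight, where the kernel mass cancels and only \<eta> remains. The long-range convolution is kept
  on \<open>E\<close> alone: long jumps rarely land in a set of finite measure.\<close>

lemma core_trunc:
  assumes \<delta>: "0 < \<delta>" "\<delta> \<le> r"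
    and \<eta>: "\<And>y::'a. (LBINT x. wt p T x * near p \<delta> r (x - y)) \<le> ((LBINT z. near p \<delta> r (z::'a)) + \<eta>) * wt p T y"
  shows "((LBINT z. far p r (z::'a)) - \<eta>) * (LBINT x. wt p T x * Y x)
      - (LBINT x. wt p T x * (indicator E x * conv Y (far p r) x))
    \<le> (LBINT x. wt p T x * (indicator E x * ((LBINT z. trunc p \<delta> (z::'a)) * Z x - conv Z (trunc p \<delta>) x)))"
    (is "?L \<le> ?R")
proof -
  let ?K = "trunc p \<delta> :: 'a \<Rightarrow> real" and ?N = "near p \<delta> r :: 'a \<Rightarrow> real" and ?B = "far p r :: 'a \<Rightarrow> real"
  let ?k = "LBINT z. ?K z" and ?n = "LBINT z. ?N z" and ?c = "LBINT z. ?B z"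
  have r: "0 < r" using \<delta> by linarith
  have K: "tame p T ?K" using dim_less_nonneg[OF p] T \<delta>(1) by (rule tame_trunc)
  have N: "tame p T ?N" using dim_less_nonneg[OF p] T \<delta> by (rule tame_near)
  have B: "tame p T ?B" using dim_less_nonneg[OF p] T r by (rule tame_far)
  have split: "?K = (\<lambda>z. ?N z + ?B z)" using \<delta> by (auto simp: trunc_split)
  have k: "?k = ?n + ?c" unfolding split using tame_integrable[OF p T] N B by simp
  have convY: "conv Y ?K x = conv Y ?N x + conv Y ?B x" for x
    using integrable_conv_integrand[OF T p N Y_measurable wY] integrable_conv_integrand[OF T p B Y_measurable wY]
    unfolding split conv_def by (simp add: distrib_left)
  note mN [measurable] = measurable_conv[OF T p N Y_measurable wY]
  note mB [measurable] = measurable_conv[OF T p B Y_measurable wY]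
  note mK [measurable] = measurable_conv[OF T p K Z wZ]
  have ind: "\<bar>wt p T x * indicator E x\<bar> \<le> 1 * wt p T x" for x by (auto split: split_indicator)
  have iN: "integrable lborel (\<lambda>x. wt p T x * conv Y ?N x)" by (rule integrable_wt_conv[OF T p N Y_measurable wY])
  have iB: "integrable lborel (\<lambda>x. wt p T x * indicator E x * conv Y ?B x)"
    by (rule conv_integrals(1)[OF T p B Y_measurable wY _ ind]) measurable
  have iK: "integrable lborel (\<lambda>x. wt p T x * indicator E x * conv Z ?K x)"
    by (rule conv_integrals(1)[OF T p K Z wZ _ ind]) measurable
  have iZE: "integrable lborel (\<lambda>x. wt p T x * indicator E x * Z x)"
    by (rule L1_dominated[OF wZ]) (auto split: split_indicator)
  have pointwise: "?n * (wt p T x * Y x) - wt p T x * conv Y ?N x + (?c * (wt p T x * Y x) - wt p T x * indicator E x * conv Y ?B x)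
      \<le> ?k * (wt p T x * indicator E x * Z x) - wt p T x * indicator E x * conv Z ?K x" for x
  proof (cases "x \<in> E")
    case True
    have "wt p T x * (?k * Y x - conv Y ?K x) \<le> wt p T x * (?k * Z x - conv Z ?K x)"
      by (intro mult_left_mono kato_trunc \<delta> True) simp
    then show ?thesis using True by (simp add: k convY algebra_simps)
  next
    case False
    have "0 \<le> conv Y ?N x" unfolding conv_def by (intro integral_nonneg_AE) (auto simp: Y_nonneg)
    then show ?thesis using False by (simp add: Y_def)
  qed
  have "(LBINT x. wt p T x * conv Y ?N x) = (LBINT y. Y y * (LBINT x. wt p T x * ?N (x - y)))"
    using conv_integrals(3)[OF T p N Y_measurable wY, of "wt p T" 1] by simp
  also have "\<dots> \<le> (LBINT y. (?n + \<eta>) * (wt p T y * Y y))"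
  proof (rule integral_mono)
    show "integrable lborel (\<lambda>y. Y y * (LBINT x. wt p T x * ?N (x - y)))"
      using conv_integrals(2)[OF T p N Y_measurable wY, of "wt p T" 1] by simp
    show "integrable lborel (\<lambda>y. (?n + \<eta>) * (wt p T y * Y y))" by (intro integrable_mult_right wY)
    show "Y y * (LBINT x. wt p T x * ?N (x - y)) \<le> (?n + \<eta>) * (wt p T y * Y y)" for y
      using mult_left_mono[OF \<eta>[of y] Y_nonneg[of y]] by (simp add: mult_ac)
  qed
  also have "\<dots> = (?n + \<eta>) * (LBINT y. wt p T y * Y y)" by simp
  finally have A: "(LBINT x. wt p T x * conv Y ?N x) \<le> (?n + \<eta>) * (LBINT y. wt p T y * Y y)" .
  have "(LBINT x. ?n * (wt p T x * Y x) - wt p T x * conv Y ?N x + (?c * (wt p T x * Y x) - wt p T x * indicator E x * conv Y ?B x))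
      = ?n * (LBINT x. wt p T x * Y x) - (LBINT x. wt p T x * conv Y ?N x)
        + (?c * (LBINT x. wt p T x * Y x) - (LBINT x. wt p T x * indicator E x * conv Y ?B x))"
    using integrable_mult_right[OF wY, of ?n] integrable_mult_right[OF wY, of ?c] iN iB
    by (simp only: L1_integral_add L1_integral_diff
        L1_diff integral_mult_right_zero)
  moreover have "?L = ?c * (LBINT x. wt p T x * Y x) - \<eta> * (LBINT x. wt p T x * Y x)
      - (LBINT x. wt p T x * indicator E x * conv Y ?B x)"
    by (simp only: left_diff_distrib mult.assoc)
  ultimately have "?L \<le> (LBINT x. ?n * (wt p T x * Y x) - wt p T x * conv Y ?N x + (?c * (wt p T x * Y x) - wt p T x * indicator E x * conv Y ?B x))"
    using A unfolding distrib_right by linarith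
  also have "\<dots> \<le> (LBINT x. ?k * (wt p T x * indicator E x * Z x) - wt p T x * indicator E x * conv Z ?K x)"
    by (intro integral_mono pointwise L1_add L1_diff
        integrable_mult_right wY iN iB iK iZE)
  also have "\<dots> = ?R"
    by (intro L1_integral_cong) (auto simp: algebra_simps)
  finally show ?thesis .
qed

end

section \<open>Mollifiers\<close>

lemma Ck_fun_mono: "Ck_fun (Suc k) f \<Longrightarrow> Ck_fun k f"
proof (induction k arbitrary: f)
  case 0
  then obtain f' where "\<And>x. (f has_derivative f' x) (at x)" by auto
  then show ?case
    by (auto intro!: continuous_at_imp_continuous_on intro: has_derivative_continuous)
next
  case (Suc k)
  then obtain f' where "\<forall>x. (f has_derivative f' x) (at x)" "\<forall>v. Ck_fun (Suc k) (\<lambda>x. f' x v)"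
    by (subst (asm) Ck_fun.simps(2)) blast
  then show ?case unfolding Ck_fun.simps(2)[of k] by (intro exI[of _ f'] conjI allI Suc.IH) auto
qed

lemma Ck_fun_const: "Ck_fun k (\<lambda>x. c)"
proof (induction k arbitrary: c)
  case (Suc k)
  then show ?case by (auto intro!: exI[of _ "\<lambda>x v. 0"])
qed simp

lemma Ck_fun_inner: "Ck_fun k (\<lambda>x. (x - c) \<bullet> v)"
proof (cases k)
  case (Suc n)
  have "((\<lambda>x. (x - c) \<bullet> v) has_derivative (\<lambda>h. h \<bullet> v)) (at x)" for x
    by (auto intro!: derivative_eq_intros)
  then show ?thesis unfolding Suc Ck_fun.simps
    by (intro exI[of _ "\<lambda>x h. h \<bullet> v"]) (auto intro: Ck_fun_const)
qed (auto intro!: continuous_intros)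

lemma Ck_fun_add: "Ck_fun k f \<Longrightarrow> Ck_fun k g \<Longrightarrow> Ck_fun k (\<lambda>x. f x + g x)"
proof (induction k arbitrary: f g)
  case (Suc k)
  then obtain f' g' where "\<forall>x. (f has_derivative f' x) (at x)" "\<forall>v. Ck_fun k (\<lambda>x. f' x v)"
    "\<forall>x. (g has_derivative g' x) (at x)" "\<forall>v. Ck_fun k (\<lambda>x. g' x v)" by auto
  then show ?case
    by (auto intro!: exI[of _ "\<lambda>x v. f' x v + g' x v"] Suc.IH has_derivative_add)
qed (auto intro: continuous_on_add)

lemma Ck_fun_mult: "Ck_fun k f \<Longrightarrow> Ck_fun k g \<Longrightarrow> Ck_fun k (\<lambda>x. f x * g x)"
proof (induction k arbitrary: f g)
  case (Suc k)
  then obtain f' g' where D: "\<forall>x. (f has_derivative f' x) (at x)" "\<forall>v. Ck_fun k (\<lambda>x. f' x v)"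
    "\<forall>x. (g has_derivative g' x) (at x)" "\<forall>v. Ck_fun k (\<lambda>x. g' x v)" by auto
  have "Ck_fun k f" "Ck_fun k g" using Suc.prems by (auto intro: Ck_fun_mono simp del: Ck_fun.simps)
  then have "Ck_fun k (\<lambda>x. f x * g' x v + f' x v * g x)" for v
    using D by (intro Ck_fun_add Suc.IH) auto
  moreover have "((\<lambda>x. f x * g x) has_derivative (\<lambda>v. f x * g' x v + f' x v * g x)) (at x)" for x
    using D by (intro has_derivative_mult) auto
  ultimately show ?case unfolding Ck_fun.simps
    by (intro exI[of _ "\<lambda>x v. f x * g' x v + f' x v * g x"]) auto
qed (auto intro: continuous_on_mult)

text \<open>\<open>flat 0\<close> is the classical cutoff exp (-1/t). The powers of 1/t are included
  so that the derivative of each member is a linear combination of members; smoothness then follows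
  by induction on the order with \<open>n\<close> arbitrary.\<close>

definition flat :: "nat \<Rightarrow> real \<Rightarrow> real" where
  "flat n t = (if t \<le> 0 then 0 else inverse t ^ n * exp (- inverse t))"

lemma flat_nonneg: "0 \<le> flat n t"
  by (simp add: flat_def)

text \<open>A single term of the exponential series gives (1/t)^n / n! <= exp (1/t). These bounds
  supply the explicit constants of the Taylor estimate.\<close>

lemma flat_le_fact: "flat n t \<le> fact n"
proof (cases "t \<le> 0")
  case False
  have "inverse t ^ n / fact n \<le> exp (inverse t)"
  proof -
    have "(\<Sum>k\<in>{n}. inverse t ^ k /\<^sub>R fact k) \<le> (\<Sum>k. inverse t ^ k /\<^sub>R fact k)"
      using False by (intro sum_le_suminf summable_exp_generic) auto
    then show ?thesis by (simp add: exp_def divide_inverse mult.commute)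
  qed
  then have "inverse t ^ n \<le> exp (inverse t) * fact n" by (simp add: divide_le_eq)
  then show ?thesis using False by (simp add: flat_def exp_minus field_simps)
qed (simp add: flat_def)

lemma flat_tendsto_0: "(flat n \<longlongrightarrow> 0) (at 0)"
proof (rule filterlim_split_at_real)
  have "eventually (\<lambda>t. 0 = flat n t) (at_left 0)"
    by (auto simp: eventually_at_filter flat_def)
  then show "(flat n \<longlongrightarrow> 0) (at_left 0)" by (rule tendsto_eventually[OF eventually_mono]) auto
  have "((\<lambda>t. inverse t ^ n / exp (inverse t)) \<longlongrightarrow> 0) (at_right (0::real))"
    by (rule filterlim_compose[OF tendsto_power_div_exp_0 filterlim_inverse_at_top_right])
  moreover have "eventually (\<lambda>t. inverse t ^ n / exp (inverse t) = flat n t) (at_right 0)"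
    by (auto simp: eventually_at_filter flat_def exp_minus field_simps)
  ultimately show "(flat n \<longlongrightarrow> 0) (at_right 0)" by (rule Lim_transform_eventually)
qed

lemma flat_deriv: "(flat n has_real_derivative (flat (n + 2) t - real n * flat (n + 1) t)) (at t)"
proof (cases t "0::real" rule: linorder_cases)
  case less
  have "((\<lambda>t. 0) has_real_derivative 0) (at t)" by simp
  then have "(flat n has_real_derivative 0) (at t)"
    by (rule DERIV_cong_ev[THEN iffD1, rotated 3])
       (use less in \<open>auto simp: flat_def intro!: eventually_mono[OF eventually_nhds_in_open[of "{..<0}"]]\<close>)
  then show ?thesis using less by (simp add: flat_def)
next
  case equal
  \<comment> \<open>The difference quotient of \<open>flat n\<close> at 0 is
    \<open>flat (Suc n)\<close>, which tends to 0 from both sides.\<close>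
  have "((\<lambda>h. (flat n (0 + h) - flat n 0) / h) \<longlongrightarrow> 0) (at 0)"
    by (rule Lim_transform_eventually[OF flat_tendsto_0[of "Suc n"]])
       (auto simp: flat_def eventually_at_filter divide_inverse)
  then show ?thesis using equal by (simp add: DERIV_def flat_def)
next
  case greater
  have "((\<lambda>t. inverse t ^ n * exp (- inverse t)) has_real_derivative (flat (n + 2) t - real n * flat (n + 1) t)) (at t)"
    using greater
    by (auto intro!: derivative_eq_intros simp: flat_def power2_eq_square)
       (cases n; simp add: field_simps power2_eq_square)
  then show ?thesis
    by (rule DERIV_cong_ev[THEN iffD1, rotated 3])
       (use greater in \<open>auto simp: flat_def intro!: eventually_mono[OF eventually_nhds_in_open[of "{0<..}"]]\<close>)
qed

lemma flat_measurable [measurable]: "flat n \<in> borel_measurable borel"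
  unfolding flat_def by measurable

lemma has_derivative_flat_ball:
  "((\<lambda>x. flat n (e - (x - c) \<bullet> (x - c))) has_derivative
     (\<lambda>v. (flat (n + 2) (e - (x - c) \<bullet> (x - c)) - real n * flat (n + 1) (e - (x - c) \<bullet> (x - c))) * (- 2 * ((x - c) \<bullet> v)))) (at x)"
proof -
  have "((\<lambda>x. e - (x - c) \<bullet> (x - c)) has_derivative (\<lambda>v. - 2 * ((x - c) \<bullet> v))) (at x)"
    by (auto intro!: derivative_eq_intros simp: inner_commute)
  from has_derivative_compose[OF this flat_deriv[unfolded has_field_derivative_def]]
  show ?thesis by (simp add: mult.commute)
qed

lemma Ck_fun_flat_ball: "Ck_fun k (\<lambda>x. flat n (e - (x - c) \<bullet> (x - c)))"
proof (induction k arbitrary: n)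
  case 0
  show ?case unfolding Ck_fun.simps
    by (intro continuous_at_imp_continuous_on ballI has_derivative_continuous[OF has_derivative_flat_ball])
next
  case (Suc k)
  let ?q = "\<lambda>x. e - (x - c) \<bullet> (x - c)"
  have "Ck_fun k (\<lambda>x. (flat (n + 2) (?q x) + (- real n) * flat (n + 1) (?q x)) * ((- 2) * ((x - c) \<bullet> v)))" for v
    by (intro Ck_fun_mult Ck_fun_add Ck_fun_const Ck_fun_inner Suc.IH)
  then have "Ck_fun k (\<lambda>x. (flat (n + 2) (?q x) - real n * flat (n + 1) (?q x)) * (- 2 * ((x - c) \<bullet> v)))" for v
    by simp
  then show ?case unfolding Ck_fun.simps(2) using has_derivative_flat_ball[of n e c]
    by (intro exI[of _ "\<lambda>x v. (flat (n + 2) (?q x) - real n * flat (n + 1) (?q x)) * (- 2 * ((x - c) \<bullet> v))"]) auto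
qed

definition bump :: "real \<Rightarrow> 'a::euclidean_space \<Rightarrow> real" where
  "bump \<epsilon> x = flat 0 (\<epsilon>\<^sup>2 - x \<bullet> x)"

definition moll :: "real \<Rightarrow> 'a::euclidean_space \<Rightarrow> real" where
  "moll \<epsilon> x = bump \<epsilon> x / (LBINT y. bump \<epsilon> (y::'a))"

lemma bump_eq_0: "0 < \<epsilon> \<Longrightarrow> \<epsilon> \<le> norm x \<Longrightarrow> bump \<epsilon> x = 0"
  using power_mono[of \<epsilon> "norm x" 2] by (simp add: bump_def flat_def power2_norm_eq_inner)

lemma bump_measurable [measurable]: "bump \<epsilon> \<in> borel_measurable borel"
  unfolding bump_def by measurable

lemma bump_bounds: "0 \<le> bump \<epsilon> x" "bump \<epsilon> x \<le> 1"
  using flat_nonneg[of 0] flat_le_fact[of 0] by (auto simp: bump_def)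

lemma bump_integrable:
  assumes "0 < \<epsilon>"
  shows "integrable lborel (bump \<epsilon> :: 'a::euclidean_space \<Rightarrow> real)"
proof (rule L1_dominated)
  show "integrable lborel (\<lambda>x. indicator (cball (0::'a) \<epsilon>) x :: real)"
    using emeasure_lborel_cball_finite[of "0::'a" \<epsilon>] by (intro integrable_real_indicator) auto
  show "AE x in lborel. norm (bump \<epsilon> (x::'a)) \<le> norm (indicator (cball (0::'a) \<epsilon>) x :: real)"
  proof (rule AE_I2)
    show "norm (bump \<epsilon> x) \<le> norm (indicator (cball (0::'a) \<epsilon>) x :: real)" for x :: 'a
      using bump_bounds[of \<epsilon> x] bump_eq_0[OF assms, of x] by (auto split: split_indicator)
  qed
qed measurable

lemma bump_integral_pos:
  assumes "0 < \<epsilon>"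
  shows "0 < (LBINT y. bump \<epsilon> (y::'a::euclidean_space))"
proof -
  \<comment> \<open>On the ball of half the radius, \<epsilon>^2 - |y|^2 is at least 3/4
    \<epsilon>^2, so the bump is at least this constant.\<close>
  let ?c = "exp (- inverse (3 / 4 * \<epsilon>\<^sup>2))" and ?B = "ball (0::'a) (\<epsilon> / 2)"
  have "0 < ?c * measure lborel ?B" using assms content_ball_pos[of "\<epsilon> / 2" "0::'a"] by simp
  also have "?c * measure lborel ?B = (LBINT y. ?c * indicator ?B y)" by simp
  also have "\<dots> \<le> (LBINT y. bump \<epsilon> (y::'a))"
  proof (rule integral_mono)
    show "integrable lborel (\<lambda>y. ?c * indicator ?B y)"
      using emeasure_lborel_ball_finite[of "0::'a" "\<epsilon> / 2"]
      by (intro integrable_mult_right integrable_real_indicator) auto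
    show "integrable lborel (bump \<epsilon> :: 'a \<Rightarrow> real)" using assms by (rule bump_integrable)
    fix y :: 'a
    show "?c * indicator ?B y \<le> bump \<epsilon> y"
    proof (cases "y \<in> ?B")
      case True
      then have "(norm y)\<^sup>2 \<le> (\<epsilon> / 2)\<^sup>2" by (intro power_mono) auto
      then have q: "3 / 4 * \<epsilon>\<^sup>2 \<le> \<epsilon>\<^sup>2 - y \<bullet> y" by (simp add: power2_norm_eq_inner power_divide)
      have e: "0 < 3 / 4 * \<epsilon>\<^sup>2" using assms by simp
      then have "inverse (\<epsilon>\<^sup>2 - y \<bullet> y) \<le> inverse (3 / 4 * \<epsilon>\<^sup>2)" using q by (intro le_imp_inverse_le)
      moreover have "0 < \<epsilon>\<^sup>2 - y \<bullet> y" using q e by linarith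
      ultimately show ?thesis using True by (simp add: bump_def flat_def)
    qed (use bump_bounds(1)[of \<epsilon> y] in simp)
  qed
  finally show ?thesis .
qed

lemma moll_nonneg [simp]: "0 \<le> moll \<epsilon> x"
  unfolding moll_def using bump_bounds by (intro divide_nonneg_nonneg integral_nonneg_AE) auto

lemma moll_eq_0: "0 < \<epsilon> \<Longrightarrow> \<epsilon> \<le> norm x \<Longrightarrow> moll \<epsilon> x = 0"
  by (simp add: moll_def bump_eq_0)

lemma moll_measurable [measurable]: "moll \<epsilon> \<in> borel_measurable borel"
  unfolding moll_def by measurable

lemma moll_integrable: "0 < \<epsilon> \<Longrightarrow> integrable lborel (moll \<epsilon> :: 'a::euclidean_space \<Rightarrow> real)"
  unfolding moll_def by (intro integrable_divide bump_integrable) auto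

lemma moll_integral: "0 < \<epsilon> \<Longrightarrow> (LBINT x. moll \<epsilon> (x::'a::euclidean_space)) = 1"
  unfolding moll_def using bump_integral_pos[of \<epsilon>, where 'a='a] bump_integrable[of \<epsilon>, where 'a='a] by simp

lemma moll_bounded:
  obtains B where "\<And>x::'a::euclidean_space. moll \<epsilon> x \<le> B"
proof
  fix x :: 'a
  have "0 \<le> (LBINT y. bump \<epsilon> (y::'a))" using bump_bounds by (intro integral_nonneg_AE) auto
  then show "moll \<epsilon> x \<le> 1 / (LBINT y. bump \<epsilon> (y::'a))"
    unfolding moll_def by (intro divide_right_mono bump_bounds)
qed

lemma tame_moll:
  assumes "0 \<le> p" "0 < T" "0 < \<epsilon>"
  shows "tame p T (moll \<epsilon> :: 'a::euclidean_space \<Rightarrow> real)"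
proof -
  obtain B where B: "\<And>x::'a. moll \<epsilon> x \<le> B" using moll_bounded by blast
  show ?thesis
    by (rule tameI[where r = \<epsilon> and B = B and C = 0]) (use assms B in \<open>auto simp: moll_eq_0\<close>)
qed

lemma test_fun_moll:
  assumes "0 < \<epsilon>"
  shows "test_fun (\<lambda>y. moll \<epsilon> (x - y))"
  unfolding test_fun_def smooth_fun_def
proof (intro conjI allI)
  fix k
  let ?c = "LBINT y. bump \<epsilon> (y::'a)"
  have "Ck_fun k (\<lambda>y. inverse ?c * flat 0 (\<epsilon>\<^sup>2 - (y - x) \<bullet> (y - x)))"
    by (intro Ck_fun_mult Ck_fun_const Ck_fun_flat_ball)
  also have "(\<lambda>y. inverse ?c * flat 0 (\<epsilon>\<^sup>2 - (y - x) \<bullet> (y - x))) = (\<lambda>y. moll \<epsilon> (x - y))"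
    by (auto simp: moll_def bump_def divide_inverse inner_diff_left inner_diff_right inner_commute algebra_simps)
  finally show "Ck_fun k (\<lambda>y. moll \<epsilon> (x - y))" .
next
  have "{y. moll \<epsilon> (x - y) \<noteq> 0} \<subseteq> cball x \<epsilon>"
    using moll_eq_0[OF assms] by (force simp: dist_norm)
  then have "bounded {y. moll \<epsilon> (x - y) \<noteq> 0}" by (rule bounded_subset[OF bounded_cball])
  then show "compact (closure {y. moll \<epsilon> (x - y) \<noteq> 0})" by (simp add: compact_closure)
qed

text \<open>The sign is that of the integrand of \<open>frac_lap\<close>, the negative of the usual
  second difference.\<close>

definition sdiff :: "('a::real_vector \<Rightarrow> real) \<Rightarrow> 'a \<Rightarrow> 'a \<Rightarrow> real" where
  "sdiff \<phi> x z = 2 * \<phi> x - \<phi> (x + z) - \<phi> (x - z)"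

text \<open>The second derivative of \<open>flat 0\<close> is \<open>flat 4 - 2 * flat 3\<close>,
  bounded by 4! + 2 * 3! = 36. The mean value bound is applied to the derivative
  \<open>flat 2\<close> and then to \<open>flat 0\<close> minus a linear function.\<close>

lemma flat_taylor: "\<bar>flat 0 (t + h) - flat 0 t - flat 2 t * h\<bar> \<le> 36 * h\<^sup>2"
proof -
  have d2: "\<bar>flat 4 s - 2 * flat 3 s\<bar> \<le> 36" for s
    using flat_le_fact[of 4 s] flat_le_fact[of 3 s] flat_nonneg[of 4 s] flat_nonneg[of 3 s]
    by (simp add: fact_numeral)
  have D2: "(flat 2 has_real_derivative (flat 4 s - 2 * flat 3 s)) (at s)" for s
    using flat_deriv[of 2 s] by (simp add: eval_nat_numeral)
  have D0: "(flat 0 has_real_derivative flat 2 s) (at s)" for s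
    using flat_deriv[of 0 s] by (simp add: eval_nat_numeral)
  have lip: "\<bar>flat 2 s - flat 2 t\<bar> \<le> 36 * \<bar>s - t\<bar>" for s
    using field_differentiable_bound[of UNIV "flat 2" "\<lambda>s. flat 4 s - 2 * flat 3 s" 36 s t] D2 d2
    by simp
  let ?S = "closed_segment t (t + h)" and ?g = "\<lambda>s. flat 0 s - flat 2 t * s"
  have "(?g has_field_derivative (flat 2 s - flat 2 t * 1)) (at s)" for s
    by (intro DERIV_diff D0 DERIV_cmult DERIV_ident)
  then have g: "(?g has_field_derivative (flat 2 s - flat 2 t)) (at s within ?S)" for s
    using has_field_derivative_at_within by fastforce
  have b: "norm (flat 2 s - flat 2 t) \<le> 36 * \<bar>h\<bar>" if "s \<in> ?S" for s
  proof -
    have "\<bar>s - t\<bar> \<le> \<bar>h\<bar>" using that by (auto simp: closed_segment_eq_real_ivl split: if_splits)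
    then show ?thesis using lip[of s] by simp
  qed
  have "norm (?g (t + h) - ?g t) \<le> 36 * \<bar>h\<bar> * norm (t + h - t)"
    by (rule field_differentiable_bound[of ?S ?g "\<lambda>s. flat 2 s - flat 2 t"]) (use g b in auto)
  then show ?thesis by (simp add: algebra_simps power2_eq_square abs_mult_self_eq)
qed

text \<open>Both shifted values are \<open>flat 0\<close> at t plus an increment of size at most 5
  |z|, and the two increments add up to -2 |z|^2. The Taylor remainders contribute 2 * 36 * 25 |z|^2
  and the linear terms at most 4 |z|^2, which fits under 2000 |z|^2 for every \<epsilon>.\<close>

lemma sdiff_bump_le:
  assumes x: "norm x \<le> 2" and z: "norm z \<le> 1"
  shows "\<bar>sdiff (bump \<epsilon>) x z\<bar> \<le> 2000 * (norm z)\<^sup>2"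
proof -
  define t where "t = \<epsilon>\<^sup>2 - x \<bullet> x"
  define h where "h \<sigma> = - (z \<bullet> z) - \<sigma> * (2 * (x \<bullet> z))" for \<sigma> :: real
  have hh: "(h \<sigma>)\<^sup>2 \<le> 25 * (norm z)\<^sup>2" if "\<bar>\<sigma>\<bar> = 1" for \<sigma>
  proof -
    have "\<bar>h \<sigma>\<bar> \<le> \<bar>z \<bullet> z\<bar> + \<bar>\<sigma> * (2 * (x \<bullet> z))\<bar>" unfolding h_def by (rule order_trans[OF abs_triangle_ineq4]) simp
    also have "\<dots> = norm z * norm z + 2 * \<bar>x \<bullet> z\<bar>"
      using that by (simp add: abs_mult power2_norm_eq_inner[symmetric] power2_eq_square)
    also have "\<dots> \<le> 1 * norm z + 2 * (2 * norm z)"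
      using Cauchy_Schwarz_ineq2[of x z] x z mult_right_mono[OF x, of "norm z"] mult_right_mono[OF z, of "norm z"]
      by (intro add_mono mult_left_mono) auto
    finally have "\<bar>h \<sigma>\<bar> \<le> 5 * norm z" by simp
    then have "\<bar>h \<sigma>\<bar>\<^sup>2 \<le> (5 * norm z)\<^sup>2" by (rule power_mono) simp
    then show ?thesis by (simp add: power_mult_distrib)
  qed
  have "bump \<epsilon> (x + z) = flat 0 (t + h 1)" "bump \<epsilon> (x - z) = flat 0 (t + h (-1))" "bump \<epsilon> x = flat 0 t"
    by (simp_all add: bump_def t_def h_def inner_add_left inner_add_right inner_diff_left inner_diff_right inner_commute algebra_simps)
  moreover have "h 1 + h (-1) = - 2 * (norm z)\<^sup>2" by (simp add: h_def power2_norm_eq_inner)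
  then have "flat 2 t * h 1 + flat 2 t * h (-1) = flat 2 t * (- 2 * (norm z)\<^sup>2)"
    by (simp only: distrib_left[symmetric])
  moreover have "\<bar>flat 2 t * (norm z)\<^sup>2\<bar> \<le> 2 * (norm z)\<^sup>2"
    using flat_le_fact[of 2 t] flat_nonneg[of 2 t] by (simp add: abs_mult mult_right_mono)
  moreover have "\<bar>2 * F - A - B\<bar> \<le> 2000 * n"
    if "\<bar>A - F - u\<bar> \<le> 36 * P" "P \<le> 25 * n" "\<bar>B - F - v\<bar> \<le> 36 * Q" "Q \<le> 25 * n"
      "u + v = c * (- 2 * n)" "\<bar>c * n\<bar> \<le> 2 * n" for F A B u v P Q n c :: real
  proof -
    have "\<bar>A - F - u\<bar> \<le> 900 * n" "\<bar>B - F - v\<bar> \<le> 900 * n" using that(1-4) by linarith+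
    then have "\<bar>(A - F - u) + (B - F - v)\<bar> \<le> 1800 * n" by (intro order_trans[OF abs_triangle_ineq]) simp
    moreover have "\<bar>u + v\<bar> \<le> 4 * n" using that(5,6) by (simp add: abs_mult)
    moreover have "2 * F - A - B = - ((A - F - u) + (B - F - v)) - (u + v)" by simp
    then have "\<bar>2 * F - A - B\<bar> \<le> \<bar>(A - F - u) + (B - F - v)\<bar> + \<bar>u + v\<bar>"
      using abs_triangle_ineq4[of "- ((A - F - u) + (B - F - v))" "u + v"] unfolding abs_minus_cancel by simp
    moreover have "0 \<le> n" using that(6) abs_ge_zero[of "c * n"] by linarith
    ultimately show ?thesis by linarith
  qed
  ultimately show ?thesis
    unfolding sdiff_def using flat_taylor[of t "h 1"] flat_taylor[of t "h (-1)"] hh[of 1] hh[of "-1"]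
    by (simp only: abs_one abs_minus_cancel)
qed

section \<open>Mollification of the equation\<close>

lemma sdiff_measurable [measurable (raw)]:
  assumes [measurable]: "\<phi> \<in> borel_measurable borel" "f \<in> borel_measurable M" "g \<in> borel_measurable M"
  shows "(\<lambda>z. sdiff (\<phi> :: 'a::euclidean_space \<Rightarrow> real) (f z) (g z)) \<in> borel_measurable M"
  unfolding sdiff_def by measurable

lemma sdiff_moll_near:
  assumes "0 < \<epsilon>"
  obtains C where "0 \<le> C"
    "\<And>x z::'a::euclidean_space. norm x \<le> 2 \<Longrightarrow> norm z \<le> 1 \<Longrightarrow> \<bar>sdiff (moll \<epsilon>) x z\<bar> \<le> C * (norm z)\<^sup>2"
proof
  let ?c = "LBINT y. bump \<epsilon> (y::'a)"
  have c: "0 < ?c" using assms by (rule bump_integral_pos)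
  then show "0 \<le> 2000 / ?c" by simp
  fix x z :: 'a
  assume "norm x \<le> 2" "norm z \<le> 1"
  moreover have "sdiff (moll \<epsilon>) x z = sdiff (bump \<epsilon>) x z / ?c"
    by (simp add: sdiff_def moll_def diff_divide_distrib)
  ultimately show "\<bar>sdiff (moll \<epsilon>) x z\<bar> \<le> 2000 / ?c * (norm z)\<^sup>2"
    using divide_right_mono[OF sdiff_bump_le[of x z \<epsilon>], of ?c] c by simp
qed

text \<open>For |x| <= 2, the second difference bound controls small z and boundedness of the
  mollifier controls large z. For |x| >= 2 the mollifier vanishes at x, and it is nonzero at x + z
  or x - z only if |z| >= |x|/2; there the kernel is at most (|x|/2)^(-p), and each shifted
  mollifier has mass 1. Hence the decay |x|^(-p), even with absolute values inside the
  integral.\<close>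

lemma sdiff_moll_kernel:
  assumes \<epsilon>: "0 < \<epsilon>" "\<epsilon> \<le> 1" and p: "real DIM('a::euclidean_space) < p" "p < real DIM('a) + 2" and T: "0 < T"
  shows "integrable lborel (\<lambda>z. sdiff (moll \<epsilon>) (x::'a) z * norm z powr - p)"
    and "tame p T (\<lambda>x::'a. LBINT z. \<bar>sdiff (moll \<epsilon>) x z * norm z powr - p\<bar>)"
proof -
  let ?D = "\<lambda>x z::'a. sdiff (moll \<epsilon>) x z * norm z powr - p"
  let ?n = "\<lambda>z::'a. indicator {z. norm z \<le> 1} z * ((norm z)\<^sup>2 * norm z powr - p)"
  let ?f = "\<lambda>z::'a. indicator {z. 1 < norm z} z * norm z powr - p"
  have p0: "0 \<le> p" by (rule dim_less_nonneg[OF p(1)])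
  obtain C where C: "0 \<le> C" "\<And>x z::'a. norm x \<le> 2 \<Longrightarrow> norm z \<le> 1 \<Longrightarrow> \<bar>sdiff (moll \<epsilon>) x z\<bar> \<le> C * (norm z)\<^sup>2"
    using sdiff_moll_near[OF \<epsilon>(1)] by blast
  obtain B where B: "\<And>x::'a. moll \<epsilon> x \<le> B" using moll_bounded by blast
  have Dm: "(\<lambda>z. ?D x z) \<in> borel_measurable borel" for x by measurable
  have i_near: "integrable lborel (\<lambda>z. C * ?n z + 4 * B * ?f z)"
    using p p0 by (intro L1_add integrable_mult_right
        integrable_norm_powr_near integrable_norm_powr_tail) auto
  have b_near: "\<bar>?D x z\<bar> \<le> C * ?n z + 4 * B * ?f z" if "norm x \<le> 2" for x z
  proof (cases "norm z \<le> 1")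
    case True
    then show ?thesis
      using mult_right_mono[OF C(2)[OF that True], of "norm z powr - p"] by (simp add: abs_mult mult_ac)
  next
    case False
    have "\<bar>sdiff (moll \<epsilon>) x z\<bar> \<le> 4 * B"
      unfolding sdiff_def abs_le_iff
      using moll_nonneg[of \<epsilon> x] moll_nonneg[of \<epsilon> "x + z"] moll_nonneg[of \<epsilon> "x - z"] B[of x] B[of "x + z"] B[of "x - z"]
      by linarith
    then have "\<bar>sdiff (moll \<epsilon>) x z\<bar> * norm z powr - p \<le> 4 * B * norm z powr - p"
      by (rule mult_right_mono) simp
    then show ?thesis using False by (simp add: abs_mult)
  qed
  let ?g = "\<lambda>x z. (norm x / 2) powr - p * (moll \<epsilon> (x + z) + moll \<epsilon> (x - z))"
  have i_shift: "integrable lborel (\<lambda>z. moll \<epsilon> (x + z))" "integrable lborel (\<lambda>z. moll \<epsilon> (x - z))" for x :: 'a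
    using integrable_lborel_add[OF moll_integrable] integrable_lborel_diff[OF moll_integrable] \<epsilon> by auto
  then have i_far: "integrable lborel (?g x)" for x :: 'a
    by (intro integrable_mult_right L1_add) auto
  have b_far: "\<bar>?D x z\<bar> \<le> ?g x z" if x: "2 \<le> norm x" for x z
  proof -
    have m0: "moll \<epsilon> x = 0" using x \<epsilon> by (intro moll_eq_0) auto
    then have D: "\<bar>sdiff (moll \<epsilon>) x z\<bar> \<le> moll \<epsilon> (x + z) + moll \<epsilon> (x - z)"
      using moll_nonneg[of \<epsilon> "x + z"] moll_nonneg[of \<epsilon> "x - z"] unfolding sdiff_def m0 abs_le_iff
      by linarith
    show ?thesis
    proof (cases "norm x / 2 \<le> norm z")
      case True
      have "\<bar>sdiff (moll \<epsilon>) x z\<bar> * norm z powr - p \<le> (moll \<epsilon> (x + z) + moll \<epsilon> (x - z)) * (norm x / 2) powr - p"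
        using True x p0 D by (intro mult_mono powr_mono2') auto
      then show ?thesis by (simp add: abs_mult mult.commute)
    next
      case False
      have "norm x - norm z \<le> norm (x + z)" "norm x - norm z \<le> norm (x - z)"
        using norm_triangle_ineq4[of "x + z" z] norm_triangle_ineq[of "x - z" z] by simp_all
      then have "\<epsilon> \<le> norm (x + z)" "\<epsilon> \<le> norm (x - z)" using False x \<epsilon> by linarith+
      then have "sdiff (moll \<epsilon>) x z = 0" using m0 \<epsilon> by (simp add: sdiff_def moll_eq_0)
      then show ?thesis by simp
    qed
  qed
  have int: "integrable lborel (?D x)" for x
  proof (cases "norm x \<le> 2")
    case True
    show ?thesis
      by (rule L1_dominated[OF i_near])
         (use b_near[OF True] Dm in \<open>auto intro!: AE_I2 le_abs_trans\<close>)
  next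
    case False
    then have x: "2 \<le> norm x" by simp
    show ?thesis
      by (rule L1_dominated[OF i_far[of x]])
         (use b_far[OF x] Dm in \<open>auto intro!: AE_I2 le_abs_trans\<close>)
  qed
  show "integrable lborel (?D x)" by (rule int)
  show "tame p T (\<lambda>x::'a. LBINT z. \<bar>?D x z\<bar>)"
  proof (rule tameI[OF p0 T, where r = 2 and B = "LBINT z. C * ?n z + 4 * B * ?f z" and C = "2 powr p * 2"])
    show "(\<lambda>x. LBINT z. \<bar>?D x z\<bar>) \<in> borel_measurable borel" by measurable
  next
    fix x :: 'a
    assume x: "norm x \<le> 2"
    have "(LBINT z. \<bar>?D x z\<bar>) \<le> (LBINT z. C * ?n z + 4 * B * ?f z)"
      by (intro integral_mono integrable_abs int i_near b_near x)
    then show "\<bar>LBINT z. \<bar>?D x z\<bar>\<bar> \<le> (LBINT z. C * ?n z + 4 * B * ?f z)" by simp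
  next
    fix x :: 'a
    assume x: "2 \<le> norm x"
    have "(LBINT z. \<bar>?D x z\<bar>) \<le> (LBINT z. ?g x z)"
      by (intro integral_mono integrable_abs int i_far b_far x)
    also have "\<dots> = (norm x / 2) powr - p * ((LBINT z. moll \<epsilon> (x + z)) + (LBINT z. moll \<epsilon> (x - z)))"
      using i_shift by simp
    also have "\<dots> = (norm x / 2) powr - p * 2"
      using integral_lborel_add[OF moll_measurable, of \<epsilon> x] integral_lborel_diff[OF moll_measurable, of \<epsilon> x]
        moll_integral[OF \<epsilon>(1), where 'a='a] by simp
    also have "(norm x / 2) powr - p = 2 powr p * norm x powr - p"
      by (simp add: powr_divide powr_minus_divide)
    finally show "\<bar>LBINT z. \<bar>?D x z\<bar>\<bar> \<le> 2 powr p * 2 * norm x powr - p" by simp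
  qed auto
qed

context
  fixes \<epsilon> p T :: real and g :: "'a::euclidean_space \<Rightarrow> real"
  assumes \<epsilon>: "0 < \<epsilon>" "\<epsilon> \<le> 1" and p: "real DIM('a) < p" "p < real DIM('a) + 2" and T: "0 < T"
    and g [measurable]: "g \<in> borel_measurable borel" and wg: "wL1 p T g"
begin

text \<open>Up to a constant, a majorant of the fractional Laplacian of the mollifier. Its tameness
  makes the exchanges of integrals below absolutely convergent.\<close>

private definition "M x = (LBINT z. \<bar>sdiff (moll \<epsilon>) (x::'a) z * norm z powr - p\<bar>)"

private lemma M: "tame p T M"
  unfolding M_def[abs_def] by (rule sdiff_moll_kernel(2)[OF \<epsilon> p T])

private lemma m: "tame p T (moll \<epsilon> :: 'a \<Rightarrow> real)"
  using p DIM_positive[where 'a='a] by (intro tame_moll T \<epsilon>) linarith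

private lemma mM [measurable]: "M \<in> borel_measurable borel"
  using M by (rule tame_measurable)

private lemma abs_wg: "integrable lborel (\<lambda>x. wt p T x * \<bar>g x\<bar>)"
  using integrable_abs[OF wg] by (simp add: abs_mult)

private lemma conv_m [measurable]: "conv g (moll \<epsilon>) \<in> borel_measurable borel"
  by (rule measurable_conv[OF T p(1) m g wg])

lemma sdiff_conv_moll: "sdiff (conv g (moll \<epsilon>)) x z = (LBINT y. g y * sdiff (moll \<epsilon>) (x - y) z)"
proof -
  note i = integrable_conv_integrand[OF T p(1) m g wg]
  have "(LBINT y. g y * sdiff (moll \<epsilon>) (x - y) z)
      = (LBINT y. 2 * (g y * moll \<epsilon> (x - y)) - g y * moll \<epsilon> (x + z - y) - g y * moll \<epsilon> (x - z - y))"
    by (intro L1_integral_cong) (auto simp: sdiff_def algebra_simps)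
  also have "\<dots> = 2 * conv g (moll \<epsilon>) x - conv g (moll \<epsilon>) (x + z) - conv g (moll \<epsilon>) (x - z)"
    unfolding conv_def using i[of x] i[of "x + z"] i[of "x - z"] by simp
  finally show ?thesis by (simp add: sdiff_def)
qed

private lemma pair: "integrable (lborel \<Otimes>\<^sub>M lborel) (\<lambda>(y, z). g y * (sdiff (moll \<epsilon>) (x - y) z * norm z powr - p))"
proof (rule lborel_pair.Fubini_integrable)
  have eq: "(LBINT z. norm (case (y, z) of (y, z) \<Rightarrow> g y * (sdiff (moll \<epsilon>) (x - y) z * norm z powr - p)))
      = \<bar>g y\<bar> * M (x - y)" for y
    unfolding M_def by (subst integral_mult_right_zero[symmetric]) (simp add: abs_mult)
  show "integrable lborel (\<lambda>y. LBINT z. norm (case (y, z) of (y, z) \<Rightarrow> g y * (sdiff (moll \<epsilon>) (x - y) z * norm z powr - p)))"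
    unfolding eq by (rule integrable_conv_integrand[OF T p(1) M _ abs_wg]) measurable
  show "AE y in lborel. integrable lborel (\<lambda>z. case (y, z) of (y, z) \<Rightarrow> g y * (sdiff (moll \<epsilon>) (x - y) z * norm z powr - p))"
    by (auto intro!: AE_I2 integrable_mult_right sdiff_moll_kernel(1)[OF \<epsilon> p T])
qed measurable

private lemma inner_eq: "(LBINT y. g y * (sdiff (moll \<epsilon>) (x - y) z * norm z powr - p))
    = sdiff (conv g (moll \<epsilon>)) x z * norm z powr - p"
proof -
  have "(LBINT y. g y * (sdiff (moll \<epsilon>) (x - y) z * norm z powr - p))
      = (LBINT y. g y * sdiff (moll \<epsilon>) (x - y) z * norm z powr - p)" by (simp add: mult.assoc)
  then show ?thesis by (simp add: sdiff_conv_moll)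
qed

lemma integrable_sdiff_conv: "integrable lborel (\<lambda>z. sdiff (conv g (moll \<epsilon>)) x z * norm z powr - p)"
  using lborel_pair.integrable_snd[OF pair[of x]] unfolding inner_eq .

text \<open>Moves the singular integral from the convolution onto the mollifier, where it is the
  \<open>frac_lap\<close> of a test function, as in the weak formulation.\<close>

lemma integral_sdiff_conv: "(LBINT z. sdiff (conv g (moll \<epsilon>)) x z * norm z powr - p)
    = (LBINT y. g y * (LBINT z. sdiff (moll \<epsilon>) (x - y) z * norm z powr - p))"
  using lborel_pair.Fubini_integral[OF pair[of x]] unfolding inner_eq by simp

text \<open>The inner integral is at most the convolution of |g| with the tame majorant
  \<open>M\<close>. The result serves as dominating function when the truncation of the kernel is
  removed.\<close>

lemma integrable_wt_sdiff_conv: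
  "integrable lborel (\<lambda>x. wt p T x * (LBINT z. \<bar>sdiff (conv g (moll \<epsilon>)) x z * norm z powr - p\<bar>))"
proof (rule L1_dominated)
  show "integrable lborel (\<lambda>x. wt p T x * conv (\<lambda>y. \<bar>g y\<bar>) M x)"
    by (rule integrable_wt_conv[OF T p(1) M _ abs_wg]) measurable
  show "AE x in lborel. norm (wt p T x * (LBINT z. \<bar>sdiff (conv g (moll \<epsilon>)) x z * norm z powr - p\<bar>))
      \<le> norm (wt p T x * conv (\<lambda>y. \<bar>g y\<bar>) M x)"
  proof (rule AE_I2)
    fix x
    let ?F = "\<lambda>(y, z). g y * (sdiff (moll \<epsilon>) (x - y) z * norm z powr - p)"
    have abs_pair: "integrable (lborel \<Otimes>\<^sub>M lborel) (\<lambda>(y, z). \<bar>?F (y, z)\<bar>)"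
      using integrable_abs[OF pair[of x]] by (simp add: case_prod_unfold)
    have "(LBINT z. \<bar>sdiff (conv g (moll \<epsilon>)) x z * norm z powr - p\<bar>) \<le> (LBINT z. (LBINT y. \<bar>?F (y, z)\<bar>))"
    proof (rule integral_mono)
      show "integrable lborel (\<lambda>z. \<bar>sdiff (conv g (moll \<epsilon>)) x z * norm z powr - p\<bar>)"
        by (intro integrable_abs integrable_sdiff_conv)
      show "integrable lborel (\<lambda>z. LBINT y. \<bar>?F (y, z)\<bar>)"
        using lborel_pair.integrable_snd[OF abs_pair] .
      show "\<bar>sdiff (conv g (moll \<epsilon>)) x z * norm z powr - p\<bar> \<le> (LBINT y. \<bar>?F (y, z)\<bar>)" for z
        unfolding inner_eq[symmetric] by (simp only: prod.case) (rule integral_abs_bound)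
    qed
    also have "\<dots> = (LBINT y. (LBINT z. \<bar>?F (y, z)\<bar>))"
      using lborel_pair.Fubini_integral[OF abs_pair] .
    also have "\<dots> = conv (\<lambda>y. \<bar>g y\<bar>) M x"
    proof -
      have "(LBINT z. \<bar>?F (y, z)\<bar>) = \<bar>g y\<bar> * M (x - y)" for y
        unfolding M_def by (subst integral_mult_right_zero[symmetric]) (simp add: abs_mult)
      then show ?thesis by (simp add: conv_def)
    qed
    finally have "(LBINT z. \<bar>sdiff (conv g (moll \<epsilon>)) x z * norm z powr - p\<bar>) \<le> conv (\<lambda>y. \<bar>g y\<bar>) M x" .
    moreover have "0 \<le> (LBINT z. \<bar>sdiff (conv g (moll \<epsilon>)) x z * norm z powr - p\<bar>)" by simp
    ultimately show "norm (wt p T x * (LBINT z. \<bar>sdiff (conv g (moll \<epsilon>)) x z * norm z powr - p\<bar>))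
        \<le> norm (wt p T x * conv (\<lambda>y. \<bar>g y\<bar>) M x)"
      by (simp add: abs_mult mult_left_mono)
  qed
qed measurable

end

lemma frac_lap_moll: "frac_lap s (\<lambda>y. moll \<epsilon> (x - y)) y
   = frac_const DIM('a) s / 2 * (LBINT z. sdiff (moll \<epsilon>) (x - y) z * norm z powr - (real DIM('a) + 2 * s))"
  for x y :: "'a::euclidean_space"
proof -
  \<comment> \<open>Moving y by z moves x - y by -z, so the two shifted terms trade places, which
    leaves the second difference unchanged.\<close>
  have 1: "(2 * A - B - C) / K = (2 * A - C - B) * (1 / K)" for A B C K :: real
    by (simp add: diff_divide_distrib)
  have 2: "x - (y + z) = x - y - z" "x - (y - z) = x - y + z" for z by simp_all
  show ?thesis unfolding frac_lap_def sdiff_def powr_minus_divide 1 2 ..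
qed

lemma frac_const_pos: "0 < s \<Longrightarrow> s < 1 \<Longrightarrow> 0 < frac_const N s"
  unfolding frac_const_def by (intro divide_pos_pos mult_pos_pos Gamma_real_pos) (auto intro: add_nonneg_pos)

lemma borel_measurable_spow [measurable]: "spow m \<in> borel_measurable borel"
  unfolding spow_def by measurable

section \<open>Convergence of mollifications in weighted L1\<close>

context
  fixes p T :: real
  assumes T: "0 < T"
begin

text \<open>The mollifier lives on |x - y| <= 1, so Peetre's inequality with displacement at most 1
  replaces x by y in the weight. The constant is the same for all \<epsilon> <= 1, on which the
  closure under limits relies.\<close>

lemma moll_wt_integral_le:
  fixes y :: "'a::euclidean_space"
  assumes p0: "0 \<le> p" and \<epsilon>: "0 < \<epsilon>" "\<epsilon> \<le> 1"
  shows "(LBINT x. wt p T x * \<bar>moll \<epsilon> (x - y)\<bar>)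
    \<le> 2 powr (p / 2) * (1 + (1 / T)\<^sup>2) powr (p / 2) * wt p T y"
proof -
  let ?D = "2 powr (p / 2) * (1 + (1 / T)\<^sup>2) powr (p / 2)"
  have i: "integrable lborel (\<lambda>x. moll \<epsilon> (x - y))"
    using integrable_lborel_add[OF moll_integrable[OF \<epsilon>(1)], of "- y"] by simp
  have b: "wt p T x * \<bar>moll \<epsilon> (x - y)\<bar> \<le> ?D * wt p T y * moll \<epsilon> (x - y)" for x
  proof (cases "norm (x - y) \<le> 1")
    case True
    have "wt p T x \<le> 2 powr (p / 2) * (1 + (norm (y - x) / T)\<^sup>2) powr (p / 2) * wt p T y"
      using p0 by (rule wt_shift)
    also have "\<dots> \<le> ?D * wt p T y"
    proof (intro mult_right_mono mult_left_mono powr_mono2 add_left_mono power_mono)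
      show "norm (y - x) / T \<le> 1 / T" using True T by (simp add: norm_minus_commute divide_right_mono)
      show "0 \<le> norm (y - x) / T" using T by simp
    qed (use p0 in auto)
    finally show ?thesis using mult_right_mono[of "wt p T x" "?D * wt p T y" "moll \<epsilon> (x - y)"] by simp
  next
    case False
    then have "moll \<epsilon> (x - y) = 0" using \<epsilon> by (intro moll_eq_0) auto
    then show ?thesis by simp
  qed
  have "(LBINT x. wt p T x * \<bar>moll \<epsilon> (x - y)\<bar>) \<le> (LBINT x. ?D * wt p T y * moll \<epsilon> (x - y))"
  proof (rule integral_mono)
    show "integrable lborel (\<lambda>x. ?D * wt p T y * moll \<epsilon> (x - y))" by (intro integrable_mult_right i)
    then show "integrable lborel (\<lambda>x. wt p T x * \<bar>moll \<epsilon> (x - y)\<bar>)"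
      by (rule L1_dominated)
         (use b in \<open>auto intro!: AE_I2 le_abs_trans\<close>)
  qed (rule b)
  also have "\<dots> = ?D * wt p T y * (LBINT x. moll \<epsilon> (x - y))" by simp
  also have "(LBINT x. moll \<epsilon> (x - y)) = 1"
    using integral_lborel_add[OF moll_measurable, of \<epsilon> "- y"] moll_integral[OF \<epsilon>(1), where 'a='a] by simp
  finally show ?thesis by simp
qed

context
  assumes p: "real DIM('a::euclidean_space) < p"
begin

private definition "eps n = 1 / real (Suc n)"

private lemma eps: "0 < eps n" "eps n \<le> 1"
  by (auto simp: eps_def)

private lemma tm: "tame p T (moll (eps n) :: 'a \<Rightarrow> real)"
  by (intro tame_moll dim_less_nonneg[OF p] T eps)

text \<open>Convergence is packaged as a property of a single function so that it can be propagated
  from boxes to Borel sets and, by induction over integrable functions, to the whole weighted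
  space.\<close>

private definition "good (g :: 'a \<Rightarrow> real) \<longleftrightarrow> g \<in> borel_measurable borel \<and> wL1 p T g
  \<and> (\<lambda>n. LBINT x. wt p T x * \<bar>conv g (moll (eps n)) x - g x\<bar>) \<longlonglongrightarrow> 0"

private lemma err_integrable:
  fixes g :: "'a \<Rightarrow> real"
  assumes "g \<in> borel_measurable borel" "wL1 p T g"
  shows "integrable lborel (\<lambda>x. wt p T x * \<bar>conv g (moll (eps n)) x - g x\<bar>)"
proof -
  have "integrable lborel (\<lambda>x. wt p T x * conv g (moll (eps n)) x - wt p T x * g x)"
    by (intro L1_diff assms(2) integrable_wt_conv[OF T p tm assms])
  then have "integrable lborel (\<lambda>x. \<bar>wt p T x * conv g (moll (eps n)) x - wt p T x * g x\<bar>)"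
    by (rule integrable_abs)
  then show ?thesis by (simp add: right_diff_distrib[symmetric] abs_mult)
qed

private lemma good_add:
  assumes "good f" "good g"
  shows "good (\<lambda>x. f x + g x)"
proof -
  have f: "f \<in> borel_measurable borel" "wL1 p T f"
    and g: "g \<in> borel_measurable borel" "wL1 p T g"
    using assms by (auto simp: good_def)
  have ifg: "integrable lborel (\<lambda>x. wt p T x * (f x + g x))"
    using L1_add[OF f(2) g(2)] by (simp add: distrib_left)
  have mfg: "(\<lambda>x. f x + g x) \<in> borel_measurable borel" using f g by simp
  have c: "conv (\<lambda>x. f x + g x) (moll (eps n)) x = conv f (moll (eps n)) x + conv g (moll (eps n)) x" for n x
    using integrable_conv_integrand[OF T p tm f] integrable_conv_integrand[OF T p tm g]
    by (simp add: conv_def distrib_right)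
  have "(\<lambda>n. LBINT x. wt p T x * \<bar>conv (\<lambda>x. f x + g x) (moll (eps n)) x - (f x + g x)\<bar>) \<longlonglongrightarrow> 0"
  proof (rule Lim_null_comparison)
    let ?A = "\<lambda>f n. LBINT x. wt p T x * \<bar>conv f (moll (eps n)) x - f x\<bar>"
    show "(\<lambda>n. ?A f n + ?A g n) \<longlonglongrightarrow> 0"
      using tendsto_add[of "?A f" 0 _ "?A g" 0] assms by (simp add: good_def)
    have "?A (\<lambda>x. f x + g x) n \<le> ?A f n + ?A g n" for n
    proof -
      have "?A (\<lambda>x. f x + g x) n \<le> (LBINT x. wt p T x * \<bar>conv f (moll (eps n)) x - f x\<bar> + wt p T x * \<bar>conv g (moll (eps n)) x - g x\<bar>)"
      proof (rule integral_mono)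
        show "integrable lborel (\<lambda>x. wt p T x * \<bar>conv (\<lambda>x. f x + g x) (moll (eps n)) x - (f x + g x)\<bar>)"
          by (rule err_integrable[OF mfg ifg])
        show "integrable lborel (\<lambda>x. wt p T x * \<bar>conv f (moll (eps n)) x - f x\<bar> + wt p T x * \<bar>conv g (moll (eps n)) x - g x\<bar>)"
          by (intro L1_add err_integrable f g)
        show "wt p T x * \<bar>conv (\<lambda>x. f x + g x) (moll (eps n)) x - (f x + g x)\<bar>
            \<le> wt p T x * \<bar>conv f (moll (eps n)) x - f x\<bar> + wt p T x * \<bar>conv g (moll (eps n)) x - g x\<bar>" for x
          unfolding c distrib_left[symmetric] by (intro mult_left_mono) auto
      qed
      also have "\<dots> = ?A f n + ?A g n" by (intro L1_integral_add err_integrable f g)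
      finally show ?thesis .
    qed
    then show "\<forall>\<^sub>F n in sequentially. norm (?A (\<lambda>x. f x + g x) n) \<le> ?A f n + ?A g n" by simp
  qed
  then show ?thesis using mfg ifg by (simp add: good_def)
qed

private lemma good_cmult:
  assumes "good g"
  shows "good (\<lambda>x. c * g x)"
proof -
  have g: "g \<in> borel_measurable borel" "wL1 p T g"
    and l: "(\<lambda>n. LBINT x. wt p T x * \<bar>conv g (moll (eps n)) x - g x\<bar>) \<longlonglongrightarrow> 0"
    using assms by (auto simp: good_def)
  have c: "conv (\<lambda>x. c * g x) (moll (eps n)) x = c * conv g (moll (eps n)) x" for n x
    by (simp add: conv_def mult.assoc)
  have "(LBINT x. wt p T x * \<bar>conv (\<lambda>x. c * g x) (moll (eps n)) x - c * g x\<bar>)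
      = \<bar>c\<bar> * (LBINT x. wt p T x * \<bar>conv g (moll (eps n)) x - g x\<bar>)" for n
    unfolding c right_diff_distrib[symmetric] abs_mult
    by (subst integral_mult_right_zero[symmetric]) (simp add: mult_ac)
  moreover have "integrable lborel (\<lambda>x. wt p T x * (c * g x))"
    using integrable_mult_right[OF g(2), of c] by (simp add: mult_ac)
  ultimately show ?thesis using g tendsto_mult_right[OF l, of "\<bar>c\<bar>"] by (simp add: good_def mult.commute)
qed

text \<open>Three-term estimate: mollification is bounded in the weighted norm by \<open>D\<close>,
  uniformly in n, so the approximant \<open>s i\<close> can be fixed before n is sent to
  infinity.\<close>

private lemma good_lim:
  assumes s: "\<And>i. good (s i)" and g [measurable]: "g \<in> borel_measurable borel"
    and wg: "wL1 p T g"
    and lim: "(\<lambda>i. LBINT x. wt p T x * \<bar>s i x - g x\<bar>) \<longlonglongrightarrow> 0"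
  shows "good g"
proof -
  define D where "D = 2 powr (p / 2) * (1 + (1 / T)\<^sup>2) powr (p / 2)"
  have D0: "0 \<le> D" by (simp add: D_def)
  have sm [measurable]: "s i \<in> borel_measurable borel" and ws: "wL1 p T (s i)" for i
    using s by (auto simp: good_def)
  let ?A = "\<lambda>f n. LBINT x. wt p T x * \<bar>conv f (moll (eps n)) x - f x\<bar>"
  let ?d = "\<lambda>i. LBINT x. wt p T x * \<bar>s i x - g x\<bar>"
  have wd: "integrable lborel (\<lambda>x. wt p T x * (s i x - g x))" for i
    using L1_diff[OF ws[of i] wg] by (simp add: right_diff_distrib)
  have wd': "integrable lborel (\<lambda>x. wt p T x * \<bar>s i x - g x\<bar>)" for i
    using integrable_abs[OF wd[of i]] by (simp add: abs_mult)
  have key: "?A g n \<le> (D + 1) * ?d i + ?A (s i) n" for n i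
  proof -
    have cd: "conv (\<lambda>x. s i x - g x) (moll (eps n)) x = conv (s i) (moll (eps n)) x - conv g (moll (eps n)) x" for x
      by (intro conv_diff integrable_conv_integrand[OF T p tm] sm ws g wg)
    have m: "(\<lambda>x. s i x - g x) \<in> borel_measurable borel" by measurable
    have ic: "integrable lborel (\<lambda>x. wt p T x * \<bar>conv (\<lambda>x. s i x - g x) (moll (eps n)) x\<bar>)"
      using integrable_abs[OF integrable_wt_conv[OF T p tm m wd]] by (simp add: abs_mult)
    have "?A g n \<le> (LBINT x. wt p T x * \<bar>conv (\<lambda>x. s i x - g x) (moll (eps n)) x\<bar> + wt p T x * \<bar>s i x - g x\<bar>
        + wt p T x * \<bar>conv (s i) (moll (eps n)) x - s i x\<bar>)"
    proof (rule integral_mono)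
      show "integrable lborel (\<lambda>x. wt p T x * \<bar>conv g (moll (eps n)) x - g x\<bar>)" by (rule err_integrable[OF g wg])
      show "integrable lborel (\<lambda>x. wt p T x * \<bar>conv (\<lambda>x. s i x - g x) (moll (eps n)) x\<bar> + wt p T x * \<bar>s i x - g x\<bar>
        + wt p T x * \<bar>conv (s i) (moll (eps n)) x - s i x\<bar>)"
        by (intro L1_add ic wd' err_integrable sm ws)
      show "wt p T x * \<bar>conv g (moll (eps n)) x - g x\<bar> \<le> wt p T x * \<bar>conv (\<lambda>x. s i x - g x) (moll (eps n)) x\<bar>
        + wt p T x * \<bar>s i x - g x\<bar> + wt p T x * \<bar>conv (s i) (moll (eps n)) x - s i x\<bar>" for x
        unfolding cd distrib_left[symmetric] by (intro mult_left_mono) auto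
    qed
    also have "\<dots> = (LBINT x. wt p T x * \<bar>conv (\<lambda>x. s i x - g x) (moll (eps n)) x\<bar>) + ?d i + ?A (s i) n"
      using ic wd'[of i] err_integrable[OF sm ws] by simp
    also have "(LBINT x. wt p T x * \<bar>conv (\<lambda>x. s i x - g x) (moll (eps n)) x\<bar>) \<le> D * ?d i"
      unfolding D_def by (rule wt_conv_norm_le[OF T p tm m wd moll_wt_integral_le[OF dim_less_nonneg[OF p] eps]])
    finally show ?thesis by (simp add: distrib_right)
  qed
  have "?A g \<longlonglongrightarrow> 0"
  proof (rule LIMSEQ_I)
    fix e :: real
    assume e: "0 < e"
    have "(\<lambda>i. (D + 1) * ?d i) \<longlonglongrightarrow> 0" using tendsto_mult_right_zero[OF lim] by simp
    then obtain i where i: "(D + 1) * ?d i < e / 2"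
      using order_tendstoD(2)[of "\<lambda>i. (D + 1) * ?d i" 0 sequentially "e / 2"] e
      by (auto simp: eventually_sequentially)
    have "?A (s i) \<longlonglongrightarrow> 0" using s by (simp add: good_def)
    then obtain N where N: "\<And>n. n \<ge> N \<Longrightarrow> ?A (s i) n < e / 2"
      using order_tendstoD(2)[of "?A (s i)" 0 sequentially "e / 2"] e by (auto simp: eventually_sequentially)
    show "\<exists>N. \<forall>n\<ge>N. norm (?A g n - 0) < e"
    proof (intro exI allI impI)
      fix n
      assume "N \<le> n"
      then have "?A g n < e" using key[of n i] N[of n] i by linarith
      moreover have "0 \<le> ?A g n" by simp
      ultimately show "norm (?A g n - 0) < e" by simp
    qed
  qed
  then show ?thesis using g wg by (simp add: good_def)
qed

private lemma wt_bounded_integrable: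
  assumes [measurable]: "g \<in> borel_measurable borel" and b: "\<And>x::'a. \<bar>g x\<bar> \<le> 1"
  shows "wL1 p T g"
  by (rule L1_dominated[OF integrable_wt[OF p T]])
     (use b in \<open>auto simp: abs_mult intro!: mult_left_le\<close>)

private lemma moll_shift: "integrable lborel (\<lambda>y. moll (eps n) (x - y))" "(LBINT y. moll (eps n) (x - y)) = 1" for x :: 'a
  using integrable_lborel_diff[OF moll_integrable[OF eps(1)], of n x] integral_lborel_diff[OF moll_measurable, of "eps n" x]
    moll_integral[OF eps(1)[of n], where 'a='a] by simp_all

private lemma conv_indicator_bounds:
  assumes [measurable]: "A \<in> sets borel"
  shows "0 \<le> conv (indicator A) (moll (eps n)) (x::'a)" "conv (indicator A) (moll (eps n)) x \<le> 1"
proof -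
  show "0 \<le> conv (indicator A) (moll (eps n)) (x::'a)" unfolding conv_def by (intro integral_nonneg_AE) auto
  have "conv (indicator A) (moll (eps n)) x \<le> (LBINT y. moll (eps n) (x - y))"
    unfolding conv_def
  proof (rule integral_mono)
    show "integrable lborel (\<lambda>y. indicat_real A y * moll (eps n) (x - y))"
      by (rule L1_dominated[OF moll_shift(1)[of n x]]) (auto split: split_indicator)
  qed (auto simp: moll_shift split: split_indicator)
  then show "conv (indicator A) (moll (eps n)) x \<le> 1" by (simp add: moll_shift)
qed

private lemma conv_indicator_local:
  assumes "\<And>y. norm (x - y) < eps n \<Longrightarrow> indicat_real A y = c"
  shows "conv (indicator A) (moll (eps n)) (x::'a) = c"
proof -
  have "indicat_real A y * moll (eps n) (x - y) = c * moll (eps n) (x - y)" for y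
    using assms[of y] moll_eq_0[OF eps(1), of n "x - y"] by (cases "norm (x - y) < eps n") auto
  then have "conv (indicator A) (moll (eps n)) x = (LBINT y. c * moll (eps n) (x - y))"
    unfolding conv_def by (intro L1_integral_cong) auto
  then show ?thesis by (simp add: moll_shift)
qed

text \<open>Off the boundary, which is null, the indicator is locally constant and its mollification
  is eventually exact. The integrable weight dominates.\<close>

private lemma good_box: "good (indicator (box a b))"
proof -
  have [measurable]: "box a b \<in> sets borel" by simp
  have "negligible (cbox a b - box a b)" by (rule negligible_frontier_interval)
  then have "cbox a b - box a b \<in> null_sets lebesgue" by (simp add: negligible_iff_null_sets)
  then have null: "AE x in lborel. x \<notin> cbox a b - box a b"
    by (intro AE_not_in) (simp add: null_sets_def)
  have ev: "eventually (\<lambda>n. eps n < e) sequentially" if "0 < e" for e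
  proof -
    have "eps \<longlonglongrightarrow> 0" unfolding eps_def[abs_def] using LIMSEQ_inverse_real_of_nat by (simp add: divide_inverse)
    then show ?thesis using order_tendstoD(2) that by blast
  qed
  have loc: "(\<lambda>n. conv (indicator (box a b)) (moll (eps n)) x) \<longlonglongrightarrow> indicator (box a b) x"
    if "open S" "x \<in> S" "\<And>y. y \<in> S \<Longrightarrow> indicat_real (box a b) y = indicator (box a b) x" for x S
  proof -
    obtain e where e: "0 < e" "ball x e \<subseteq> S" using \<open>open S\<close> \<open>x \<in> S\<close> by (auto simp: open_contains_ball)
    have "eventually (\<lambda>n. conv (indicator (box a b)) (moll (eps n)) x = indicator (box a b) x) sequentially"
      using ev[OF e(1)]
    proof eventually_elim
      case (elim n)
      show ?case by (rule conv_indicator_local, rule that(3)) (use e elim in \<open>auto simp: dist_norm subset_iff\<close>)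
    qed
    then show ?thesis by (rule tendsto_eventually)
  qed
  have lim: "AE x in lborel. (\<lambda>n. conv (indicator (box a b)) (moll (eps n)) x) \<longlonglongrightarrow> indicator (box a b) x"
    using null
  proof eventually_elim
    case (elim x)
    show ?case
    proof (cases "x \<in> box a b")
      case True
      then show ?thesis by (intro loc[of "box a b"]) auto
    next
      case False
      then have "x \<in> - cbox a b" using elim by auto
      then show ?thesis using False box_subset_cbox[of a b]
        by (intro loc[of "- cbox a b"]) (auto simp: closed_cbox open_Compl indicator_def subset_iff)
    qed
  qed
  have wi: "integrable lborel (\<lambda>x. wt p T x * indicat_real (box a b) x)"
    by (intro wt_bounded_integrable) auto
  note mc [measurable] = measurable_conv[OF T p tm _ wi]
  have "(\<lambda>n. LBINT x. wt p T x * \<bar>conv (indicator (box a b)) (moll (eps n)) x - indicator (box a b) x\<bar>)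
      \<longlonglongrightarrow> (\<integral>x. 0 \<partial>(lborel :: 'a measure))"
  proof (rule integral_dominated_convergence[where w = "wt p T"])
    show "AE x in lborel. (\<lambda>n. wt p T x * \<bar>conv (indicator (box a b)) (moll (eps n)) x - indicator (box a b) x\<bar>) \<longlonglongrightarrow> 0"
      using lim by eventually_elim (auto intro!: tendsto_eq_intros)
    show "AE x in lborel. norm (wt p T x * \<bar>conv (indicator (box a b)) (moll (eps n)) x - indicator (box a b) x\<bar>) \<le> wt p T x" for n
    proof (rule AE_I2)
      fix x
      have "\<bar>conv (indicator (box a b)) (moll (eps n)) x - indicat_real (box a b) x\<bar> \<le> 1"
        using conv_indicator_bounds[of "box a b" n x] by (auto split: split_indicator)
      then show "norm (wt p T x * \<bar>conv (indicator (box a b)) (moll (eps n)) x - indicator (box a b) x\<bar>) \<le> wt p T x"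
        using mult_left_mono[of _ 1 "wt p T x"] by (simp add: abs_mult)
    qed
  qed (use integrable_wt[OF p T] in simp_all)
  then show ?thesis using wi by (simp add: good_def)
qed

text \<open>Dynkin's argument: boxes are stable under intersection and generate the Borel sets.
  Complements are handled because mollification preserves constants and the weight has finite
  mass.\<close>

private lemma good_indicator:
  assumes "A \<in> sets borel"
  shows "good (indicator A)"
proof -
  have "Int_stable (range (\<lambda>(a, b). box a b :: 'a set))" by (auto simp: Int_stable_def box_Int_box)
  moreover have "range (\<lambda>(a, b). box a b :: 'a set) \<subseteq> Pow UNIV" by simp
  moreover have "A \<in> sigma_sets UNIV (range (\<lambda>(a, b). box a b :: 'a set))"
    using assms by (simp add: borel_eq_box)
  ultimately have "A \<in> sets borel \<and> good (indicator A)"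
  proof (induction rule: sigma_sets_induct_disjoint)
    case (basic A)
    then show ?case using good_box by auto
  next
    case empty
    show ?case using good_cmult[OF good_box[of 0 0], of 0] by (simp add: indicator_def[abs_def])
  next
    case (compl A)
    then have [measurable]: "A \<in> sets borel" and A: "good (indicator A)" by auto
    have wi: "integrable lborel (\<lambda>x. wt p T x * indicat_real A x)" using A by (simp add: good_def)
    have ic: "integrable lborel (\<lambda>y. indicat_real A y * moll (eps n) (x - y))" for n x
      by (rule integrable_conv_integrand[OF T p tm _ wi]) simp
    have "conv (indicator (UNIV - A)) (moll (eps n)) x = 1 - conv (indicator A) (moll (eps n)) x" for n and x :: 'a
    proof -
      have "indicat_real (UNIV - A) y * moll (eps n) (x - y) = moll (eps n) (x - y) - indicat_real A y * moll (eps n) (x - y)" for y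
        by (auto split: split_indicator)
      then show ?thesis unfolding conv_def using moll_shift[of n x] ic[of n x] by simp
    qed
    moreover have "indicat_real (UNIV - A) x = 1 - indicator A x" for x by (auto split: split_indicator)
    ultimately have "\<bar>conv (indicator (UNIV - A)) (moll (eps n)) x - indicat_real (UNIV - A) x\<bar>
        = \<bar>conv (indicator A) (moll (eps n)) x - indicat_real A x\<bar>" for n and x :: 'a by simp
    moreover have "integrable lborel (\<lambda>x. wt p T x * indicat_real (UNIV - A) x)"
      by (intro wt_bounded_integrable) (auto split: split_indicator)
    ultimately show ?case using A by (simp add: good_def)
  next
    case (union A)
    have [measurable]: "A i \<in> sets borel" for i using union by auto
    \<comment> \<open>By disjointness the finite partial unions have sums of good indicators as
      indicators; the full union is their weighted L1 limit.\<close>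
    have g: "good (indicator (\<Union>i<n. A i))" for n
    proof (induction n)
      case 0
      show ?case using good_cmult[OF good_box[of 0 0], of 0] by (simp add: indicator_def[abs_def])
    next
      case (Suc n)
      have "A i \<inter> A n = {}" if "i < n" for i
        using union(1) that by (auto simp: disjoint_family_on_def)
      then have "indicat_real (\<Union>i<Suc n. A i) = (\<lambda>x. indicator (\<Union>i<n. A i) x + indicator (A n) x)"
        by (auto simp: lessThan_Suc fun_eq_iff split: split_indicator)
      moreover have "good (\<lambda>x. indicat_real (\<Union>i<n. A i) x + indicator (A n) x)"
        using good_add Suc.IH union by auto
      ultimately show ?case by simp
    qed
    have "good (indicator (\<Union>i. A i))"
    proof (rule good_lim[OF g])
      show "integrable lborel (\<lambda>x. wt p T x * indicat_real (\<Union>i. A i) x)"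
        by (intro wt_bounded_integrable) auto
      have "(\<lambda>n. LBINT x. wt p T x * \<bar>indicat_real (\<Union>i<n. A i) x - indicator (\<Union>i. A i) x\<bar>)
          \<longlonglongrightarrow> (\<integral>x. 0 \<partial>(lborel :: 'a measure))"
      proof (rule integral_dominated_convergence[where w = "wt p T"])
        show "AE x in lborel. (\<lambda>n. wt p T x * \<bar>indicat_real (\<Union>i<n. A i) x - indicator (\<Union>i. A i) x\<bar>) \<longlonglongrightarrow> 0"
        proof (rule AE_I2)
          fix x
          have "(\<lambda>n. indicat_real (\<Union>i<n. A i) x) \<longlonglongrightarrow> indicator (\<Union>i. A i) x"
            by (rule LIMSEQ_indicator_UN)
          then show "(\<lambda>n. wt p T x * \<bar>indicat_real (\<Union>i<n. A i) x - indicator (\<Union>i. A i) x\<bar>) \<longlonglongrightarrow> 0"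
            by (auto intro!: tendsto_eq_intros)
        qed
      qed (use integrable_wt[OF p T] in \<open>auto split: split_indicator\<close>)
      then show "(\<lambda>n. LBINT x. wt p T x * \<bar>indicat_real (\<Union>i<n. A i) x - indicator (\<Union>i. A i) x\<bar>) \<longlonglongrightarrow> 0"
        by simp
    qed simp
    then show ?case by simp
  qed
  then show ?thesis by blast
qed

lemma conv_moll_tendsto:
  fixes g :: "'a \<Rightarrow> real"
  assumes gm: "g \<in> borel_measurable borel" and wg: "wL1 p T g"
  shows "(\<lambda>n. LBINT x. wt p T x * \<bar>conv g (moll (1 / real (Suc n))) x - g x\<bar>) \<longlonglongrightarrow> 0"
proof -
  \<comment> \<open>Weighted integrability is integrability for this measure, which opens the way to
    \<open>integrable_induct\<close>.\<close>
  let ?M = "density lborel (\<lambda>x. ennreal (wt p T (x::'a)))"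
  have iff: "integrable ?M f \<longleftrightarrow> wL1 p T f" if "f \<in> borel_measurable borel" for f :: "'a \<Rightarrow> real"
    using that by (subst integrable_density) auto
  have fm: "f \<in> borel_measurable borel" if "integrable ?M f" for f :: "'a \<Rightarrow> real"
    using borel_measurable_integrable[OF that] by simp
  have "integrable ?M g" using gm wg by (simp add: iff)
  then have "good g"
  proof (induct rule: integrable_induct)
    case (base A c)
    then show ?case using good_cmult[OF good_indicator, of A c] by (simp add: mult.commute)
  next
    case (add f g)
    then show ?case by (intro good_add)
  next
    case (lim f s)
    have [measurable]: "f \<in> borel_measurable borel" "s i \<in> borel_measurable borel" for i
      using lim fm by auto
    have wf: "wL1 p T f" using lim(5) iff[OF fm[OF lim(5)]] by simp
    \<comment> \<open>The approximants satisfy |s i| <= 2 |f|, hence the factor 3.\<close>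
    have wf': "integrable lborel (\<lambda>x. 3 * \<bar>wt p T x * f x\<bar>)"
      by (intro integrable_mult_right integrable_abs wf)
    show ?case
    proof (rule good_lim[OF lim(2)])
      have "(\<lambda>i. LBINT x. wt p T x * \<bar>s i x - f x\<bar>) \<longlonglongrightarrow> (\<integral>x. 0 \<partial>(lborel :: 'a measure))"
      proof (rule integral_dominated_convergence[OF _ _ wf'])
        show "AE x in lborel. (\<lambda>i. wt p T x * \<bar>s i x - f x\<bar>) \<longlonglongrightarrow> 0"
        proof (rule AE_I2)
          fix x :: 'a
          have "(\<lambda>i. s i x) \<longlonglongrightarrow> f x" using lim(3)[of x] by simp
          then show "(\<lambda>i. wt p T x * \<bar>s i x - f x\<bar>) \<longlonglongrightarrow> 0" by (auto intro!: tendsto_eq_intros)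
        qed
        show "AE x in lborel. norm (wt p T x * \<bar>s i x - f x\<bar>) \<le> 3 * \<bar>wt p T x * f x\<bar>" for i
        proof (rule AE_I2)
          fix x :: 'a
          have "\<bar>s i x - f x\<bar> \<le> 3 * \<bar>f x\<bar>" using lim(4)[of x i] by simp
          then show "norm (wt p T x * \<bar>s i x - f x\<bar>) \<le> 3 * \<bar>wt p T x * f x\<bar>"
            using mult_left_mono[of "\<bar>s i x - f x\<bar>" "3 * \<bar>f x\<bar>" "wt p T x"] by (simp add: abs_mult)
        qed
      qed measurable
      then show "(\<lambda>i. LBINT x. wt p T x * \<bar>s i x - f x\<bar>) \<longlonglongrightarrow> 0" by simp
    qed (use wf in simp_all)
  qed
  then show ?thesis by (simp add: good_def eps_def)
qed

end
end

section \<open>Removal of the truncation and of the mollification\<close>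

text \<open>The truncated kernel is integrable and even, so the substitutions y = x + z and y = x -
  z can be made separately and averaged. This links the Kato inequality, stated with convolutions,
  to the second differences in \<open>frac_lap\<close>.\<close>

lemma conv_trunc_sdiff:
  fixes Z :: "'a::euclidean_space \<Rightarrow> real"
  assumes p: "real DIM('a) < p" and T: "0 < T" and \<delta>: "0 < \<delta>"
    and Z [measurable]: "Z \<in> borel_measurable borel" and wZ: "wL1 p T Z"
  shows "(LBINT z. trunc p \<delta> (z::'a)) * Z x - conv Z (trunc p \<delta>) x
    = (LBINT z. sdiff Z x z * trunc p \<delta> z) / 2"
proof -
  let ?K = "trunc p \<delta> :: 'a \<Rightarrow> real"
  have p0: "0 \<le> p" by (rule dim_less_nonneg[OF p(1)])
  have K: "tame p T ?K" using p0 T \<delta> by (rule tame_trunc)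
  have iK: "integrable lborel ?K" using p T K by (rule tame_integrable)
  have iZ: "integrable lborel (\<lambda>y. Z y * ?K (x - y))" by (rule integrable_conv_integrand[OF T p K Z wZ])
  have eqK: "?K (x - (x + z)) = ?K z" "?K (x - (x - z)) = ?K z" for z by simp_all
  have i1: "integrable lborel (\<lambda>z. Z (x + z) * ?K z)" using integrable_lborel_add[OF iZ, of x] unfolding eqK .
  have i2: "integrable lborel (\<lambda>z. Z (x - z) * ?K z)" using integrable_lborel_diff[OF iZ, of x] unfolding eqK .
  have m: "(\<lambda>y. Z y * ?K (x - y)) \<in> borel_measurable borel" by measurable
  have c1: "conv Z ?K x = (LBINT z. Z (x + z) * ?K z)"
    using integral_lborel_add[OF m, of x] unfolding eqK conv_def by simp
  have c2: "conv Z ?K x = (LBINT z. Z (x - z) * ?K z)"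
    using integral_lborel_diff[OF m, of x] unfolding eqK conv_def by simp
  have "(LBINT z. sdiff Z x z * ?K z) = (LBINT z. 2 * Z x * ?K z - Z (x + z) * ?K z - Z (x - z) * ?K z)"
    by (simp add: sdiff_def left_diff_distrib)
  also have "\<dots> = 2 * Z x * (LBINT z. ?K z) - conv Z ?K x - conv Z ?K x"
    using iK i1 i2 by (simp add: c1[symmetric] c2[symmetric])
  finally show ?thesis by (simp add: mult.commute)
qed

text \<open>The truncation is removed with r and \<eta> fixed; the left-hand side of
  \<open>core_trunc\<close> does not involve \<delta>. The capped kernel tends to |z|^(-p) away from
  the origin, and at the origin the second difference vanishes. The dominating functions are
  provided by \<open>sd\<close> for the inner integral and by \<open>wsd\<close> for the outer
  one.\<close>

lemma core_smooth:
  fixes a :: "'a::euclidean_space" and Z :: "'a \<Rightarrow> real"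
  assumes p: "real DIM('a) < p" and T: "0 < T" and a: "a \<noteq> 0" and \<theta>: "0 \<le> \<theta>"
    and Z [measurable]: "Z \<in> borel_measurable borel" and wZ: "wL1 p T Z"
    and anti: "\<And>x. Z (hyp_refl a b x) = - Z x"
    and sd: "\<And>x. integrable lborel (\<lambda>z. sdiff Z x z * norm z powr - p)"
    and wsd: "integrable lborel (\<lambda>x. wt p T x * (LBINT z. \<bar>sdiff Z x z * norm z powr - p\<bar>))"
    and r: "0 < r"
    and \<eta>: "\<And>\<delta> y::'a. \<lbrakk>0 < \<delta>; \<delta> \<le> r\<rbrakk> \<Longrightarrow>
      (LBINT x. wt p T x * near p \<delta> r (x - y)) \<le> ((LBINT z. near p \<delta> r (z::'a)) + \<eta>) * wt p T y"
  defines E_superlevel: "E \<equiv> superlevel a b \<theta> Z" and Y_excess: "Y \<equiv> excess a b \<theta> Z"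
  shows "((LBINT z. far p r (z::'a)) - \<eta>) * (LBINT x. wt p T x * Y x)
      - (LBINT x. wt p T x * (indicator E x * conv Y (far p r) x))
    \<le> (LBINT x. wt p T x * (indicator E x * ((LBINT z. sdiff Z x z * norm z powr - p) / 2)))"
    (is "?L \<le> _")
proof -
  have p0: "0 \<le> p" by (rule dim_less_nonneg[OF p(1)])
  have [measurable]: "E \<in> sets borel" unfolding E_superlevel superlevel_def by measurable
  define \<delta> where "\<delta> n = r / real (Suc n)" for n
  have \<delta>: "0 < \<delta> n" "\<delta> n \<le> r" for n using r by (auto simp: \<delta>_def divide_le_eq)
  have \<delta>0: "\<delta> \<longlonglongrightarrow> 0"
    unfolding \<delta>_def[abs_def] using LIMSEQ_inverse_real_of_nat tendsto_mult_right_zero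
    by (auto simp: divide_inverse)
  have dom: "\<bar>sdiff Z x z * trunc p (\<delta> n) z\<bar> \<le> \<bar>sdiff Z x z * norm z powr - p\<bar>" for x z n
  proof (cases "z = 0")
    case False
    then have "trunc p (\<delta> n) z \<le> norm z powr - p" unfolding trunc_def using p0 by (intro powr_mono2') auto
    then show ?thesis by (simp add: abs_mult mult_left_mono)
  qed (simp add: sdiff_def)
  have "?L \<le> (LBINT x. wt p T x * (indicator E x * ((LBINT z. sdiff Z x z * trunc p (\<delta> n) z) / 2)))" for n
    using core_trunc[OF p T a \<theta> Z wZ anti \<delta>(1)[of n] \<delta>(2)[of n] \<eta>[OF \<delta>(1)[of n] \<delta>(2)[of n]]]
    unfolding conv_trunc_sdiff[OF p T \<delta>(1) Z wZ] E_superlevel Y_excess .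
  moreover have "(\<lambda>n. LBINT x. wt p T x * (indicator E x * ((LBINT z. sdiff Z x z * trunc p (\<delta> n) z) / 2)))
      \<longlonglongrightarrow> (LBINT x. wt p T x * (indicator E x * ((LBINT z. sdiff Z x z * norm z powr - p) / 2)))"
  proof (rule integral_dominated_convergence[OF _ _ wsd])
    have "(\<lambda>n. LBINT z. sdiff Z x z * trunc p (\<delta> n) z) \<longlonglongrightarrow> (LBINT z. sdiff Z x z * norm z powr - p)" for x
    proof (rule integral_dominated_convergence[OF _ _ integrable_abs[OF sd[of x]]])
      show "AE z in lborel. (\<lambda>n. sdiff Z x z * trunc p (\<delta> n) z) \<longlonglongrightarrow> sdiff Z x z * norm z powr - p"
      proof (rule AE_I2)
        fix z :: 'a
        show "(\<lambda>n. sdiff Z x z * trunc p (\<delta> n) z) \<longlonglongrightarrow> sdiff Z x z * norm z powr - p"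
        proof (cases "z = 0")
          case False
          then have "eventually (\<lambda>n. \<delta> n < norm z) sequentially"
            using order_tendstoD(2)[OF \<delta>0] by auto
          then have "eventually (\<lambda>n. sdiff Z x z * trunc p (\<delta> n) z = sdiff Z x z * norm z powr - p) sequentially"
            by eventually_elim (simp add: trunc_def max_def)
          then show ?thesis by (rule tendsto_eventually)
        qed (simp add: sdiff_def)
      qed
      show "AE z in lborel. norm (sdiff Z x z * trunc p (\<delta> n) z) \<le> \<bar>sdiff Z x z * norm z powr - p\<bar>" for n
        using dom by simp
    qed measurable
    then show "AE x in lborel. (\<lambda>n. wt p T x * (indicator E x * ((LBINT z. sdiff Z x z * trunc p (\<delta> n) z) / 2)))
        \<longlonglongrightarrow> wt p T x * (indicator E x * ((LBINT z. sdiff Z x z * norm z powr - p) / 2))"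
      by (intro AE_I2 tendsto_intros) auto
    show "AE x in lborel. norm (wt p T x * (indicator E x * ((LBINT z. sdiff Z x z * trunc p (\<delta> n) z) / 2)))
        \<le> wt p T x * (LBINT z. \<bar>sdiff Z x z * norm z powr - p\<bar>)" for n
    proof (rule AE_I2)
      fix x
      have "\<bar>LBINT z. sdiff Z x z * trunc p (\<delta> n) z\<bar> \<le> (LBINT z. \<bar>sdiff Z x z * trunc p (\<delta> n) z\<bar>)"
        by (rule integral_abs_bound)
      also have "\<dots> \<le> (LBINT z. \<bar>sdiff Z x z * norm z powr - p\<bar>)"
      proof (rule integral_mono[OF _ integrable_abs[OF sd] dom])
        show "integrable lborel (\<lambda>z. \<bar>sdiff Z x z * trunc p (\<delta> n) z\<bar>)"
          by (rule L1_dominated[OF sd[of x]]) (use dom in auto)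
      qed
      finally have *: "\<bar>LBINT z. sdiff Z x z * trunc p (\<delta> n) z\<bar> \<le> (LBINT z. \<bar>sdiff Z x z * norm z powr - p\<bar>)" .
      then have "\<bar>indicator E x * ((LBINT z. sdiff Z x z * trunc p (\<delta> n) z) / 2)\<bar> \<le> (LBINT z. \<bar>sdiff Z x z * norm z powr - p\<bar>)"
        by (auto split: split_indicator)
      then show "norm (wt p T x * (indicator E x * ((LBINT z. sdiff Z x z * trunc p (\<delta> n) z) / 2)))
          \<le> wt p T x * (LBINT z. \<bar>sdiff Z x z * norm z powr - p\<bar>)"
        unfolding real_norm_def abs_mult[of "wt p T x"] by (simp add: mult_left_mono)
    qed
  qed measurable
  ultimately show ?thesis by (intro tendsto_lowerbound[where F = sequentially]) auto
qed

text \<open>Removes the mollification. \<open>Y\<close> is 1-Lipschitz in its argument, so its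
  weighted integrals converge, but the sets \<open>E (Zn n)\<close> need not converge where
  \<open>Z\<close> equals \<theta>. They are compared with the non-strict level set: outside it
  their contribution dies out, on it \<open>neg\<close> discards \<open>\<kappa>\<close>, and by
  \<open>B\<close> the remaining long jumps cost at most \<open>B\<close> times the integral of
  \<open>wt * Y Z\<close>. As \<eta> + B is less than the mass of the far kernel, that integral
  vanishes.\<close>

lemma level_set_null:
  fixes a :: "'a::euclidean_space" and Z :: "'a \<Rightarrow> real" and Zn \<kappa>n :: "nat \<Rightarrow> 'a \<Rightarrow> real"
    and p T b \<theta> r \<eta> B :: real
  defines E_superlevel: "E \<equiv> superlevel a b \<theta>" and Y_excess: "Y \<equiv> excess a b \<theta>"
  assumes p: "real DIM('a) < p" and T: "0 < T" and \<theta>: "0 < \<theta>" and r: "0 < r"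
    and Zn [measurable]: "\<And>n. Zn n \<in> borel_measurable borel" and wZn: "\<And>n. wL1 p T (Zn n)"
    and Z [measurable]: "Z \<in> borel_measurable borel" and wZ: "wL1 p T Z"
    and \<kappa>n [measurable]: "\<And>n. \<kappa>n n \<in> borel_measurable borel" and w\<kappa>n: "\<And>n. wL1 p T (\<kappa>n n)"
    and \<kappa> [measurable]: "\<kappa> \<in> borel_measurable borel" and w\<kappa>: "wL1 p T \<kappa>"
    and ineq: "\<And>n. ((LBINT z. far p r (z::'a)) - \<eta>) * (LBINT x. wt p T x * Y (Zn n) x)
      - (LBINT x. wt p T x * (indicator (E (Zn n)) x * conv (Y (Zn n)) (far p r) x))
      \<le> (LBINT x. wt p T x * (indicator (E (Zn n)) x * \<kappa>n n x))"
    and limZ: "(\<lambda>n. LBINT x. wt p T x * \<bar>Zn n x - Z x\<bar>) \<longlonglongrightarrow> 0"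
    and lim\<kappa>: "(\<lambda>n. LBINT x. wt p T x * \<bar>\<kappa>n n x - \<kappa> x\<bar>) \<longlonglongrightarrow> 0"
    and limAE: "AE x in lborel. (\<lambda>n. Zn n x) \<longlonglongrightarrow> Z x"
    and neg: "AE x in lborel. b < a \<bullet> x \<longrightarrow> \<theta> \<le> Z x \<longrightarrow> \<kappa> x \<le> 0"
    and B: "\<And>y. (LBINT x. wt p T x * indicator {x. b < a \<bullet> x \<and> \<theta> \<le> Z x} x * far p r (x - y)) \<le> B * wt p T y"
    and \<eta>B: "\<eta> + B < (LBINT z. far p r (z::'a))"
  shows "AE x in lborel. b < a \<bullet> x \<longrightarrow> Z x \<le> \<theta>"
proof -
  have E_def: "E f = {x. b < a \<bullet> x \<and> \<theta> < f x}" for f by (simp add: E_superlevel superlevel_def)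
  have Y_def: "Y f = (\<lambda>x. indicator (E f) x * (f x - \<theta>))" for f
    by (auto simp: Y_excess E_superlevel excess_def)
  let ?B = "far p r :: 'a \<Rightarrow> real"
  define c where "c = (LBINT z. far p r (z::'a))"
  define F where "F = {x. b < a \<bullet> x \<and> \<theta> \<le> Z x}"
  define W where "W = (LBINT x. wt p T x * Y Z x)"
  have p0: "0 \<le> p" by (rule dim_less_nonneg[OF p(1)])
  have tB: "tame p T ?B" using p0 T r by (rule tame_far)
  have Em [measurable]: "E f \<in> sets borel" if "f \<in> borel_measurable borel" for f
    unfolding E_def using that by measurable
  have Fm [measurable]: "F \<in> sets borel" unfolding F_def by measurable
  have Ym [measurable]: "Y f \<in> borel_measurable borel" if "f \<in> borel_measurable borel" for f
    unfolding Y_def using that by measurable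
  have Y0: "0 \<le> Y f x" for f x by (auto simp: Y_def E_def split: split_indicator)
  have Yabs: "\<bar>Y f x\<bar> \<le> \<bar>f x\<bar>" for f x using \<theta> by (auto simp: Y_def E_def split: split_indicator)
  have Ylip: "\<bar>Y f x - Y g x\<bar> \<le> \<bar>f x - g x\<bar>" for f g x by (auto simp: Y_def E_def split: split_indicator)
  have wY: "wL1 p T (Y f)"
    if "f \<in> borel_measurable borel" "wL1 p T f" for f
    by (rule L1_dominated[OF that(2)])
       (use Yabs that(1) in \<open>auto simp: abs_mult intro!: mult_left_mono\<close>)
  have wd: "integrable lborel (\<lambda>x. wt p T x * \<bar>f x - g x\<bar>)"
    if "wL1 p T f" "wL1 p T g" for f g :: "'a \<Rightarrow> real"
    using integrable_abs[OF L1_diff[OF that]]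
    by (simp add: right_diff_distrib[symmetric] abs_mult)
  have wE: "integrable lborel (\<lambda>x. wt p T x * (indicator A x * f x))"
    if "wL1 p T f" "f \<in> borel_measurable borel" "A \<in> sets borel" for A and f :: "'a \<Rightarrow> real"
    by (rule L1_dominated[OF that(1)]) (use that(2,3) in \<open>auto split: split_indicator\<close>)
  obtain D where D: "0 \<le> D" "\<And>y. integrable lborel (\<lambda>x. wt p T x * \<bar>?B (x - y)\<bar>)"
    "\<And>y. (LBINT x. wt p T x * \<bar>?B (x - y)\<bar>) \<le> D * wt p T y"
    by (rule tame_wt_integral[OF T p tB]) (rule that)
  define d where "d n = (LBINT x. wt p T x * \<bar>Zn n x - Z x\<bar>)" for n
  define e where "e n = (LBINT x. wt p T x * \<bar>\<kappa>n n x - \<kappa> x\<bar>)" for n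
  define P where "P = conv (Y Z) ?B"
  have P0: "0 \<le> P x" for x unfolding P_def conv_def
    by (intro integral_nonneg_AE AE_I2 mult_nonneg_nonneg Y0 kernel_nonneg)
  have Pm [measurable]: "P \<in> borel_measurable borel" unfolding P_def
    by (rule measurable_conv[OF T p tB Ym[OF Z] wY[OF Z wZ]])
  have wP: "wL1 p T P" unfolding P_def
    by (rule integrable_wt_conv[OF T p tB Ym[OF Z] wY[OF Z wZ]])
  \<comment> \<open>The positive part keeps this majorant of \<open>\<kappa> + P\<close>
    nonnegative; on \<open>F\<close> it reduces almost everywhere to \<open>P\<close>, by
    \<open>neg\<close>.\<close>
  define H where "H x = max 0 (\<kappa> x) + P x" for x
  have Hm [measurable]: "H \<in> borel_measurable borel" unfolding H_def[abs_def] by measurable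
  have H0: "0 \<le> H x" for x using P0[of x] by (simp add: H_def)
  have wmax: "integrable lborel (\<lambda>x. wt p T x * max 0 (\<kappa> x))"
    by (rule L1_dominated[OF w\<kappa>]) (auto simp: abs_mult max_def intro!: mult_left_mono)
  have wH: "wL1 p T H"
    using L1_add[OF wmax wP] by (simp add: H_def distrib_left)
  define G where "G n = (LBINT x. wt p T x * (indicator (E (Zn n)) x * H x))" for n

  \<comment> \<open>Replacing \<open>Y (Zn n)\<close> by \<open>Y Z\<close> costs \<open>d n\<close>
    in the main term and \<open>D * d n\<close> inside the convolution; replacing
    \<open>\<kappa>n n\<close> by \<open>\<kappa>\<close> costs \<open>e n\<close>. Only the sets
    \<open>E (Zn n)\<close> in \<open>G n\<close> still carry n.\<close>
  have step: "(c - \<eta>) * W \<le> (c - \<eta>) * d n + D * d n + e n + G n" if "\<eta> \<le> c" for n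
  proof -
    let ?E = "E (Zn n)" and ?Y = "Y (Zn n)"
    note wYn = wY[OF Zn wZn, of n] and wYZ = wY[OF Z wZ]
    have dY: "(LBINT x. wt p T x * \<bar>?Y x - Y Z x\<bar>) \<le> d n"
      unfolding d_def by (intro integral_mono wd wYn wYZ wZ wZn mult_left_mono Ylip) simp
    have "W - (LBINT x. wt p T x * ?Y x) = (LBINT x. wt p T x * Y Z x - wt p T x * ?Y x)"
      unfolding W_def using wYn wYZ by simp
    also have "\<dots> \<le> (LBINT x. wt p T x * \<bar>?Y x - Y Z x\<bar>)"
    proof (intro integral_mono L1_diff wd wYn wYZ)
      show "wt p T x * Y Z x - wt p T x * ?Y x \<le> wt p T x * \<bar>?Y x - Y Z x\<bar>" for x
        unfolding right_diff_distrib[symmetric] by (intro mult_left_mono) auto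
    qed
    finally have 1: "W - d n \<le> (LBINT x. wt p T x * ?Y x)" using dY by linarith
    have "(\<lambda>x. ?Y x - Y Z x) \<in> borel_measurable borel" by measurable
    moreover have "integrable lborel (\<lambda>x. wt p T x * (?Y x - Y Z x))"
      using L1_diff[OF wYn wYZ] by (simp add: right_diff_distrib)
    ultimately have diff: "(\<lambda>x. ?Y x - Y Z x) \<in> borel_measurable borel" "integrable lborel (\<lambda>x. wt p T x * (?Y x - Y Z x))" by auto
    note mc [measurable] = measurable_conv[OF T p tB diff] measurable_conv[OF T p tB Ym[OF Zn] wYn]
    have wc: "integrable lborel (\<lambda>x. wt p T x * \<bar>conv (\<lambda>x. ?Y x - Y Z x) ?B x\<bar>)"
      using integrable_abs[OF integrable_wt_conv[OF T p tB diff]] by (simp add: abs_mult)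
    have cd: "conv (\<lambda>x. ?Y x - Y Z x) ?B x = conv ?Y ?B x - P x" for x
      unfolding P_def by (intro conv_diff integrable_conv_integrand[OF T p tB] Ym Z Zn wYn wYZ)
    have wcn: "integrable lborel (\<lambda>x. wt p T x * conv ?Y ?B x)" by (rule integrable_wt_conv[OF T p tB Ym[OF Zn] wYn])
    have "(LBINT x. wt p T x * (indicator ?E x * conv ?Y ?B x)) + (LBINT x. wt p T x * (indicator ?E x * \<kappa>n n x))
        = (LBINT x. wt p T x * (indicator ?E x * conv ?Y ?B x) + wt p T x * (indicator ?E x * \<kappa>n n x))"
      by (intro L1_integral_add[symmetric] wE wcn w\<kappa>n) measurable
    also have "\<dots> \<le> (LBINT x. wt p T x * (indicator ?E x * H x) + wt p T x * \<bar>conv (\<lambda>x. ?Y x - Y Z x) ?B x\<bar> + wt p T x * \<bar>\<kappa>n n x - \<kappa> x\<bar>)"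
    proof (rule integral_mono)
      show "integrable lborel (\<lambda>x. wt p T x * (indicator ?E x * conv ?Y ?B x) + wt p T x * (indicator ?E x * \<kappa>n n x))"
        by (intro L1_add wE wcn w\<kappa>n) measurable
      show "integrable lborel (\<lambda>x. wt p T x * (indicator ?E x * H x) + wt p T x * \<bar>conv (\<lambda>x. ?Y x - Y Z x) ?B x\<bar> + wt p T x * \<bar>\<kappa>n n x - \<kappa> x\<bar>)"
        by (intro L1_add wE wH wc wd w\<kappa>n w\<kappa>) measurable
      fix x
      have "indicator ?E x * conv ?Y ?B x + indicator ?E x * \<kappa>n n x
          \<le> indicator ?E x * H x + \<bar>conv ?Y ?B x - P x\<bar> + \<bar>\<kappa>n n x - \<kappa> x\<bar>"
        by (auto simp: H_def split: split_indicator)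
      then show "wt p T x * (indicator ?E x * conv ?Y ?B x) + wt p T x * (indicator ?E x * \<kappa>n n x)
          \<le> wt p T x * (indicator ?E x * H x) + wt p T x * \<bar>conv (\<lambda>x. ?Y x - Y Z x) ?B x\<bar> + wt p T x * \<bar>\<kappa>n n x - \<kappa> x\<bar>"
        unfolding cd distrib_left[symmetric] by (rule mult_left_mono) simp
    qed
    also have "\<dots> = G n + (LBINT x. wt p T x * \<bar>conv (\<lambda>x. ?Y x - Y Z x) ?B x\<bar>) + e n"
      unfolding G_def e_def using wE[OF wH Hm Em[OF Zn]] wc wd[OF w\<kappa>n w\<kappa>] by simp
    also have "(LBINT x. wt p T x * \<bar>conv (\<lambda>x. ?Y x - Y Z x) ?B x\<bar>) \<le> D * (LBINT x. wt p T x * \<bar>?Y x - Y Z x\<bar>)"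
      by (rule wt_conv_norm_le[OF T p tB diff D(3)])
    also have "\<dots> \<le> D * d n" using dY D(1) by (rule mult_left_mono)
    finally have 2: "(LBINT x. wt p T x * (indicator ?E x * conv ?Y ?B x)) + (LBINT x. wt p T x * (indicator ?E x * \<kappa>n n x))
        \<le> G n + D * d n + e n" by simp
    have "(c - \<eta>) * (W - d n) \<le> (c - \<eta>) * (LBINT x. wt p T x * ?Y x)"
      using 1 that by (intro mult_left_mono) auto
    then show ?thesis using ineq[of n] 2 unfolding c_def[symmetric] right_diff_distrib by linarith
  qed

  define Q where "Q = (LBINT x. wt p T x * (indicator F x * P x))"
  define g where "g n = (LBINT x. wt p T x * (indicator (E (Zn n) - F) x * H x))" for n
  have GQ: "G n \<le> Q + g n" for n
  proof -
    have "G n \<le> (LBINT x. wt p T x * (indicator F x * P x) + wt p T x * (indicator (E (Zn n) - F) x * H x))"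
      unfolding G_def
    proof (rule integral_mono_AE)
      show "AE x in lborel. wt p T x * (indicator (E (Zn n)) x * H x)
          \<le> wt p T x * (indicator F x * P x) + wt p T x * (indicator (E (Zn n) - F) x * H x)"
        using neg
      proof eventually_elim
        case (elim x)
        have "indicator (E (Zn n)) x * H x \<le> indicator F x * P x + indicator (E (Zn n) - F) x * H x"
          using elim P0[of x] by (auto simp: F_def H_def split: split_indicator)
        then show ?case unfolding distrib_left[symmetric] by (rule mult_left_mono) simp
      qed
    qed (intro L1_add wE wH wP; measurable)+
    also have "\<dots> = Q + g n"
      unfolding Q_def g_def by (intro L1_integral_add wE wP wH; measurable)
    finally show ?thesis .
  qed
  \<comment> \<open>In the half-space below the level, pointwise convergence puts x outside
    \<open>E (Zn n)\<close> for large n; at all other points the indicator is 0 for every n.\<close>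
  have g0: "g \<longlonglongrightarrow> 0"
  proof -
    have "g \<longlonglongrightarrow> (\<integral>x. 0 \<partial>(lborel :: 'a measure))"
      unfolding g_def[abs_def]
    proof (rule integral_dominated_convergence[OF _ _ wH])
      show "AE x in lborel. (\<lambda>n. wt p T x * (indicator (E (Zn n) - F) x * H x)) \<longlonglongrightarrow> 0"
        using limAE
      proof eventually_elim
        case (elim x)
        show ?case
        proof (cases "b < a \<bullet> x \<and> Z x < \<theta>")
          case True
          then have "eventually (\<lambda>n. Zn n x < \<theta>) sequentially" using order_tendstoD(2)[OF elim] by blast
          then have "eventually (\<lambda>n. wt p T x * (indicator (E (Zn n) - F) x * H x) = 0) sequentially"
            by eventually_elim (auto simp: E_def)
          then show ?thesis by (rule tendsto_eventually)
        next
          case False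
          then have "x \<notin> E (Zn n) - F" for n by (auto simp: E_def F_def)
          then show ?thesis by simp
        qed
      qed
      show "AE x in lborel. norm (wt p T x * (indicator (E (Zn n) - F) x * H x)) \<le> wt p T x * H x" for n
        using H0 by (auto split: split_indicator)
    qed measurable
    then show ?thesis by simp
  qed
  \<comment> \<open>Fubini moves the far kernel onto the weight restricted to \<open>F\<close>, the
    quantity that hypothesis \<open>B\<close> bounds.\<close>
  have "Q \<le> B * W"
  proof -
    have ind: "\<bar>wt p T x * indicator F x\<bar> \<le> 1 * wt p T x" for x by (auto split: split_indicator)
    have m: "(\<lambda>x. wt p T x * indicator F x) \<in> borel_measurable borel" by measurable
    note ci = conv_integrals[OF T p tB Ym[OF Z] wY[OF Z wZ] m ind]
    have "Q = (LBINT y. Y Z y * (LBINT x. wt p T x * indicator F x * ?B (x - y)))"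
      unfolding Q_def P_def using ci(3) by (simp add: mult.assoc)
    also have "\<dots> \<le> (LBINT y. B * (wt p T y * Y Z y))"
    proof (intro integral_mono ci(2) integrable_mult_right wY Z wZ)
      show "Y Z y * (LBINT x. wt p T x * indicator F x * ?B (x - y)) \<le> B * (wt p T y * Y Z y)" for y
        using mult_left_mono[OF B[of y] Y0[of Z y]] by (simp add: F_def mult_ac)
    qed
    also have "\<dots> = B * W" by (simp add: W_def)
    finally show ?thesis .
  qed
  \<comment> \<open>Together with \<open>\<eta>B\<close> this yields \<eta> <= c, the condition of
    \<open>step\<close>.\<close>
  have B0: "0 \<le> B"
  proof -
    have "0 \<le> (LBINT x. wt p T x * indicator F x * ?B (x - 0))" by (intro integral_nonneg_AE) auto
    then have "0 \<le> B * wt p T (0::'a)" using B[of 0] unfolding F_def by linarith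
    then show ?thesis by (simp add: wt_def zero_le_mult_iff)
  qed
  have "(\<lambda>n. (c - \<eta>) * d n + D * d n + e n + (Q + g n)) \<longlonglongrightarrow> (c - \<eta>) * 0 + D * 0 + 0 + (Q + 0)"
    using limZ lim\<kappa> g0 by (intro tendsto_intros) (auto simp: d_def e_def)
  moreover have "(c - \<eta>) * W \<le> (c - \<eta>) * d n + D * d n + e n + (Q + g n)" for n
    using step[of n] GQ[of n] \<eta>B B0 unfolding c_def by linarith
  ultimately have "(c - \<eta>) * W \<le> (c - \<eta>) * 0 + D * 0 + 0 + (Q + 0)"
    by (intro tendsto_lowerbound[where F = sequentially]) auto
  then have "(c - \<eta> - B) * W \<le> 0" using \<open>Q \<le> B * W\<close> by (simp add: left_diff_distrib)
  moreover have "0 < c - \<eta> - B" using \<eta>B by (simp add: c_def)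
  ultimately have "W \<le> 0" by (simp add: mult_le_0_iff)
  moreover have "0 \<le> W" unfolding W_def by (intro integral_nonneg_AE) (auto simp: Y0)
  ultimately have "(LBINT x. wt p T x * Y Z x) = 0" by (simp add: W_def)
  then have "AE x in lborel. wt p T x * Y Z x = 0"
    using integral_nonneg_eq_0_iff_AE[OF wY[OF Z wZ]] by (auto simp: Y0)
  then show ?thesis
  proof eventually_elim
    case (elim x)
    have "wt p T x \<noteq> 0" using wt_pos[of p T x] by linarith
    then show ?case using elim by (auto simp: Y_def E_def split: split_indicator_asm)
  qed
qed

section \<open>Reflection of the solution\<close>

text \<open>For |x - y| > r the kernel is at most (1/r^2 + 1/T^2)^(p/2) times
  \<open>wt p T (x - y)\<close>, and r <= T bounds that factor by (2/r^2)^(p/2).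
  \<open>wt_mult_le\<close> absorbs the product of the weights with another 2^(p/2), leaving 2^p
  r^(-p) \<open>wt p T y\<close>; integration over \<open>F\<close> brings in its measure.\<close>

lemma far_level_le:
  fixes F :: "'a::euclidean_space set"
  assumes p: "0 \<le> p" and r: "0 < r" "r \<le> T" and F [measurable]: "F \<in> sets borel" "emeasure lborel F < \<infinity>"
  shows "(LBINT x. wt p T x * indicator F x * far p r (x - y)) \<le> 2 powr p * r powr - p * measure lborel F * wt p T y"
proof -
  have pw: "wt p T x * far p r (x - y) \<le> 2 powr p * r powr - p * wt p T y" for x
  proof (cases "r < norm (x - y)")
    case True
    have "wt p T x * wt p T (x - y) \<le> 2 powr (p / 2) * wt p T y"
      using wt_mult_le[OF p, of T x y] by (simp add: wt_diff_commute[of p T y x])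
    then have "(1 / r\<^sup>2 + 1 / T\<^sup>2) powr (p / 2) * (wt p T x * wt p T (x - y))
        \<le> (1 / r\<^sup>2 + 1 / T\<^sup>2) powr (p / 2) * (2 powr (p / 2) * wt p T y)"
      by (rule mult_left_mono) simp
    also have "\<dots> \<le> (2 / r\<^sup>2) powr (p / 2) * (2 powr (p / 2) * wt p T y)"
    proof (intro mult_right_mono powr_mono2)
      have "1 / T\<^sup>2 \<le> 1 / r\<^sup>2" using r by (intro divide_left_mono power_mono) auto
      then show "1 / r\<^sup>2 + 1 / T\<^sup>2 \<le> 2 / r\<^sup>2" by simp
    qed (use p in auto)
    also have "\<dots> = ((2 / r\<^sup>2) * 2) powr (p / 2) * wt p T y" using r by (subst powr_mult) auto
    also have "(2 / r\<^sup>2) * 2 = (2 / r) powr 2" using r by (simp add: power_divide)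
    also have "((2 / r) powr 2) powr (p / 2) = 2 powr p * r powr - p"
      using r by (simp add: powr_powr powr_divide powr_minus_divide del: powr_numeral)
    finally have *: "(1 / r\<^sup>2 + 1 / T\<^sup>2) powr (p / 2) * (wt p T x * wt p T (x - y)) \<le> 2 powr p * r powr - p * wt p T y" .
    have "wt p T x * norm (x - y) powr - p \<le> wt p T x * ((1 / r\<^sup>2 + 1 / T\<^sup>2) powr (p / 2) * wt p T (x - y))"
      using True r p by (intro mult_left_mono norm_powr_le_wt) auto
    also have "\<dots> = (1 / r\<^sup>2 + 1 / T\<^sup>2) powr (p / 2) * (wt p T x * wt p T (x - y))"
      by (rule mult.left_commute)
    also note *
    finally show ?thesis using True by (simp add: far_def)
  qed (simp add: far_def)
  have iF: "integrable lborel (\<lambda>x. indicator F x * (2 powr p * r powr - p * wt p T y))"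
    using F by (intro integrable_mult_left integrable_real_indicator) auto
  have b: "wt p T x * indicator F x * far p r (x - y) \<le> indicator F x * (2 powr p * r powr - p * wt p T y)" for x
    using pw[of x] by (auto split: split_indicator)
  have "(LBINT x. wt p T x * indicator F x * far p r (x - y))
      \<le> (LBINT x. indicator F x * (2 powr p * r powr - p * wt p T y))"
  proof (rule integral_mono[OF _ iF b])
    show "integrable lborel (\<lambda>x. wt p T x * indicator F x * far p r (x - y))"
      by (rule L1_dominated[OF iF])
         (use b in \<open>auto intro!: AE_I2 le_abs_trans\<close>)
  qed
  also have "\<dots> = 2 powr p * r powr - p * measure lborel F * wt p T y" by simp
  finally show ?thesis .
qed

text \<open>The reflection preserves Lebesgue measure and distorts the weight by a bounded factor
  only.\<close>

lemma wt_hyp_refl_integral: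
  fixes a :: "'a::euclidean_space"
  assumes p: "0 \<le> p" and a: "a \<noteq> 0"
  obtains C where "0 \<le> C"
    "\<And>g :: 'a \<Rightarrow> real. g \<in> borel_measurable borel \<Longrightarrow> wL1 p T g \<Longrightarrow>
      integrable lborel (\<lambda>x. wt p T x * g (hyp_refl a b x)) \<and>
      (LBINT x. wt p T x * \<bar>g (hyp_refl a b x)\<bar>) \<le> C * (LBINT x. wt p T x * \<bar>g x\<bar>)"
proof -
  obtain C where C: "0 \<le> C" "\<And>x. wt p T (hyp_refl a b x) \<le> C * wt p T x"
    using wt_hyp_refl_le[OF p a] by blast
  show thesis
  proof (rule that[OF C(1)], rule conjI)
    fix g :: "'a \<Rightarrow> real"
    assume g [measurable]: "g \<in> borel_measurable borel" and wg: "wL1 p T g"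
    have awg: "integrable lborel (\<lambda>x. C * (wt p T x * \<bar>g x\<bar>))"
      using integrable_mult_right[OF integrable_abs[OF wg], of C] by (simp add: abs_mult)
    have b: "wt p T (hyp_refl a b x) * \<bar>g x\<bar> \<le> C * (wt p T x * \<bar>g x\<bar>)" for x
      using mult_right_mono[OF C(2)[of x], of "\<bar>g x\<bar>"] by (simp add: mult.assoc)
    have i: "integrable lborel (\<lambda>x. wt p T (hyp_refl a b x) * g x)"
      by (rule L1_dominated[OF awg])
         (use b C(1) in \<open>auto simp: abs_mult\<close>)
    show "integrable lborel (\<lambda>x. wt p T x * g (hyp_refl a b x))"
      using integrable_hyp_refl[OF a i, of b] a by simp
    have "(LBINT x. wt p T x * \<bar>g (hyp_refl a b x)\<bar>) = (LBINT x. wt p T (hyp_refl a b x) * \<bar>g x\<bar>)"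
      using integral_hyp_refl[OF a, of "\<lambda>x. wt p T (hyp_refl a b x) * \<bar>g x\<bar>" b] a by simp
    also have "\<dots> \<le> (LBINT x. C * (wt p T x * \<bar>g x\<bar>))"
      using integrable_abs[OF i] by (intro integral_mono awg b) (simp add: abs_mult)
    finally show "(LBINT x. wt p T x * \<bar>g (hyp_refl a b x)\<bar>) \<le> C * (LBINT x. wt p T x * \<bar>g x\<bar>)" by simp
  qed
qed

lemma spow_strict_mono:
  assumes m: "0 < m" and "s < t"
  shows "spow m s < spow m t"
proof -
  consider "0 \<le> s" | "s < 0" "0 \<le> t" | "t < 0" using assms by linarith
  then show ?thesis
  proof cases
    case 1
    then have "s powr m < t powr m" using assms by (intro powr_less_mono2) auto
    then show ?thesis using 1 assms by (cases "s = 0") (auto simp: spow_def)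
  next
    case 2
    then have "spow m s < 0" "0 \<le> spow m t" by (auto simp: spow_def sgn_if)
    then show ?thesis by linarith
  next
    case 3
    then have "(- t) powr m < (- s) powr m" using assms by (intro powr_less_mono2) auto
    then show ?thesis using 3 assms by (simp add: spow_def)
  qed
qed

lemma abs_spow: "\<bar>spow m t\<bar> = \<bar>t\<bar> powr m"
  by (cases "t = 0") (auto simp: spow_def abs_mult abs_sgn_eq)

lemma antisym_tendsto:
  fixes a :: "'a::euclidean_space" and gn :: "nat \<Rightarrow> 'a \<Rightarrow> real"
  assumes p: "0 \<le> p" and a: "a \<noteq> 0"
    and gn [measurable]: "\<And>n. gn n \<in> borel_measurable borel" and wgn: "\<And>n. wL1 p T (gn n)"
    and g [measurable]: "g \<in> borel_measurable borel" and wg: "wL1 p T g"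
    and lim: "(\<lambda>n. LBINT x. wt p T x * \<bar>gn n x - g x\<bar>) \<longlonglongrightarrow> 0"
  shows "(\<lambda>n. LBINT x. wt p T x * \<bar>(gn n (hyp_refl a b x) - gn n x) - (g (hyp_refl a b x) - g x)\<bar>) \<longlonglongrightarrow> 0"
proof -
  obtain C where C: "0 \<le> C"
    "\<And>g :: 'a \<Rightarrow> real. g \<in> borel_measurable borel \<Longrightarrow> wL1 p T g \<Longrightarrow>
      integrable lborel (\<lambda>x. wt p T x * g (hyp_refl a b x)) \<and>
      (LBINT x. wt p T x * \<bar>g (hyp_refl a b x)\<bar>) \<le> C * (LBINT x. wt p T x * \<bar>g x\<bar>)"
    proof (rule wt_hyp_refl_integral[OF p a, of T b], goal_cases)
    case (1 C)
    from 1(2-) show ?case by (rule 1(1))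
  qed
  have A: "norm (LBINT x. wt p T x * \<bar>(gn n (hyp_refl a b x) - gn n x) - (g (hyp_refl a b x) - g x)\<bar>)
      \<le> (C + 1) * (LBINT x. wt p T x * \<bar>gn n x - g x\<bar>)" for n
  proof -
    let ?h = "\<lambda>x. gn n x - g x"
    have wh: "integrable lborel (\<lambda>x. wt p T x * ?h x)"
      using L1_diff[OF wgn[of n] wg] by (simp add: right_diff_distrib)
    have hm: "?h \<in> borel_measurable borel" by measurable
    note hC = C(2)[OF hm wh]
    have i1: "integrable lborel (\<lambda>x. wt p T x * \<bar>?h x\<bar>)"
      using integrable_abs[OF wh] by (simp add: abs_mult)
    have i2: "integrable lborel (\<lambda>x. wt p T x * \<bar>?h (hyp_refl a b x)\<bar>)"
      using integrable_abs[OF conjunct1[OF hC]] by (simp add: abs_mult)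
    have b: "wt p T x * \<bar>(gn n (hyp_refl a b x) - gn n x) - (g (hyp_refl a b x) - g x)\<bar>
        \<le> wt p T x * \<bar>?h (hyp_refl a b x)\<bar> + wt p T x * \<bar>?h x\<bar>" for x
      unfolding distrib_left[symmetric] by (intro mult_left_mono) auto
    have "(LBINT x. wt p T x * \<bar>(gn n (hyp_refl a b x) - gn n x) - (g (hyp_refl a b x) - g x)\<bar>)
        \<le> (LBINT x. wt p T x * \<bar>?h (hyp_refl a b x)\<bar> + wt p T x * \<bar>?h x\<bar>)"
    proof (rule integral_mono[OF _ _ b])
      show "integrable lborel (\<lambda>x. wt p T x * \<bar>?h (hyp_refl a b x)\<bar> + wt p T x * \<bar>?h x\<bar>)"
        by (rule L1_add[OF i2 i1])
      then show "integrable lborel (\<lambda>x. wt p T x * \<bar>(gn n (hyp_refl a b x) - gn n x) - (g (hyp_refl a b x) - g x)\<bar>)"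
        by (rule L1_dominated)
           (use b in \<open>auto intro!: AE_I2 le_abs_trans\<close>)
    qed
    also have "\<dots> = (LBINT x. wt p T x * \<bar>?h (hyp_refl a b x)\<bar>) + (LBINT x. wt p T x * \<bar>?h x\<bar>)"
      by (rule L1_integral_add[OF i2 i1])
    also have "\<dots> \<le> (C + 1) * (LBINT x. wt p T x * \<bar>?h x\<bar>)"
      using conjunct2[OF hC] by (simp add: distrib_right)
    finally show ?thesis by simp
  qed
  have "(\<lambda>n. (C + 1) * (LBINT x. wt p T x * \<bar>gn n x - g x\<bar>)) \<longlonglongrightarrow> 0"
    using tendsto_mult_right_zero[OF lim] by simp
  with always_eventually[OF allI[OF A]] show ?thesis by (rule Lim_null_comparison)
qed

text \<open>The second difference of G composed with the reflection, at x in direction z, is that of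
  G at the mirror point in direction \<open>hyp_refl a 0 z\<close>. This direction has the same
  length, so substituting it for z changes neither |z|^(-p) nor the measure.\<close>

lemma antisym_sdiff:
  fixes a :: "'a::euclidean_space" and b :: real and G :: "'a \<Rightarrow> real"
  assumes p: "0 \<le> p" and a: "a \<noteq> 0" and G [measurable]: "G \<in> borel_measurable borel"
    and sd: "\<And>x. integrable lborel (\<lambda>z. sdiff G x z * norm z powr - p)"
    and wsd: "integrable lborel (\<lambda>x. wt p T x * (LBINT z. \<bar>sdiff G x z * norm z powr - p\<bar>))"
  defines "Z \<equiv> \<lambda>x. G (hyp_refl a b x) - G x"
  shows "integrable lborel (\<lambda>z. sdiff Z x z * norm z powr - p)"
    and "(LBINT z. sdiff Z x z * norm z powr - p)
      = (LBINT z. sdiff G (hyp_refl a b x) z * norm z powr - p) - (LBINT z. sdiff G x z * norm z powr - p)"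
    and "integrable lborel (\<lambda>x. wt p T x * (LBINT z. \<bar>sdiff Z x z * norm z powr - p\<bar>))"
proof -
  have [measurable]: "Z \<in> borel_measurable borel" unfolding Z_def by measurable
  let ?g = "\<lambda>x z. sdiff G x z * norm z powr - p"
  let ?M = "\<lambda>x. LBINT z. \<bar>?g x z\<bar>"
  have eq: "sdiff Z x z * norm z powr - p = ?g (hyp_refl a b x) (hyp_refl a 0 z) - ?g x z" for x z
    using a by (simp add: Z_def sdiff_def hyp_refl_add hyp_refl_diff norm_hyp_refl algebra_simps)
  have gm: "?g x \<in> borel_measurable borel" for x by measurable
  have gm': "(\<lambda>z. \<bar>?g x z\<bar>) \<in> borel_measurable borel" for x by measurable
  have i: "integrable lborel (\<lambda>z. ?g (hyp_refl a b x) (hyp_refl a 0 z))" for x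
    by (rule integrable_hyp_refl[OF a sd])
  show int: "integrable lborel (\<lambda>z. sdiff Z x z * norm z powr - p)" for x
    unfolding eq by (intro L1_diff i sd)
  show "(LBINT z. sdiff Z x z * norm z powr - p)
      = (LBINT z. sdiff G (hyp_refl a b x) z * norm z powr - p) - (LBINT z. sdiff G x z * norm z powr - p)"
    unfolding eq L1_integral_diff[OF i sd]
    using integral_hyp_refl[OF a gm, of "hyp_refl a b x" 0] by simp
  have Mm [measurable]: "?M \<in> borel_measurable borel" by measurable
  obtain C where C: "0 \<le> C"
    "\<And>g :: 'a \<Rightarrow> real. g \<in> borel_measurable borel \<Longrightarrow> wL1 p T g \<Longrightarrow>
      integrable lborel (\<lambda>x. wt p T x * g (hyp_refl a b x)) \<and>
      (LBINT x. wt p T x * \<bar>g (hyp_refl a b x)\<bar>) \<le> C * (LBINT x. wt p T x * \<bar>g x\<bar>)"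
    proof (rule wt_hyp_refl_integral[OF p a, of T b], goal_cases)
    case (1 C)
    from 1(2-) show ?case by (rule 1(1))
  qed
  have "integrable lborel (\<lambda>x. wt p T x * ?M (hyp_refl a b x) + wt p T x * ?M x)"
    by (intro L1_add wsd conjunct1[OF C(2)[OF Mm wsd]])
  then show "integrable lborel (\<lambda>x. wt p T x * (LBINT z. \<bar>sdiff Z x z * norm z powr - p\<bar>))"
  proof (rule L1_dominated)
    show "AE x in lborel. norm (wt p T x * (LBINT z. \<bar>sdiff Z x z * norm z powr - p\<bar>))
        \<le> norm (wt p T x * ?M (hyp_refl a b x) + wt p T x * ?M x)"
    proof (rule AE_I2)
      fix x
      have "(LBINT z. \<bar>sdiff Z x z * norm z powr - p\<bar>)
          \<le> (LBINT z. \<bar>?g (hyp_refl a b x) (hyp_refl a 0 z)\<bar> + \<bar>?g x z\<bar>)"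
        by (intro integral_mono integrable_abs int L1_add i sd)
           (unfold eq, rule abs_triangle_ineq4)
      also have "\<dots> = (LBINT z. \<bar>?g (hyp_refl a b x) (hyp_refl a 0 z)\<bar>) + ?M x"
        by (intro L1_integral_add integrable_abs i sd)
      also have "(LBINT z. \<bar>?g (hyp_refl a b x) (hyp_refl a 0 z)\<bar>) = ?M (hyp_refl a b x)"
        using integral_hyp_refl[OF a gm', of "hyp_refl a b x" 0] .
      finally have "wt p T x * (LBINT z. \<bar>sdiff Z x z * norm z powr - p\<bar>)
          \<le> wt p T x * (?M (hyp_refl a b x) + ?M x)"
        by (rule mult_left_mono) simp
      then show "norm (wt p T x * (LBINT z. \<bar>sdiff Z x z * norm z powr - p\<bar>))
          \<le> norm (wt p T x * ?M (hyp_refl a b x) + wt p T x * ?M x)"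
        by (simp add: abs_mult distrib_left)
    qed
  qed measurable
qed

section \<open>The weak solution: mollified equation and level sets\<close>

context
  fixes s m p :: real and f u :: "'a::euclidean_space \<Rightarrow> real"
  assumes s: "0 < s" "s < 1" and p_eq: "p = real DIM('a) + 2 * s" and f: "integrable lborel f" and sol: "frac_weak_sol s m f u"
begin

private abbreviation (input) "U \<equiv> \<lambda>x. spow m (u x)"
private abbreviation (input) "k \<equiv> \<lambda>x. f x - u x"

private lemma p: "real DIM('a) < p" "p < real DIM('a) + 2" "0 \<le> p"
  using s by (auto simp: p_eq)

lemma wt_integrable:
  fixes g :: "'a \<Rightarrow> real"
  assumes "integrable lborel g"
  shows "wL1 p T g"
proof (rule L1_dominated[OF assms])
  show "AE x in lborel. norm (wt p T x * g x) \<le> norm (g x)"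
    using wt_le_1[of p T] p by (auto simp: abs_mult intro!: AE_I2 mult_left_le_one_le)
qed (use borel_measurable_integrable[OF assms] in measurable)

lemma u_integrable: "integrable lborel u"
  using sol by (simp add: frac_weak_sol_def)

lemma U_measurable: "U \<in> borel_measurable borel"
  using borel_measurable_integrable[OF u_integrable] by simp

lemma wt_U_integrable:
  assumes T: "0 < T"
  shows "wL1 p T U"
proof -
  obtain C where C: "0 \<le> C" "\<And>x::'a. wt p T x \<le> C / (1 + norm x) powr p"
    using wt_le_norm_weight[OF p(3) T] by blast
  have "integrable lborel (\<lambda>x. C * (\<bar>u x\<bar> powr m / (1 + norm x) powr p))"
    using sol by (intro integrable_mult_right) (simp add: frac_weak_sol_def p_eq)
  then show ?thesis
  proof (rule L1_dominated)
    show "AE x in lborel. norm (wt p T x * U x) \<le> norm (C * (\<bar>u x\<bar> powr m / (1 + norm x) powr p))"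
    proof (rule AE_I2)
      fix x
      have "wt p T x * \<bar>u x\<bar> powr m \<le> C / (1 + norm x) powr p * \<bar>u x\<bar> powr m"
        using C(2)[of x] by (rule mult_right_mono) simp
      then show "norm (wt p T x * U x) \<le> norm (C * (\<bar>u x\<bar> powr m / (1 + norm x) powr p))"
        using C(1) by (simp add: abs_mult abs_spow)
    qed
  qed (use U_measurable in measurable)
qed

text \<open>The weak equation is tested with the function taking y to
  \<open>moll \<epsilon> (x - y)\<close>; \<open>integral_sdiff_conv\<close> turns the resulting
  \<open>frac_lap\<close> term into a singular integral of the mollified \<open>U\<close>. The
  equation thereby becomes pointwise.\<close>

lemma mollified_equation:
  assumes \<epsilon>: "0 < \<epsilon>" "\<epsilon> \<le> 1"
  shows "frac_const DIM('a) s / 2 * (LBINT z. sdiff (conv U (moll \<epsilon>)) x z * norm z powr - p) = conv k (moll \<epsilon>) x"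
proof -
  let ?c = "frac_const DIM('a) s / 2"
  have T: "0 < (1::real)" by simp
  have m: "tame p 1 (moll \<epsilon> :: 'a \<Rightarrow> real)" by (intro tame_moll p T \<epsilon>)
  have i: "integrable lborel (\<lambda>y. g y * moll \<epsilon> (x - y))" if "integrable lborel g" for g :: "'a \<Rightarrow> real"
    using borel_measurable_integrable[OF that] wt_integrable[OF that, of 1]
    by (intro integrable_conv_integrand[OF T p(1) m]) auto
  have "(LBINT y. U y * frac_lap s (\<lambda>y. moll \<epsilon> (x - y)) y) + (LBINT y. u y * moll \<epsilon> (x - y))
      = (LBINT y. f y * moll \<epsilon> (x - y))"
    using sol test_fun_moll[OF \<epsilon>(1), of x] by (simp add: frac_weak_sol_def)
  moreover have "(LBINT y. U y * frac_lap s (\<lambda>y. moll \<epsilon> (x - y)) y)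
      = ?c * (LBINT z. sdiff (conv U (moll \<epsilon>)) x z * norm z powr - p)"
    unfolding frac_lap_moll p_eq[symmetric] mult.left_commute[of _ ?c]
      integral_sdiff_conv[OF \<epsilon> p(1,2) T U_measurable wt_U_integrable[OF T]]
    by (rule integral_mult_right_zero)
  moreover have "conv k (moll \<epsilon>) x = (LBINT y. f y * moll \<epsilon> (x - y)) - (LBINT y. u y * moll \<epsilon> (x - y))"
    using conv_diff[OF i[OF f] i[OF u_integrable]] by (simp add: conv_def)
  ultimately show ?thesis by linarith
qed

context
  fixes a :: 'a and b :: real
  assumes a: "a \<noteq> 0" and m_pos: "0 < m"
    and mono: "AE x in lborel. a \<bullet> x > b \<longrightarrow> f x \<ge> f (hyp_refl a b x)"
begin

private abbreviation (input) "Z \<equiv> \<lambda>x. U (hyp_refl a b x) - U x"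

lemma level_set_measurable: "{x. b < a \<bullet> x \<and> \<theta> \<le> Z x} \<in> sets borel"
  using U_measurable by measurable

text \<open>Chebyshev: on the level set, |u|^m is at least \<theta>/2 at x or at its mirror image,
  so the sum of the two values of |u| is at least (\<theta>/2)^(1/m). Here integrability of
  \<open>u\<close> against Lebesgue measure itself enters.\<close>

lemma level_set_finite:
  assumes \<theta>: "0 < \<theta>"
  shows "emeasure lborel {x. b < a \<bullet> x \<and> \<theta> \<le> Z x} < \<infinity>"
proof -
  let ?F = "{x. b < a \<bullet> x \<and> \<theta> \<le> Z x}"
  define \<tau> where "\<tau> = (\<theta> / 2) powr (1 / m)"
  have \<tau>: "0 < \<tau>" using \<theta> by (simp add: \<tau>_def)
  have "\<tau> \<le> \<bar>t\<bar>" if "\<theta> / 2 \<le> \<bar>t\<bar> powr m" for t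
    using powr_mono2[OF _ _ that, of "1 / m"] m_pos \<theta> by (simp add: \<tau>_def powr_powr)
  then have *: "\<tau> \<le> \<bar>u x\<bar> + \<bar>u (hyp_refl a b x)\<bar>" if "x \<in> ?F" for x
  proof -
    have "\<theta> \<le> \<bar>u (hyp_refl a b x)\<bar> powr m + \<bar>u x\<bar> powr m"
      using that abs_spow[of m "u x"] abs_spow[of m "u (hyp_refl a b x)"] by auto
    then consider "\<theta> / 2 \<le> \<bar>u (hyp_refl a b x)\<bar> powr m" | "\<theta> / 2 \<le> \<bar>u x\<bar> powr m" by linarith
    then show ?thesis using \<open>\<And>t. \<theta> / 2 \<le> \<bar>t\<bar> powr m \<Longrightarrow> \<tau> \<le> \<bar>t\<bar>\<close> by cases force+
  qed
  have "integrable lborel (\<lambda>x. (\<bar>u x\<bar> + \<bar>u (hyp_refl a b x)\<bar>) / \<tau>)"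
    by (intro integrable_divide L1_add integrable_abs integrable_hyp_refl a u_integrable)
  then have "integrable lborel (indicat_real ?F)"
  proof (rule L1_dominated)
    show "AE x in lborel. norm (indicat_real ?F x) \<le> norm ((\<bar>u x\<bar> + \<bar>u (hyp_refl a b x)\<bar>) / \<tau>)"
    proof (rule AE_I2)
      fix x
      show "norm (indicat_real ?F x) \<le> norm ((\<bar>u x\<bar> + \<bar>u (hyp_refl a b x)\<bar>) / \<tau>)"
        using *[of x] \<tau> by (cases "x \<in> ?F") (auto simp: le_divide_eq)
    qed
  qed (use level_set_measurable in simp)
  then show ?thesis using level_set_measurable[of \<theta>] by (simp add: integrable_indicator_iff)
qed

lemma level_bound:
  assumes \<theta>: "0 < \<theta>"
  shows "AE x in lborel. b < a \<bullet> x \<longrightarrow> Z x \<le> \<theta>"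
proof -
  let ?N = "real DIM('a)" and ?F = "{x. b < a \<bullet> x \<and> \<theta> \<le> Z x}"
  define \<mu> where "\<mu> = measure lborel ?F"
  have c0: "0 < frac_const DIM('a) s" using s by (rule frac_const_pos)
  obtain \<kappa> where \<kappa>: "0 < \<kappa>" "\<And>r. 0 < r \<Longrightarrow> \<kappa> * r powr (?N - p) \<le> (LBINT z. far p r (z::'a))"
    unfolding far_def proof (rule integral_norm_powr_tail_ge[OF p(1)], goal_cases)
    case (1 C)
    from 1(2-) show ?case by (rule 1(1))
  qed
  \<comment> \<open>The second entry gives 4 2^p \<mu> <= \<kappa> r, and r >= 1 gives r <= r^N.
    Hence the return of long jumps to the level set costs at most q/4, with \<open>q\<close> below
    as lower bound for the mass of the far kernel.\<close>
  define r where "r = max 1 (4 * (2 powr p * \<mu>) / \<kappa>)"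
  have r: "1 \<le> r" "0 < r" by (auto simp: r_def)
  define q where "q = \<kappa> * r powr (?N - p)"
  have q: "0 < q" using \<kappa>(1) r by (simp add: q_def)
  have B: "2 powr p * r powr - p * \<mu> \<le> q / 4"
  proof -
    have "4 * (2 powr p * \<mu>) / \<kappa> \<le> r" by (simp add: r_def)
    then have "4 * (2 powr p * \<mu>) \<le> \<kappa> * r" using \<kappa>(1) by (simp add: pos_divide_le_eq mult.commute)
    also have "\<kappa> * r \<le> \<kappa> * r powr ?N"
    proof (intro mult_left_mono)
      have "r powr 1 \<le> r powr ?N" using r DIM_positive[where 'a='a] by (intro powr_mono) (auto simp: Suc_le_eq)
      then show "r \<le> r powr ?N" using r by simp
    qed (use \<kappa> in auto)
    finally have "(2 powr p * \<mu>) * r powr - p \<le> (\<kappa> * r powr ?N / 4) * r powr - p"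
      by (intro mult_right_mono) auto
    also have "\<dots> = q / 4" by (simp add: q_def powr_add[symmetric])
    finally show ?thesis by (simp add: mult_ac)
  qed
  obtain C where C: "0 \<le> C" "\<And>T \<delta> r y::'a. \<lbrakk>0 < \<delta>; \<delta> \<le> r; 2 * r \<le> T\<rbrakk> \<Longrightarrow>
      (LBINT x. wt p T x * near p \<delta> r (x - y)) \<le>
      ((LBINT z. near p \<delta> r (z::'a))
        + C / T\<^sup>2 * (LBINT z. indicator {z. norm z \<le> r} z * ((norm z)\<^sup>2 * norm (z::'a) powr - p))) * wt p T y"
    proof (rule near_wt_le[OF p(1,2)], goal_cases)
    case (1 C)
    from 1(2-) show ?case by (rule 1(1))
  qed
  define I where "I = (LBINT z. indicator {z. norm z \<le> r} z * ((norm z)\<^sup>2 * norm (z::'a) powr - p))"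
  have I: "0 \<le> I" unfolding I_def by (intro integral_nonneg_AE) auto
  \<comment> \<open>\<open>C\<close> and \<open>I\<close> are known once r is fixed. The entry
    \<open>2 * r\<close> is what \<open>near_wt_le\<close> requires; the other one makes C I / T^2
    at most q/4, since T <= T^2.\<close>
  define T where "T = max (2 * r) (4 * (C * I) / q)"
  have T: "1 \<le> T" "0 < T" "2 * r \<le> T" "r \<le> T" using r by (auto simp: T_def)
  define \<eta> where "\<eta> = C / T\<^sup>2 * I"
  have \<eta>: "\<eta> \<le> q / 4"
  proof -
    have "4 * (C * I) / q \<le> T" by (simp add: T_def)
    then have "4 * (C * I) \<le> q * T" using q by (simp add: pos_divide_le_eq mult.commute)
    also have "\<dots> \<le> q * T\<^sup>2" using T q self_le_power[of T 2] by (intro mult_left_mono) auto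
    finally show ?thesis using T by (simp add: \<eta>_def pos_divide_le_eq mult.commute)
  qed

  define \<epsilon> where "\<epsilon> n = 1 / real (Suc n)" for n
  have \<epsilon>: "0 < \<epsilon> n" "\<epsilon> n \<le> 1" for n by (auto simp: \<epsilon>_def)
  have m: "tame p T (moll (\<epsilon> n) :: 'a \<Rightarrow> real)" for n by (intro tame_moll p T \<epsilon>)
  note Um [measurable] = U_measurable and wU = wt_U_integrable[OF T(2)]
  have k: "integrable lborel k" by (intro L1_diff f u_integrable)
  then have km [measurable]: "k \<in> borel_measurable borel" using borel_measurable_integrable by force
  note wk = wt_integrable[OF k, of T]
  define Vn where "Vn n = conv U (moll (\<epsilon> n))" for n
  define kn where "kn n = conv k (moll (\<epsilon> n))" for n
  have Vnm [measurable]: "Vn n \<in> borel_measurable borel" and wVn: "wL1 p T (Vn n)" for n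
    unfolding Vn_def by (rule measurable_conv[OF T(2) p(1) m Um wU] integrable_wt_conv[OF T(2) p(1) m Um wU])+
  have knm [measurable]: "kn n \<in> borel_measurable borel" and wkn: "wL1 p T (kn n)" for n
    unfolding kn_def by (rule measurable_conv[OF T(2) p(1) m km wk] integrable_wt_conv[OF T(2) p(1) m km wk])+
  have wref: "integrable lborel (\<lambda>x. wt p T x * (g (hyp_refl a b x) - g x))"
    if "g \<in> borel_measurable borel" "wL1 p T g" for g :: "'a \<Rightarrow> real"
  proof -
    have "integrable lborel (\<lambda>x. wt p T x * g (hyp_refl a b x))"
    proof (rule wt_hyp_refl_integral[OF p(3) a, of T b], goal_cases)
      case (1 C)
      from 1(2)[OF that] show ?case by (rule conjunct1)
    qed
    from L1_diff[OF this that(2)] show ?thesis by (simp add: right_diff_distrib)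
  qed
  define Zn where "Zn n x = Vn n (hyp_refl a b x) - Vn n x" for n x
  \<comment> \<open>The operator carries the factor \<open>frac_const DIM('a) s / 2\<close>, so half
    the integral of the second differences is the mollified \<open>k\<close> divided by
    \<open>frac_const DIM('a) s\<close>.\<close>
  define \<kappa>n where "\<kappa>n n x = (kn n (hyp_refl a b x) - kn n x) / frac_const DIM('a) s" for n x
  define \<kappa>' where "\<kappa>' x = (k (hyp_refl a b x) - k x) / frac_const DIM('a) s" for x
  have Znm [measurable]: "Zn n \<in> borel_measurable borel" for n unfolding Zn_def[abs_def] by measurable
  have \<kappa>nm [measurable]: "\<kappa>n n \<in> borel_measurable borel" for n unfolding \<kappa>n_def[abs_def] by measurable
  have \<kappa>m [measurable]: "\<kappa>' \<in> borel_measurable borel" unfolding \<kappa>'_def[abs_def] by measurable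
  have wZn: "wL1 p T (Zn n)" for n unfolding Zn_def by (intro wref Vnm wVn)
  have w\<kappa>n: "wL1 p T (\<kappa>n n)" for n
    unfolding \<kappa>n_def times_divide_eq_right by (intro integrable_divide wref knm wkn)
  have w\<kappa>: "wL1 p T \<kappa>'"
    unfolding \<kappa>'_def times_divide_eq_right by (intro integrable_divide wref km wk)
  have anti: "Zn n (hyp_refl a b x) = - Zn n x" for n x using a by (simp add: Zn_def)
  have Zn_eq: "Zn n = (\<lambda>x. Vn n (hyp_refl a b x) - Vn n x)" for n by (auto simp: Zn_def)
  note sd = antisym_sdiff[OF p(3) a Vnm integrable_sdiff_conv[OF \<epsilon> p(1,2) T(2) Um wU, folded Vn_def]
      integrable_wt_sdiff_conv[OF \<epsilon> p(1,2) T(2) Um wU, folded Vn_def], where b = b, folded Zn_eq]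
  have half: "(LBINT z. sdiff (Zn n) x z * norm z powr - p) / 2 = \<kappa>n n x" for n x
  proof -
    have eq: "(LBINT z. sdiff (Vn n) x z * norm z powr - p) = 2 * kn n x / frac_const DIM('a) s" for x
      using mollified_equation[OF \<epsilon>, of n x] c0 unfolding Vn_def kn_def by (simp add: field_simps)
    show ?thesis unfolding sd(2) eq \<kappa>n_def by (simp add: diff_divide_distrib)
  qed
  have ineq: "((LBINT z. far p r (z::'a)) - \<eta>) * (LBINT x. wt p T x * excess a b \<theta> (Zn n) x)
      - (LBINT x. wt p T x * (indicator (superlevel a b \<theta> (Zn n)) x * conv (excess a b \<theta> (Zn n)) (far p r) x))
      \<le> (LBINT x. wt p T x * (indicator (superlevel a b \<theta> (Zn n)) x * \<kappa>n n x))" for n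
    unfolding half[symmetric]
  proof (rule core_smooth[OF p(1) T(2) a _ Znm wZn anti sd(1) sd(3) r(2)])
    show "(LBINT x. wt p T x * near p \<delta> r (x - y)) \<le> ((LBINT z. near p \<delta> r (z::'a)) + \<eta>) * wt p T y"
      if "0 < \<delta>" "\<delta> \<le> r" for \<delta> and y :: 'a
      using C(2)[OF that T(3), of y] by (simp add: \<eta>_def I_def)
  qed (use \<theta> in simp)
  have limU: "(\<lambda>n. LBINT x. wt p T x * \<bar>Vn n x - U x\<bar>) \<longlonglongrightarrow> 0"
    unfolding Vn_def \<epsilon>_def by (rule conv_moll_tendsto[OF T(2) p(1) Um wU])
  have limk: "(\<lambda>n. LBINT x. wt p T x * \<bar>kn n x - k x\<bar>) \<longlonglongrightarrow> 0"
    unfolding kn_def \<epsilon>_def by (rule conv_moll_tendsto[OF T(2) p(1) km wk])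
  have limZ: "(\<lambda>n. LBINT x. wt p T x * \<bar>Zn n x - Z x\<bar>) \<longlonglongrightarrow> 0"
    unfolding Zn_def by (rule antisym_tendsto[OF p(3) a Vnm wVn Um wU limU])
  have lim\<kappa>: "(\<lambda>n. LBINT x. wt p T x * \<bar>\<kappa>n n x - \<kappa>' x\<bar>) \<longlonglongrightarrow> 0"
  proof -
    have "wt p T x * \<bar>\<kappa>n n x - \<kappa>' x\<bar> = wt p T x * \<bar>(kn n (hyp_refl a b x) - kn n x) - (k (hyp_refl a b x) - k x)\<bar> / frac_const DIM('a) s" for n x
      using c0 by (simp add: \<kappa>n_def \<kappa>'_def diff_divide_distrib[symmetric] abs_divide)
    then show ?thesis
      using tendsto_divide[OF antisym_tendsto[OF p(3) a knm wkn km wk limk, of b] tendsto_const[of "frac_const DIM('a) s"]] c0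
      by simp
  qed
  have wZ: "wL1 p T Z" by (rule wref[OF Um wU])
  \<comment> \<open>Weighted L1 convergence yields almost everywhere convergence only along a
    subsequence, to which the limit argument is then restricted.\<close>
  have "\<exists>\<rho>::nat \<Rightarrow> nat. strict_mono \<rho> \<and> (AE x in lborel. (\<lambda>n. wt p T x * (Zn (\<rho> n) x - Z x)) \<longlonglongrightarrow> 0)"
  proof (rule tendsto_L1_AE_subseq)
    show "integrable lborel (\<lambda>x. wt p T x * (Zn n x - Z x))" for n
      using L1_diff[OF wZn[of n] wZ] by (simp add: right_diff_distrib)
    show "(\<lambda>n. LBINT x. norm (wt p T x * (Zn n x - Z x))) \<longlonglongrightarrow> 0"
      using limZ by (simp add: abs_mult)
  qed
  then obtain \<rho> :: "nat \<Rightarrow> nat" where \<rho>: "strict_mono \<rho>"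
    and AE_lim: "AE x in lborel. (\<lambda>n. wt p T x * (Zn (\<rho> n) x - Z x)) \<longlonglongrightarrow> 0" by blast
  have AE_Z: "AE x in lborel. (\<lambda>n. Zn (\<rho> n) x) \<longlonglongrightarrow> Z x"
    using AE_lim
  proof eventually_elim
    case (elim x)
    have "wt p T x \<noteq> 0" using wt_pos[of p T x] by linarith
    then have "(\<lambda>n. Zn (\<rho> n) x - Z x) \<longlonglongrightarrow> 0"
      using tendsto_mult_left[OF elim, of "inverse (wt p T x)"] by (simp add: mult.assoc[symmetric])
    then show ?case by (simp add: LIM_zero_iff)
  qed
  \<comment> \<open>As \<open>spow m\<close> is strictly increasing,
    \<open>\<theta> \<le> Z x\<close> orders the two values of \<open>u\<close>, and
    \<open>mono\<close> orders those of \<open>f\<close>; both contributions to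
    \<open>\<kappa>'\<close> are then nonpositive.\<close>
  have neg: "AE x in lborel. b < a \<bullet> x \<longrightarrow> \<theta> \<le> Z x \<longrightarrow> \<kappa>' x \<le> 0"
    using mono
  proof (eventually_elim, intro impI)
    fix x
    assume fx: "a \<bullet> x > b \<longrightarrow> f x \<ge> f (hyp_refl a b x)" and x: "b < a \<bullet> x" and Zx: "\<theta> \<le> Z x"
    have "u x \<le> u (hyp_refl a b x)"
    proof (rule ccontr)
      assume "\<not> u x \<le> u (hyp_refl a b x)"
      then have "U (hyp_refl a b x) < U x" by (intro spow_strict_mono m_pos) simp
      then show False using Zx \<theta> by simp
    qed
    then have "k (hyp_refl a b x) - k x \<le> 0" using fx x by simp
    then show "\<kappa>' x \<le> 0" using c0 by (simp add: \<kappa>'_def divide_nonpos_pos)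
  qed
  show ?thesis
  proof (rule level_set_null[OF p(1) T(2) \<theta> r(2) Znm wZn _ wZ \<kappa>nm w\<kappa>n \<kappa>m w\<kappa> ineq _ _ AE_Z neg])
    show "Z \<in> borel_measurable borel" by measurable
    show "(\<lambda>n. LBINT x. wt p T x * \<bar>Zn (\<rho> n) x - Z x\<bar>) \<longlonglongrightarrow> 0"
      using LIMSEQ_subseq_LIMSEQ[OF limZ \<rho>] by (simp add: o_def)
    show "(\<lambda>n. LBINT x. wt p T x * \<bar>\<kappa>n (\<rho> n) x - \<kappa>' x\<bar>) \<longlonglongrightarrow> 0"
      using LIMSEQ_subseq_LIMSEQ[OF lim\<kappa> \<rho>] by (simp add: o_def)
    show "(LBINT x. wt p T x * indicator ?F x * far p r (x - y)) \<le> (2 powr p * r powr - p * \<mu>) * wt p T y" for y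
      unfolding \<mu>_def by (rule far_level_le[OF p(3) r(2) T(4) level_set_measurable level_set_finite[OF \<theta>]])
    \<comment> \<open>Each of the two errors is at most q/4, while the far kernel has mass at least
      q.\<close>
    show "\<eta> + 2 powr p * r powr - p * \<mu> < (LBINT z. far p r (z::'a))"
      using \<eta> B q \<kappa>(2)[OF r(2)] unfolding q_def by linarith
  qed
qed

text \<open>The levels 1/(n + 1) leave only countably many null exceptional sets. In the limit
  \<open>Z x \<le> 0\<close>, and strict monotonicity of \<open>spow m\<close> carries this back to
  \<open>u\<close>.\<close>

lemma solution_reflection_le: "AE x in lborel. a \<bullet> x > b \<longrightarrow> u x \<ge> u (hyp_refl a b x)"
proof -
  have "AE x in lborel. \<forall>n::nat. b < a \<bullet> x \<longrightarrow> Z x \<le> 1 / real (Suc n)"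
    unfolding AE_all_countable by (intro allI level_bound) simp
  then show ?thesis
  proof (eventually_elim, intro impI)
    fix x
    assume le: "\<forall>n::nat. b < a \<bullet> x \<longrightarrow> Z x \<le> 1 / real (Suc n)" and x: "a \<bullet> x > b"
    have "Z x \<le> 0"
    proof (rule tendsto_lowerbound[OF LIMSEQ_inverse_real_of_nat])
      show "\<forall>\<^sub>F n in sequentially. Z x \<le> inverse (real (Suc n))" using le x by (simp add: divide_inverse)
    qed simp
    show "u x \<ge> u (hyp_refl a b x)"
    proof (rule ccontr)
      assume "\<not> u x \<ge> u (hyp_refl a b x)"
      then have "U x < U (hyp_refl a b x)" by (intro spow_strict_mono m_pos) simp
      then show False using \<open>Z x \<le> 0\<close> by simp
    qed
  qed
qed

end
end

theorem theorem15p1: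
  fixes s m b :: real and a :: "'a::euclidean_space"
    and f u :: "'a \<Rightarrow> real"
  assumes "0 < s" "s < 1" "0 < m"
    and "integrable lborel f" "AE x in lborel. f x \<ge> 0"
    and "frac_weak_sol s m f u"
    and "\<forall>v. frac_weak_sol s m f v \<longrightarrow> (AE x in lborel. v x = u x)"
    and "a \<noteq> 0"
    and "AE x in lborel. a \<bullet> x > b \<longrightarrow> f x \<ge> f (hyp_refl a b x)"
  shows "AE x in lborel. a \<bullet> x > b \<longrightarrow> u x \<ge> u (hyp_refl a b x)"
  by (rule solution_reflection_le[OF assms(1,2) refl assms(4,6,8,3,9)])

end
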